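(* Let $\mu,\nu$ be two Borel probability measures on $\mathbb R$, neither of them a point mass, and let $\mu\boxplus\nu$ be their free additive convolution. Then: (1) The point $a\in\mathbb R$ is an atom of the measure $\mu\boxplus\nu$ if and only if there exist $b,c\in\mathbb R$ such that $a=b+c$ and $\mu(\{b\})+\nu(\{c\})>1$. Moreover, $(\mu\boxplus\nu)(\{a\})=\mu(\{b\})+\nu(\{c\})-1$. (2) The absolutely continuous part $(\mu\boxplus\nu)^{ac}$ of $\mu\boxplus\nu$ is always nonzero, and its density is analytic wherever positive and finite. More precisely, there exists an open set $U\subseteq\mathbb R$ so that the density function $f(x)=\frac{d(\mu\boxplus\nu)^{ac}(x)}{dx}$ with respect to the Lebesgue measure on the real line is analytic on $U$ and $(\mu\boxplus\nu)^{ac}(\mathbb R)=\int_U f(x)\,dx$. (3) The singular continuous part of $\mu\boxplus\nu$ is zero.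
   Context: All measures are Borel measures. "Absolutely continuous", "singular" and "singular continuous" are with respect to Lebesgue measure on $\mathbb R$; for a finite positive Borel measure $\sigma$ on $\mathbb R$, $\sigma^{ac}$ denotes its absolutely continuous part in the Lebesgue decomposition. A point mass is a Dirac measure $\delta_a$, and an atom of a measure $\sigma$ is a point $a\in\mathbb R$ with $\sigma(\{a\})>0$. The density $f$ is defined up to a Lebesgue-null set; analyticity on $U$ means that the density has a version that is real-analytic on $U$. Free additive convolution: $\mu\boxplus\nu$ is the distribution of $X+Y$, where $X,Y$ are freely independent selfadjoint operators (possibly unbounded) affiliated with a von Neumann algebra with a normal faithful tracial state, having distributions $\mu$ and $\nu$ respectively. Equivalent purely analytic definition: let $\mathbb C^+=\{z\in\mathbb C:\Im z>0\}$ and, for a probability measure $\sigma$ on $\mathbb R$, let $G_\sigma(z)=\int_{\mathbb R}\frac{d\sigma(t)}{z-t}$ and $F_\sigma(z)=1/G_\sigma(z)$ for $z\in\mathbb C^+$. There exist unique analytic functions $\omega_1,\omega_2:\mathbb C^+\to\mathbb C^+$ such that $\Im\omega_j(z)\ge\Im z$ for all $z\in\mathbb C^+$, $\lim_{y\to+\infty}\omega_j(iy)/(iy)=1$ for $j=1,2$, $F_\mu(\omega_1(z))=F_\nu(\omega_2(z))$, and $\omega_1(z)+\omega_2(z)=z+F_\mu(\omega_1(z))$ for all $z\in\mathbb C^+$; then $\mu\boxplus\nu$ is the unique Borel probability measure on $\mathbb R$ with $F_{\mu\boxplus\nu}=F_\mu\circ\omega_1=F_\nu\circ\omega_2$. 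*)

theory Defs
  imports "HOL-Probability.Probability"
begin

section \<open>Free additive convolution\<close>

definition upper_half_plane :: "complex set"
  where "upper_half_plane = {z. Im z > 0}"

definition cauchy_transform :: "real measure \<Rightarrow> complex \<Rightarrow> complex"
  where "cauchy_transform \<sigma> z = (LINT t|\<sigma>. 1 / (z - complex_of_real t))"

definition F_transform :: "real measure \<Rightarrow> complex \<Rightarrow> complex"
  where "F_transform \<sigma> z = 1 / cauchy_transform \<sigma> z"

text \<open>The values of \<open>\<omega>1\<close> and \<open>\<omega>2\<close> outside the upper half-plane are irrelevant.\<close>

definition subordination_pair ::
    "real measure \<Rightarrow> real measure \<Rightarrow> (complex \<Rightarrow> complex) \<Rightarrow> (complex \<Rightarrow> complex) \<Rightarrow> bool"
  where "subordination_pair \<mu> \<nu> \<omega>1 \<omega>2 \<longleftrightarrow>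
    (\<forall>\<omega>\<in>{\<omega>1, \<omega>2}.
       \<omega> holomorphic_on upper_half_plane \<and>
       \<omega> ` upper_half_plane \<subseteq> upper_half_plane \<and>
       (\<forall>z\<in>upper_half_plane. Im (\<omega> z) \<ge> Im z) \<and>
       ((\<lambda>y::real. \<omega> (\<i> * of_real y) / (\<i> * of_real y)) \<longlongrightarrow> 1) at_top) \<and>
    (\<forall>z\<in>upper_half_plane.
       F_transform \<mu> (\<omega>1 z) = F_transform \<nu> (\<omega>2 z) \<and>
       \<omega>1 z + \<omega>2 z = z + F_transform \<mu> (\<omega>1 z))"

text \<open>For Borel probability measures \<open>\<mu>\<close> and \<open>\<nu>\<close> the subordination pair, and hence the
  measure described here, exists and is unique.\<close>

definition free_conv :: "real measure \<Rightarrow> real measure \<Rightarrow> real measure"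
  where "free_conv \<mu> \<nu> =
    (THE \<rho>. real_distribution \<rho> \<and>
       (\<exists>\<omega>1 \<omega>2. subordination_pair \<mu> \<nu> \<omega>1 \<omega>2 \<and>
          (\<forall>z\<in>upper_half_plane.
             F_transform \<rho> z = F_transform \<mu> (\<omega>1 z) \<and>
             F_transform \<rho> z = F_transform \<nu> (\<omega>2 z))))"

section \<open>Lebesgue decomposition\<close>

definition lebesgue_singular :: "real measure \<Rightarrow> bool"
  where "lebesgue_singular \<sigma> \<longleftrightarrow> (\<exists>N\<in>null_sets lborel. emeasure \<sigma> (UNIV - N) = 0)"

text \<open>The decomposition \<open>\<sigma> = \<alpha> + \<beta> + \<delta>\<close> into an absolutely continuous, a singular continuous
  (singular and atomless) and a discrete (carried by a countable set) measure. It exists and is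
  unique for every finite Borel measure \<open>\<sigma>\<close>; the singular part of the two-term Lebesgue
  decomposition is \<open>\<beta> + \<delta>\<close>.\<close>

definition lebesgue_decomposition ::
    "real measure \<Rightarrow> real measure \<Rightarrow> real measure \<Rightarrow> real measure \<Rightarrow> bool"
  where "lebesgue_decomposition \<sigma> \<alpha> \<beta> \<delta> \<longleftrightarrow>
    sets \<alpha> = sets borel \<and> sets \<beta> = sets borel \<and> sets \<delta> = sets borel \<and>
    (\<forall>A\<in>sets borel. emeasure \<sigma> A = emeasure \<alpha> A + emeasure \<beta> A + emeasure \<delta> A) \<and>
    absolutely_continuous lborel \<alpha> \<and>
    lebesgue_singular \<beta> \<and> (\<forall>x. emeasure \<beta> {x} = 0) \<and>
    (\<exists>C. countable C \<and> emeasure \<delta> (UNIV - C) = 0)"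

definition ac_part :: "real measure \<Rightarrow> real measure"
  where "ac_part \<sigma> = (THE \<alpha>. \<exists>\<beta> \<delta>. lebesgue_decomposition \<sigma> \<alpha> \<beta> \<delta>)"

definition sc_part :: "real measure \<Rightarrow> real measure"
  where "sc_part \<sigma> = (THE \<beta>. \<exists>\<alpha> \<delta>. lebesgue_decomposition \<sigma> \<alpha> \<beta> \<delta>)"

section \<open>Real-analytic functions\<close>

definition real_analytic_on :: "(real \<Rightarrow> real) \<Rightarrow> real set \<Rightarrow> bool"
  where "real_analytic_on g U \<longleftrightarrow> (\<forall>x\<in>U. \<exists>P. (\<lambda>h. g (x + h)) has_fps_expansion P)"

text \<open>A density, given with values in \<^typ>\<open>ennreal\<close>, is only determined almost everywhere. The
  condition \<open>0 \<le> g x\<close> is needed because \<^const>\<open>ennreal\<close> sends negative reals to \<open>0\<close>.\<close>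

definition has_analytic_version_on :: "(real \<Rightarrow> ennreal) \<Rightarrow> real set \<Rightarrow> bool"
  where "has_analytic_version_on f U \<longleftrightarrow>
    (\<exists>g. real_analytic_on g U \<and> (\<forall>x\<in>U. 0 \<le> g x) \<and>
         (AE x in lborel. x \<in> U \<longrightarrow> f x = ennreal (g x)))"

end

theory Submission
  imports Defs "HOL-Complex_Analysis.Complex_Analysis"
begin

text \<open>
Write \<open>G\<close> for the Cauchy transform of a measure, \<open>F = 1 / G\<close> and \<open>h = F - id\<close>. Unless the measure is
a point mass, \<open>h\<close> maps the upper half-plane \<open>H\<close> into itself. The equations for the subordination
functions read \<open>\<omega>1 = z + h\<^sub>\<nu>(\<omega>2)\<close> and \<open>\<omega>2 = z + h\<^sub>\<mu>(\<omega>1)\<close>, so \<open>\<omega>1(z)\<close> is a fixed point of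
\<open>w \<mapsto> z + h\<^sub>\<nu>(z + h\<^sub>\<mu>(w))\<close>. This map sends \<open>H\<close> into \<open>{Im w > Im z}\<close> and therefore contracts the
hyperbolic distance strictly, which makes the fixed point unique (\<open>subordination_unique\<close>); the
iterates of the map form a normal family, and their limit is the fixed point
(\<open>subordination_exists\<close>). That \<open>G\<^sub>\<mu> \<circ> \<omega>1\<close> is the Cauchy transform of a probability measure follows
from the Poisson formula on the lines \<open>Im z = \<epsilon>\<close> and a tightness argument as \<open>\<epsilon> \<rightarrow> 0\<close>
(\<open>cauchy_transform_exists\<close>), and Stieltjes inversion shows that this measure is unique. So the free
convolution \<open>\<rho>\<close> is well defined and obeys the subordination equations (\<open>subordination_free_conv\<close>).

The regularity of \<open>\<rho>\<close> rests on one identity. Let \<open>q\<^sub>\<sigma>(w) = Im w / Im F\<^sub>\<sigma>(w)\<close>. Taking imaginary parts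
in \<open>\<omega>1 + \<omega>2 = z + F\<^sub>\<rho>(z)\<close> gives
\<open>q\<^sub>\<mu>(\<omega>1(z)) + q\<^sub>\<nu>(\<omega>2(z)) = 1 + Im z / Im F\<^sub>\<rho>(z)\<close> (\<open>energy_ratio_sum\<close>).
By the Cauchy--Schwarz inequality, if \<open>F\<^sub>\<sigma>(w\<^sub>n) \<rightarrow> 0\<close> then the upper limit of \<open>q\<^sub>\<sigma>(w\<^sub>n)\<close> is at most
\<open>\<sigma>({b})\<close> when \<open>w\<^sub>n \<rightarrow> b\<close>, and it is \<open>0\<close> when \<open>w\<^sub>n \<rightarrow> \<infinity>\<close>. Hence \<open>F\<^sub>\<rho>(z\<^sub>n) \<rightarrow> 0\<close> with \<open>z\<^sub>n \<rightarrow> x\<close> forces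
\<open>x = b + c\<close> with \<open>\<mu>({b}) + \<nu>({c}) \<ge> 1 + lim (Im z\<^sub>n / Im F\<^sub>\<rho>(z\<^sub>n))\<close> (\<open>heavy_pair_of_F_tendsto_0\<close>). At an
atom of \<open>\<rho>\<close> the last limit is its mass, and this is the upper half of the formula for the atoms; the
lower half is an application of Julia's inequality for horodiscs (\<open>atom_lower_bound\<close>).

Outside the countable set of sums \<open>b + c\<close> with \<open>\<mu>({b}) + \<nu>({c}) \<ge> 1\<close> it follows that \<open>G\<^sub>\<rho>(x + iy)\<close> stays
bounded as \<open>y \<rightarrow> 0\<close>. If \<open>Im G\<^sub>\<rho>(x + iy)\<close> does not tend to \<open>0\<close>, then \<open>\<omega>1\<close> and \<open>\<omega>2\<close> have limit points
\<open>w1, w2\<close> inside \<open>H\<close>, and \<open>w1\<close> is a fixed point of \<open>w \<mapsto> x + h\<^sub>\<nu>(x + h\<^sub>\<mu>(w))\<close>. By the Schwarz lemma the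
derivative there differs from \<open>1\<close> unless this map is the identity, which happens for at most one real
\<open>x\<close>; so the inverse function theorem continues \<open>\<omega>1\<close>, and with it \<open>G\<^sub>\<rho>\<close>, analytically across \<open>x\<close>. The
points with \<open>Im G\<^sub>\<rho>(x + iy) \<rightarrow> 0\<close> have vanishing symmetric derivative of \<open>\<rho>\<close> and carry no mass by
Vitali's covering lemma. Consequently \<open>\<rho>\<close> lives on a countable set together with an open set \<open>U\<close> on
which it has the analytic density \<open>- Im G\<^sub>\<rho> / \<pi> > 0\<close>. There is no room for a singular continuous part,
and \<open>U\<close> is nonempty because the atoms never have total mass one (\<open>emeasure_countable_less_1\<close>).
\<close>

section \<open>Cauchy transforms of probability measures\<close>

lemma norm_diff_real_ge_Im: "Im z \<le> norm (z - of_real t)"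
  using abs_Im_le_cmod[of "z - of_real t"] by simp

lemma diff_real_nonzero: "Im z > 0 \<Longrightarrow> z - of_real t \<noteq> 0"
  by (metis complex.sel Im_complex_of_real eq_iff_diff_eq_0 less_irrefl)

lemma norm_cauchy_kernel_le:
  assumes "Im z > 0" shows "norm (1 / (z - of_real t)) \<le> 1 / Im z"
  using assms norm_diff_real_ge_Im[of z t] diff_real_nonzero[OF assms, of t]
  by (simp add: norm_divide frac_le)

text \<open>The squared \<open>L\<^sup>2\<close>-norm of the Cauchy kernel; up to the factor \<open>- Im z\<close> this is the imaginary part of
  the Cauchy transform.\<close>

definition cauchy_energy :: "real measure \<Rightarrow> complex \<Rightarrow> real"
  where "cauchy_energy \<sigma> z = (LINT t|\<sigma>. 1 / (norm (z - of_real t))\<^sup>2)"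

definition h_transform :: "real measure \<Rightarrow> complex \<Rightarrow> complex"
  where "h_transform \<sigma> z = F_transform \<sigma> z - z"

context real_distribution
begin

lemma prob_UNIV [simp]: "prob UNIV = 1"
  using prob_space by simp

lemma integrable_cauchy_kernel:
  assumes "Im z > 0"
  shows "integrable M (\<lambda>t. 1 / (z - of_real t))"
proof (rule integrable_const_bound[where B = "1 / Im z"])
  show "AE t in M. norm (1 / (z - of_real t)) \<le> 1 / Im z"
    using norm_cauchy_kernel_le[OF assms] by blast
qed simp

lemma integrable_cauchy_kernel_sq:
  assumes "Im z > 0"
  shows "integrable M (\<lambda>t. 1 / (norm (z - of_real t))\<^sup>2)"
proof (rule integrable_const_bound[where B = "1 / (Im z)\<^sup>2"])
  show "AE t in M. norm (1 / (norm (z - of_real t))\<^sup>2) \<le> 1 / (Im z)\<^sup>2"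
    using assms norm_diff_real_ge_Im[of z] diff_real_nonzero[OF assms]
    by (auto simp: norm_divide intro!: divide_left_mono power_mono mult_pos_pos)
qed simp

lemma norm_cauchy_transform_le:
  assumes "Im z > 0"
  shows "norm (cauchy_transform M z) \<le> 1 / Im z"
proof -
  have "norm (cauchy_transform M z) \<le> (LINT t|M. 1 / Im z)"
    unfolding cauchy_transform_def
    using integrable_cauchy_kernel[OF assms] norm_cauchy_kernel_le[OF assms]
    by (intro Bochner_Integration.integral_norm_bound_integral) auto
  then show ?thesis by (simp add: prob_space)
qed

lemma Im_cauchy_kernel: 
  assumes "Im z > 0"
  shows "Im (1 / (z - of_real t)) = - Im z * (1 / (norm (z - of_real t))\<^sup>2)"
  by (simp add: Im_divide cmod_power2)

lemma Im_cauchy_transform: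
  assumes "Im z > 0"
  shows "Im (cauchy_transform M z) = - Im z * cauchy_energy M z"
proof -
  have "Im (cauchy_transform M z) = (LINT t|M. Im (1 / (z - of_real t)))"
    unfolding cauchy_transform_def using integrable_cauchy_kernel[OF assms] by simp
  also have "\<dots> = (LINT t|M. - Im z * (1 / (norm (z - of_real t))\<^sup>2))"
    by (simp only: Im_cauchy_kernel[OF assms])
  also have "\<dots> = - Im z * cauchy_energy M z"
    unfolding cauchy_energy_def by (rule integral_mult_right_zero)
  finally show ?thesis .
qed

text \<open>The variance of the kernel \<open>1 / (z - t)\<close> under the measure. It is nonnegative, and it vanishes only
  for a point mass; this is what makes \<^const>\<open>h_transform\<close> a self-map of the half-plane.\<close>

lemma cauchy_variance:
  assumes "Im z > 0"
  defines "G \<equiv> cauchy_transform M z"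
  shows "(LINT t|M. (norm (1 / (z - of_real t) - G))\<^sup>2) = cauchy_energy M z - (norm G)\<^sup>2"
    and "integrable M (\<lambda>t. (norm (1 / (z - of_real t) - G))\<^sup>2)"
proof -
  have eq: "(norm (1 / (z - of_real t) - G))\<^sup>2
      = 1 / (norm (z - of_real t))\<^sup>2 - 2 * Re (cnj G * (1 / (z - of_real t))) + (norm G)\<^sup>2" for t
  proof -
    have inv: "1 / (norm (z - of_real t))\<^sup>2 = (norm (1 / (z - of_real t)))\<^sup>2"
      by (simp add: norm_divide power_divide)
    have expand: "(norm (w - G))\<^sup>2 = (norm w)\<^sup>2 - 2 * Re (cnj G * w) + (norm G)\<^sup>2" for w
      unfolding cmod_power2 by (simp add: power2_eq_square algebra_simps)
    show ?thesis unfolding inv by (rule expand)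
  qed
  have i1: "integrable M (\<lambda>t. 2 * Re (cnj G * (1 / (z - of_real t))))"
    by (rule integrable_mult_right, rule integrable_Re, rule integrable_mult_right,
        rule integrable_cauchy_kernel[OF assms(1)])
  note i2 = integrable_cauchy_kernel_sq[OF assms(1)]
  have i3: "integrable M (\<lambda>t. (norm G)\<^sup>2)" by simp
  note i12 = Bochner_Integration.integrable_diff[OF i2 i1]
  show "integrable M (\<lambda>t. (norm (1 / (z - of_real t) - G))\<^sup>2)"
    unfolding eq by (rule Bochner_Integration.integrable_add[OF i12 i3])
  have "(LINT t|M. 2 * Re (cnj G * (1 / (z - of_real t))))
      = 2 * (LINT t|M. Re (cnj G * (1 / (z - of_real t))))"
    by (rule integral_mult_right_zero)
  also have "(LINT t|M. Re (cnj G * (1 / (z - of_real t)))) = Re (LINT t|M. cnj G * (1 / (z - of_real t)))"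
    by (rule integral_Re, rule integrable_mult_right, rule integrable_cauchy_kernel[OF assms(1)])
  also have "(LINT t|M. cnj G * (1 / (z - of_real t))) = cnj G * G"
    unfolding G_def cauchy_transform_def by (rule integral_mult_right_zero)
  finally have c: "(LINT t|M. 2 * Re (cnj G * (1 / (z - of_real t)))) = 2 * Re (cnj G * G)" .
  have "(LINT t|M. (norm (1 / (z - of_real t) - G))\<^sup>2)
     = cauchy_energy M z - (LINT t|M. 2 * Re (cnj G * (1 / (z - of_real t)))) + (norm G)\<^sup>2"
    unfolding eq Bochner_Integration.integral_add[OF i12 i3] Bochner_Integration.integral_diff[OF i2 i1]
    by (simp add: cauchy_energy_def)
  also have "\<dots> = cauchy_energy M z - (norm G)\<^sup>2"
  proof -
    have "Re (cnj G * G) = (norm G)\<^sup>2"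
      unfolding cmod_power2 by (simp add: power2_eq_square)
    then show ?thesis unfolding c by linarith
  qed
  finally show "(LINT t|M. (norm (1 / (z - of_real t) - G))\<^sup>2) = cauchy_energy M z - (norm G)\<^sup>2" .
qed

lemma norm_cauchy_transform_sq_le:
  assumes "Im z > 0"
  shows "(norm (cauchy_transform M z))\<^sup>2 \<le> cauchy_energy M z"
proof -
  have "0 \<le> (LINT t|M. (norm (1 / (z - of_real t) - cauchy_transform M z))\<^sup>2)"
    by (rule integral_nonneg_AE) auto
  then show ?thesis using cauchy_variance[OF assms] by simp
qed

lemma eq_return_of_AE:
  assumes "AE t in M. t = c"
  shows "M = return borel c"
proof (rule measure_eqI)
  show "sets M = sets (return borel c)" by simp
  fix A assume A: "A \<in> sets M"
  have "emeasure M A = emeasure M (if c \<in> A then UNIV else {})"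
    using assms A by (intro emeasure_eq_AE) auto
  then show "emeasure M A = emeasure (return borel c) A"
    using A emeasure_space_1 by (auto simp: indicator_def)
qed

lemma cauchy_energy_pos:
  assumes "Im z > 0" shows "cauchy_energy M z > 0"
proof -
  have "(\<integral>t. 1 / (norm (z - of_real t))\<^sup>2 \<partial>M) \<noteq> 0"
  proof
    assume "(\<integral>t. 1 / (norm (z - of_real t))\<^sup>2 \<partial>M) = 0"
    then have "AE t in M. 1 / (norm (z - of_real t))\<^sup>2 = 0"
      using integral_nonneg_eq_0_iff_AE[OF integrable_cauchy_kernel_sq[OF assms]] by auto
    then have "AE t in M. False" using diff_real_nonzero[OF assms] by simp
    then show False by simp
  qed
  moreover have "(\<integral>t. 1 / (norm (z - of_real t))\<^sup>2 \<partial>M) \<ge> 0"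
    by (rule integral_nonneg_AE) auto
  ultimately show ?thesis unfolding cauchy_energy_def by linarith
qed

lemma norm_cauchy_transform_sq_less:
  assumes "Im z > 0" and np: "\<And>a. M \<noteq> return borel a"
  shows "(norm (cauchy_transform M z))\<^sup>2 < cauchy_energy M z"
proof (rule ccontr)
  assume "\<not> ?thesis"
  then have "(LINT t|M. (norm (1 / (z - of_real t) - cauchy_transform M z))\<^sup>2) = 0"
    using norm_cauchy_transform_sq_le[OF assms(1)] cauchy_variance(1)[OF assms(1)] by simp
  then have ae: "AE t in M. 1 / (z - of_real t) = cauchy_transform M z"
    using integral_nonneg_eq_0_iff_AE[OF cauchy_variance(2)[OF assms(1)]] by auto
  have "AE t in M. t = Re (z - 1 / cauchy_transform M z)"
    using ae
  proof eventually_elim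
    case (elim t)
    then show ?case
      by (metis Re_complex_of_real add_diff_cancel_left' diff_add_cancel div_by_1 divide_divide_eq_right
          mult_1)
  qed
  from eq_return_of_AE[OF this] np show False by blast
qed

lemma Im_cauchy_transform_neg:
  assumes "Im z > 0" shows "Im (cauchy_transform M z) < 0"
  using Im_cauchy_transform[OF assms] cauchy_energy_pos[OF assms] assms by simp

lemma cauchy_transform_nonzero: "Im z > 0 \<Longrightarrow> cauchy_transform M z \<noteq> 0"
  using Im_cauchy_transform_neg by fastforce

lemma Im_F_transform:
  assumes "Im z > 0"
  shows "Im (F_transform M z) = Im z * cauchy_energy M z / (norm (cauchy_transform M z))\<^sup>2"
  unfolding F_transform_def using Im_cauchy_transform[OF assms]
  by (simp add: Im_divide cmod_power2)

lemma Im_F_transform_ge: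
  assumes "Im z > 0" shows "Im (F_transform M z) \<ge> Im z"
  using norm_cauchy_transform_sq_le[OF assms] cauchy_transform_nonzero[OF assms] assms
  by (simp add: Im_F_transform divide_simps)

lemma Im_F_transform_greater:
  assumes "Im z > 0" "\<And>a. M \<noteq> return borel a" shows "Im (F_transform M z) > Im z"
  using norm_cauchy_transform_sq_less[OF assms] cauchy_transform_nonzero[OF assms(1)] assms(1)
  by (simp add: Im_F_transform divide_simps)

lemma Im_h_transform_pos:
  assumes "Im z > 0" "\<And>a. M \<noteq> return borel a" shows "Im (h_transform M z) > 0"
  using Im_F_transform_greater[OF assms] by (simp add: h_transform_def)

text \<open>The difference quotient and the claimed derivative differ by an integral with the explicit kernel
  \<open>(w - z) / ((z - t)\<^sup>2 (w - t))\<close>, which is of the order of \<open>w - z\<close> uniformly in \<open>t\<close>.\<close>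

lemma cauchy_transform_has_derivative:
  assumes z: "Im z > 0"
  shows "(cauchy_transform M has_field_derivative - (LINT t|M. 1 / (z - of_real t)\<^sup>2)) (at z)"
proof -
  have i2: "integrable M (\<lambda>t. 1 / (z - of_real t)\<^sup>2)"
  proof (rule integrable_const_bound[where B = "1 / (Im z)\<^sup>2"])
    show "AE t in M. norm (1 / (z - of_real t)\<^sup>2) \<le> 1 / (Im z)\<^sup>2"
      using assms norm_diff_real_ge_Im[of z] diff_real_nonzero[OF assms]
      by (auto simp: norm_divide norm_power intro!: divide_left_mono power_mono mult_pos_pos)
  qed simp
  define C where "C = 2 / (Im z) ^ 3"
  have bound: "norm ((cauchy_transform M w - cauchy_transform M z) / (w - z)
      - (- (LINT t|M. 1 / (z - of_real t)\<^sup>2))) \<le> C * norm (w - z)"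
    if w: "norm (w - z) < Im z / 2" "w \<noteq> z" for w
  proof -
    have wi: "Im w > Im z / 2"
      using w(1) abs_Im_le_cmod[of "w - z"] by (auto simp: abs_if split: if_splits)
    then have w0: "Im w > 0" using z by linarith
    have "(cauchy_transform M w - cauchy_transform M z) / (w - z) + (LINT t|M. 1 / (z - of_real t)\<^sup>2)
      = (LINT t|M. (1 / (w - of_real t) - 1 / (z - of_real t)) / (w - z) + 1 / (z - of_real t)\<^sup>2)"
      unfolding cauchy_transform_def
      using i2 integrable_cauchy_kernel[OF z] integrable_cauchy_kernel[OF w0] by simp
    also have "\<dots> = (LINT t|M. (w - z) / ((z - of_real t)\<^sup>2 * (w - of_real t)))"
    proof (rule Bochner_Integration.integral_cong[OF refl])
      fix t
      have "z - of_real t \<noteq> 0" "w - of_real t \<noteq> 0" "w - z \<noteq> 0"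
        using diff_real_nonzero z w0 w(2) by auto
      then show "(1 / (w - of_real t) - 1 / (z - of_real t)) / (w - z) + 1 / (z - of_real t)\<^sup>2
          = (w - z) / ((z - of_real t)\<^sup>2 * (w - of_real t))"
        by (simp add: divide_simps power2_eq_square) (simp add: algebra_simps)
    qed
    also have "norm \<dots> \<le> (LINT t|M. norm (w - z) * C)"
    proof (rule Bochner_Integration.integral_norm_bound_integral)
      have b: "norm ((w - z) / ((z - of_real t)\<^sup>2 * (w - of_real t))) \<le> norm (w - z) * C" for t
      proof -
        have "(Im z)\<^sup>2 * (Im z / 2) \<le> (norm (z - of_real t))\<^sup>2 * norm (w - of_real t)"
          using norm_diff_real_ge_Im[of z t] norm_diff_real_ge_Im[of w t] wi z
          by (intro mult_mono power_mono) auto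
        then have "1 / ((norm (z - of_real t))\<^sup>2 * norm (w - of_real t)) \<le> 1 / ((Im z)\<^sup>2 * (Im z / 2))"
          using z diff_real_nonzero[OF z, of t] diff_real_nonzero[OF w0, of t]
          by (intro divide_left_mono mult_pos_pos) auto
        also have "\<dots> = C" by (simp add: C_def power2_eq_square power3_eq_cube)
        finally have "norm (w - z) * (1 / ((norm (z - of_real t))\<^sup>2 * norm (w - of_real t))) \<le> norm (w - z) * C"
          by (intro mult_left_mono) auto
        then show ?thesis by (simp add: norm_divide norm_mult norm_power)
      qed
      then show "\<And>t. norm ((w - z) / ((z - of_real t)\<^sup>2 * (w - of_real t))) \<le> norm (w - z) * C" .
      show "integrable M (\<lambda>t. (w - z) / ((z - of_real t)\<^sup>2 * (w - of_real t)))"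
        by (rule integrable_const_bound[where B = "norm (w - z) * C"]) (use b in auto)
    qed auto
    finally show ?thesis by (simp add: prob_space mult.commute)
  qed
  have "((\<lambda>w. (cauchy_transform M w - cauchy_transform M z) / (w - z)
      - (- (LINT t|M. 1 / (z - of_real t)\<^sup>2))) \<longlongrightarrow> 0) (at z)"
  proof (rule Lim_null_comparison)
    show "\<forall>\<^sub>F w in at z. norm ((cauchy_transform M w - cauchy_transform M z) / (w - z)
      - (- (LINT t|M. 1 / (z - of_real t)\<^sup>2))) \<le> C * norm (w - z)"
      unfolding eventually_at using bound z
      by (intro exI[of _ "Im z / 2"]) (auto simp: dist_norm)
    have "((\<lambda>w. C * norm (w - z)) \<longlongrightarrow> C * norm (z - z)) (at z)"
      by (intro tendsto_intros)
    then show "((\<lambda>w. C * norm (w - z)) \<longlongrightarrow> 0) (at z)" by simp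
  qed
  then show ?thesis
    unfolding has_field_derivative_iff by (rule LIM_zero_cancel)
qed

lemma holomorphic_cauchy_transform: "cauchy_transform M holomorphic_on {z. Im z > 0}"
  using cauchy_transform_has_derivative
  by (auto simp: holomorphic_on_def field_differentiable_def intro: has_field_derivative_at_within)

lemma holomorphic_F_transform: "F_transform M holomorphic_on {z. Im z > 0}"
  unfolding F_transform_def[abs_def]
  by (intro holomorphic_intros holomorphic_cauchy_transform) (use cauchy_transform_nonzero in auto)

lemma holomorphic_h_transform: "h_transform M holomorphic_on {z. Im z > 0}"
  unfolding h_transform_def[abs_def]
  by (intro holomorphic_intros holomorphic_F_transform)

lemma isCont_cauchy_transform: "Im z > 0 \<Longrightarrow> isCont (cauchy_transform M) z"
  using cauchy_transform_has_derivative DERIV_isCont by blast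

lemma isCont_F_transform: "Im z > 0 \<Longrightarrow> isCont (F_transform M) z"
  unfolding F_transform_def[abs_def]
  by (intro continuous_intros isCont_cauchy_transform) (use cauchy_transform_nonzero in auto)

lemma isCont_h_transform: "Im z > 0 \<Longrightarrow> isCont (h_transform M) z"
  unfolding h_transform_def[abs_def] by (intro continuous_intros isCont_F_transform)

lemma tail_measure_tendsto_0: "(\<lambda>n. prob {t. \<bar>t\<bar> > real n}) \<longlonglongrightarrow> 0"
proof -
  have "(\<lambda>n. prob {t. \<bar>t\<bar> > real n}) \<longlonglongrightarrow> prob (\<Inter>n. {t. \<bar>t\<bar> > real n})"
    by (rule finite_Lim_measure_decseq) (auto simp: decseq_def)
  also have "(\<Inter>n. {t::real. \<bar>t\<bar> > real n}) = {}"
  proof -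
    have "\<not> (\<forall>n. real n < \<bar>x\<bar>)" for x
      using real_arch_simple[of "\<bar>x\<bar>"] by (meson not_less)
    then show ?thesis by blast
  qed
  finally show ?thesis by simp
qed

lemma tail_measure_small:
  assumes "\<epsilon> > 0" obtains R where "R > 0" "prob {t. \<bar>t\<bar> > R} < \<epsilon>"
proof -
  obtain N where N: "\<And>n. n \<ge> N \<Longrightarrow> prob {t. \<bar>t\<bar> > real n} < \<epsilon>"
    using order_tendstoD(2)[OF tail_measure_tendsto_0 assms] unfolding eventually_sequentially by auto
  show ?thesis using N[of "Suc N"] by (intro that[of "real (Suc N)"]) auto
qed

end

text \<open>In the cone \<open>|Re w| \<le> Im w\<close> the function \<open>w / (w - t)\<close> is bounded by \<open>2\<close> and tends to \<open>1\<close> for each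
  \<open>t\<close>, so \<open>w G(w) \<rightarrow> 1\<close> there, that is, \<open>F(w) / w \<rightarrow> 1\<close>. Heavy
  tails make the estimate fail in half-planes \<open>Im w \<ge> \<eta>\<close>, because of mass close to \<open>Re w\<close>.\<close>

lemma (in real_distribution) h_transform_small_in_cone:
  assumes "\<epsilon> > 0"
  obtains K where "K > 0"
    "\<And>w. \<bar>Re w\<bar> \<le> Im w \<Longrightarrow> K \<le> Im w \<Longrightarrow> norm (h_transform M w) \<le> \<epsilon> * norm w"
proof -
  \<comment> \<open>With \<open>|w G(w) - 1| \<le> \<delta> \<le> 1 / 2\<close> one gets \<open>|h(w)| = |w| |w G(w) - 1| / |w G(w)| \<le> 2 \<delta> |w|\<close>.\<close>
  define \<delta> where "\<delta> = min (1 / 2) (\<epsilon> / 2)"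
  have \<delta>: "\<delta> > 0" "\<delta> \<le> 1 / 2" "2 * \<delta> \<le> \<epsilon>" using assms by (auto simp: \<delta>_def)
  obtain R where R: "R > 0" "prob {t. \<bar>t\<bar> > R} < \<delta> / 6"
    using tail_measure_small[of "\<delta> / 6"] \<delta> by auto
  define K where "K = 2 * R / \<delta>"
  have K: "K > 0" using R \<delta> by (simp add: K_def)
  have "norm (h_transform M w) \<le> \<epsilon> * norm w" if w: "\<bar>Re w\<bar> \<le> Im w" "K \<le> Im w" for w
  proof -
    have wi: "Im w > 0" using w K by linarith
    have nw: "norm w \<le> 2 * Im w" using cmod_le[of w] w by linarith
    define G where "G = cauchy_transform M w"
    have G0: "G \<noteq> 0" unfolding G_def by (rule cauchy_transform_nonzero[OF wi])
    note ik = integrable_cauchy_kernel[OF wi]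
    have "w * G = (LINT t|M. w * (1 / (w - of_real t)))"
      unfolding G_def cauchy_transform_def by (rule integral_mult_right_zero[symmetric])
    then have "w * G - 1 = (LINT t|M. w * (1 / (w - of_real t)) - 1)"
      using integrable_mult_right[OF ik, of w] by (subst Bochner_Integration.integral_diff) auto
    also have "norm \<dots> \<le> (LINT t|M. R / Im w + 3 * indicator {t. \<bar>t\<bar> > R} t)"
    proof (rule Bochner_Integration.integral_norm_bound_integral)
      show "integrable M (\<lambda>t. w * (1 / (w - of_real t)) - 1)"
        by (intro Bochner_Integration.integrable_diff integrable_mult_right ik) auto
      show "integrable M (\<lambda>t. R / Im w + 3 * indicator {t. \<bar>t\<bar> > R} t)"
        by (intro Bochner_Integration.integrable_add integrable_mult_right) 
           (auto intro: integrable_real_indicator simp: less_top[symmetric])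
      fix t
      have ne: "w - of_real t \<noteq> 0" using diff_real_nonzero[OF wi] .
      show "norm (w * (1 / (w - of_real t)) - 1) \<le> R / Im w + 3 * indicator {t. \<bar>t\<bar> > R} t"
      proof (cases "\<bar>t\<bar> > R")
        case True
        have "norm (w * (1 / (w - of_real t)) - 1) \<le> norm (w * (1 / (w - of_real t))) + 1"
          using norm_triangle_ineq4[of "w * (1 / (w - of_real t))" 1] by simp
        also have "norm (w * (1 / (w - of_real t))) \<le> (2 * Im w) * (1 / Im w)"
          unfolding norm_mult using nw norm_cauchy_kernel_le[OF wi] wi by (intro mult_mono) auto
        finally show ?thesis using True wi R by (simp add: add_increasing)
      next
        case False
        have "w * (1 / (w - of_real t)) - 1 = of_real t * (1 / (w - of_real t))"
          using ne by (simp add: field_simps)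
        also have "norm \<dots> \<le> R * (1 / Im w)"
          unfolding norm_mult using False norm_cauchy_kernel_le[OF wi] wi R by (intro mult_mono) auto
        finally show ?thesis using False by simp
      qed
    qed
    also have "\<dots> = R / Im w + 3 * prob {t. \<bar>t\<bar> > R}"
      by (subst Bochner_Integration.integral_add)
         (auto intro: integrable_mult_right integrable_real_indicator simp: less_top[symmetric])
    also have "\<dots> \<le> \<delta>"
    proof -
      have "R / Im w \<le> R / K" using w K R by (intro divide_left_mono) auto
      also have "\<dots> = \<delta> / 2" using R \<delta> by (simp add: K_def)
      finally show ?thesis using R by linarith
    qed
    finally have d: "norm (w * G - 1) \<le> \<delta>" .
    have "norm (w * G) \<ge> 1 / 2"
      using norm_triangle_ineq4[of "w * G" "w * G - 1"] d \<delta> by auto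
    then have "norm (w * G - 1) \<le> 2 * \<delta> * norm (w * G)"
      using d \<delta> mult_left_mono[of "1/2" "norm (w * G)" "2 * \<delta>"] by linarith
    then have "norm w * norm (w * G - 1) \<le> norm w * (2 * \<delta> * norm (w * G))"
      by (intro mult_left_mono) auto
    moreover have "norm (h_transform M w) * norm (w * G) = norm w * norm (w * G - 1)"
    proof -
      have "h_transform M w * (w * G) = w * - (w * G - 1)"
        using G0 by (simp add: h_transform_def F_transform_def G_def[symmetric] field_simps)
      then show ?thesis by (metis norm_minus_cancel norm_mult)
    qed
    ultimately have "norm (h_transform M w) * norm (w * G) \<le> (2 * \<delta> * norm w) * norm (w * G)"
      by (simp add: mult_ac)
    moreover have "norm (w * G) > 0" using \<open>norm (w * G) \<ge> 1 / 2\<close> by linarith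
    ultimately have "norm (h_transform M w) \<le> 2 * \<delta> * norm w"
      using mult_le_cancel_right_pos by blast
    also have "\<dots> \<le> \<epsilon> * norm w" using \<delta> by (intro mult_right_mono) auto
    finally show ?thesis .
  qed
  with K show ?thesis using that by blast
qed

section \<open>Schwarz--Pick in the upper half-plane\<close>

definition cayley :: "complex \<Rightarrow> complex \<Rightarrow> complex"
  where "cayley q z = (z - q) / (z - cnj q)"

definition cayley_inv :: "complex \<Rightarrow> complex \<Rightarrow> complex"
  where "cayley_inv q \<zeta> = (q - cnj q * \<zeta>) / (1 - \<zeta>)"

lemma norm_diff_cnj_sq: "(norm (p - cnj q))\<^sup>2 = (norm (p - q))\<^sup>2 + 4 * Im p * Im q"
  unfolding cmod_power2 by (simp add: power2_eq_square algebra_simps)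

lemma diff_cnj_nonzero:
  assumes "Im p > 0" "Im q > 0" shows "p - cnj q \<noteq> 0"
proof
  assume "p - cnj q = 0"
  then have "Im (p - cnj q) = 0" by simp
  then show False using assms by simp
qed

lemma norm_cayley_less_1:
  assumes "Im z > 0" "Im q > 0" shows "norm (cayley q z) < 1"
proof -
  have "(norm (z - q))\<^sup>2 < (norm (z - cnj q))\<^sup>2"
    using norm_diff_cnj_sq[of z q] assms by simp
  then have "norm (z - q) < norm (z - cnj q)" by (rule power2_less_imp_less) simp
  then show ?thesis using diff_cnj_nonzero[OF assms] by (simp add: cayley_def norm_divide)
qed

lemma Im_cayley_inv_pos:
  assumes "Im q > 0" "norm \<zeta> < 1" shows "Im (cayley_inv q \<zeta>) > 0"
proof -
  have ne: "1 - \<zeta> \<noteq> 0" using assms by auto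
  have "Im (cayley_inv q \<zeta>) = Im ((q - cnj q * \<zeta>) * cnj (1 - \<zeta>)) / (norm (1 - \<zeta>))\<^sup>2"
    unfolding cayley_inv_def by (simp add: Im_divide cmod_power2 algebra_simps)
  also have "Im ((q - cnj q * \<zeta>) * cnj (1 - \<zeta>)) = Im q * (1 - (norm \<zeta>)\<^sup>2)"
    unfolding cmod_power2 by (simp add: power2_eq_square algebra_simps)
  finally have eq: "Im (cayley_inv q \<zeta>) = Im q * (1 - (norm \<zeta>)\<^sup>2) / (norm (1 - \<zeta>))\<^sup>2" .
  have "(norm \<zeta>)\<^sup>2 < 1" using assms abs_square_less_1[of "norm \<zeta>"] by simp
  then show ?thesis unfolding eq using assms ne by (intro divide_pos_pos mult_pos_pos) auto
qed

lemma cayley_inv_cayley: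
  assumes "Im q > 0" "Im z > 0" shows "cayley_inv q (cayley q z) = z"
proof -
  have ne: "z - cnj q \<noteq> 0" using diff_cnj_nonzero assms by blast
  have q: "q - cnj q \<noteq> 0" using diff_cnj_nonzero[of q q] assms by simp
  have "1 - cayley q z = (q - cnj q) / (z - cnj q)"
    "q - cnj q * cayley q z = (q - cnj q) * z / (z - cnj q)"
    using ne by (simp_all add: cayley_def field_simps)
  then show ?thesis using ne q by (simp add: cayley_inv_def)
qed

lemma holomorphic_cayley: "Im q > 0 \<Longrightarrow> cayley q holomorphic_on {z. Im z > 0}"
  unfolding cayley_def[abs_def]
  by (intro holomorphic_intros) (use diff_cnj_nonzero in auto)

lemma holomorphic_cayley_inv: "cayley_inv q holomorphic_on ball 0 1"
  unfolding cayley_inv_def[abs_def]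
  by (intro holomorphic_intros) auto

lemma holomorphic_on_comp:
  assumes "g holomorphic_on T" "f holomorphic_on S" "f ` S \<subseteq> T"
  shows "(\<lambda>z. g (f z)) holomorphic_on S"
  using holomorphic_on_compose_gen[OF assms(2,1,3)] by (simp add: o_def)

context
  fixes f :: "complex \<Rightarrow> complex"
  assumes hol: "f holomorphic_on {z. Im z > 0}" and self: "\<And>z. Im z > 0 \<Longrightarrow> Im (f z) > 0"
begin

text \<open>Conjugation with Cayley transforms centred at \<open>q\<close> and \<open>f q\<close> turns \<open>f\<close> into a self-map of the disc
  that fixes the origin, to which the Schwarz lemma applies.\<close>

lemma cayley_conjugate:
  assumes q: "Im q > 0"
  defines "g \<equiv> \<lambda>\<zeta>. cayley (f q) (f (cayley_inv q \<zeta>))"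
  shows "g holomorphic_on ball 0 1" and "g 0 = 0" and "\<And>\<zeta>. norm \<zeta> < 1 \<Longrightarrow> norm (g \<zeta>) < 1"
    and "\<And>z. Im z > 0 \<Longrightarrow> g (cayley q z) = cayley (f q) (f z)"
proof -
  show "g holomorphic_on ball 0 1"
    unfolding g_def
    by (rule holomorphic_on_comp[OF holomorphic_cayley], use self q in blast,
        rule holomorphic_on_comp[OF hol holomorphic_cayley_inv])
       (use self Im_cayley_inv_pos q in auto)
  show "g 0 = 0" by (simp add: g_def cayley_inv_def cayley_def)
  show "norm (g \<zeta>) < 1" if "norm \<zeta> < 1" for \<zeta>
    unfolding g_def using that q self Im_cayley_inv_pos by (intro norm_cayley_less_1) auto
  show "g (cayley q z) = cayley (f q) (f z)" if "Im z > 0" for z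
    unfolding g_def using cayley_inv_cayley[OF q that] by simp
qed

lemma Schwarz_Pick:
  assumes p: "Im p > 0" and q: "Im q > 0"
  shows "norm (f p - f q) * norm (p - cnj q) \<le> norm (f p - cnj (f q)) * norm (p - q)"
proof -
  have "norm (cayley (f q) (f p)) \<le> norm (cayley q p)"
    using Schwarz_Lemma(1)[OF cayley_conjugate(1,2)[OF q] cayley_conjugate(3)[OF q] norm_cayley_less_1[OF p q]]
      cayley_conjugate(4)[OF q p] by simp
  then show ?thesis
    using diff_cnj_nonzero[OF p q] diff_cnj_nonzero[OF self[OF p] self[OF q]]
    by (simp add: cayley_def norm_divide divide_simps mult_ac)
qed

text \<open>The equality case of the Schwarz lemma: the derivative \<open>1\<close> at an interior fixed point leaves only
  the rotation by the angle zero.\<close>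

lemma self_map_eq_id:
  assumes q: "Im q > 0" and fixq: "f q = q" and deriv: "(f has_field_derivative 1) (at q)"
    and z: "Im z > 0"
  shows "f z = z"
proof -
  define g where "g = (\<lambda>\<zeta>. cayley (f q) (f (cayley_inv q \<zeta>)))"
  have q0: "q - cnj q \<noteq> 0" using diff_cnj_nonzero[of q q] q by simp
  have d1: "(cayley_inv q has_field_derivative (q - cnj q)) (at 0)"
    unfolding cayley_inv_def[abs_def]
    by (rule derivative_eq_intros refl | simp)+
  have d2: "(cayley q has_field_derivative 1 / (q - cnj q)) (at q)"
    unfolding cayley_def[abs_def]
    using q0 by (auto intro!: derivative_eq_intros simp: divide_simps)
  have i0: "cayley_inv q 0 = q" by (simp add: cayley_inv_def)
  have "((\<lambda>\<zeta>. f (cayley_inv q \<zeta>)) has_field_derivative 1 * (q - cnj q)) (at 0)"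
    by (rule DERIV_chain2[OF _ d1]) (use deriv i0 in simp)
  then have "(g has_field_derivative 1 / (q - cnj q) * (1 * (q - cnj q))) (at 0)"
    unfolding g_def fixq by (rule DERIV_chain2[rotated]) (use d2 i0 fixq in simp)
  then have g1: "(g has_field_derivative 1) (at 0)" using q0 by simp
  then have "norm (deriv g 0) = 1" by (simp add: DERIV_imp_deriv)
  moreover have "\<exists>\<alpha>. (\<forall>\<zeta>. norm \<zeta> < 1 \<longrightarrow> g \<zeta> = \<alpha> * \<zeta>) \<and> norm \<alpha> = 1" if "norm (deriv g 0) = 1"
    using Schwarz_Lemma(3)[of g 0] cayley_conjugate(1-3)[OF q] that unfolding g_def by simp
  ultimately obtain \<alpha> where \<alpha>: "\<And>\<zeta>. norm \<zeta> < 1 \<Longrightarrow> g \<zeta> = \<alpha> * \<zeta>" by blast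
  have "(g has_field_derivative \<alpha>) (at 0)"
  proof (rule has_field_derivative_transform_within_open[of "\<lambda>\<zeta>. \<alpha> * \<zeta>" _ _ "ball 0 1"])
    show "((*) \<alpha> has_field_derivative \<alpha>) (at 0)" by (rule derivative_eq_intros refl | simp)+
  qed (use \<alpha> in auto)
  then have "\<alpha> = 1" using g1 DERIV_unique by blast
  then have "cayley q (f z) = cayley q z"
    using \<alpha>[OF norm_cayley_less_1[OF z q]] cayley_conjugate(4)[OF q z] fixq by (simp add: g_def)
  then show ?thesis
    using cayley_inv_cayley[OF q z] cayley_inv_cayley[OF q self[OF z]] by simp
qed

end

text \<open>Since \<open>f\<close> stays above height \<open>\<eta>\<close>, the map \<open>f - i\<eta>\<close> is still a self-map of the half-plane. It has the
  same differences as \<open>f\<close> but smaller values of \<open>|f p - cnj (f q)|\<close>, so the Schwarz--Pick inequality for it is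
  strictly better than the one for \<open>f\<close>.\<close>

lemma strict_Schwarz_Pick:
  assumes hol: "f holomorphic_on {z. Im z > 0}" and \<eta>: "\<eta> > 0"
    and self: "\<And>z. Im z > 0 \<Longrightarrow> Im (f z) > \<eta>"
    and p: "Im p > 0" and q: "Im q > 0" and "p \<noteq> q"
  shows "norm (f p - f q) * norm (p - cnj q) < norm (f p - cnj (f q)) * norm (p - q)"
proof -
  define g where "g z = f z - \<i> * of_real \<eta>" for z
  have "norm (g p - g q) * norm (p - cnj q) \<le> norm (g p - cnj (g q)) * norm (p - q)"
    by (rule Schwarz_Pick[OF _ _ p q]) (use self hol in \<open>auto simp: g_def intro!: holomorphic_intros\<close>)
  also have "\<dots> < norm (f p - cnj (f q)) * norm (p - q)"
  proof (rule mult_strict_right_mono)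
    have "(norm (g p - cnj (g q)))\<^sup>2 < (norm (f p - cnj (f q)))\<^sup>2"
      unfolding cmod_power2 using self[OF p] self[OF q] \<eta>
      by (auto simp: g_def intro!: power_strict_mono)
    then show "norm (g p - cnj (g q)) < norm (f p - cnj (f q))"
      by (rule power2_less_imp_less) simp
  qed (use \<open>p \<noteq> q\<close> in simp)
  finally show ?thesis by (simp add: g_def)
qed

lemma fixed_point_unique:
  assumes "f holomorphic_on {z. Im z > 0}" "\<eta> > 0" "\<And>z. Im z > 0 \<Longrightarrow> Im (f z) > \<eta>"
    and "Im p > 0" "Im q > 0" "f p = p" "f q = q"
  shows "p = q"
proof (rule ccontr)
  assume "p \<noteq> q"
  from strict_Schwarz_Pick[OF assms(1-5) this] show False by (simp add: assms(6,7) mult.commute)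
qed


section \<open>Subordination functions\<close>

lemma subordination_unique:
  fixes A B :: "complex \<Rightarrow> complex"
  assumes A: "A holomorphic_on {z. Im z > 0}" "\<And>z. Im z > 0 \<Longrightarrow> Im (A z) > 0"
    and B: "B holomorphic_on {z. Im z > 0}" "\<And>z. Im z > 0 \<Longrightarrow> Im (B z) > 0"
    and z: "Im z > 0"
    and u: "Im u > 0" "u = z + B v" "v = z + A u"
    and u': "Im u' > 0" "u' = z + B v'" "v' = z + A u'"
  shows "u = u'"
proof (rule fixed_point_unique)
  have "Im (z + A w) > 0" if "Im w > 0" for w using A(2)[OF that] z by simp
  then show "(\<lambda>w. z + B (z + A w)) holomorphic_on {z. Im z > 0}"
    by (intro holomorphic_intros holomorphic_on_comp[OF B(1)] A(1)) auto
  show "\<And>w. Im w > 0 \<Longrightarrow> Im (z + B (z + A w)) > Im z"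
    using A(2) B(2) z by (simp add: add_pos_pos)
  show "Im z > 0" "Im u > 0" "Im u' > 0" by (fact z u u')+
  show "z + B (z + A u) = u" "z + B (z + A u') = u'"
    using u(2,3) u'(2,3) by metis+
qed

text \<open>Let \<open>W\<^sub>n(z)\<close> be the \<open>n\<close>-th iterate of \<open>f\<^sub>z(w) = z + B(z + A(w))\<close>, started at \<open>z\<close>. After a Cayley
  transform these functions of \<open>z\<close> are bounded by \<open>1\<close>, so Montel's theorem gives a convergent
  subsequence. The limit could only degenerate to a unimodular constant, and this is excluded by the
  behaviour on the imaginary axis, where the orbit stays near its starting point; the same estimate
  yields the asymptotics of the limit. To see that the limit is a fixed point, no convergence of the
  whole sequence is needed: the hyperbolic distances of consecutive iterates decrease to some \<open>L\<close>, so the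
  limit point and its image under \<open>f\<^sub>z\<close> both are moved by the distance \<open>L\<close>, against strict contraction.\<close>

lemma subordination_exists:
  fixes A B :: "complex \<Rightarrow> complex"
  assumes A: "A holomorphic_on {z. Im z > 0}" "\<And>z. Im z > 0 \<Longrightarrow> Im (A z) > 0"
    and B: "B holomorphic_on {z. Im z > 0}" "\<And>z. Im z > 0 \<Longrightarrow> Im (B z) > 0"
    and Ac: "\<And>\<epsilon>. \<epsilon> > 0 \<Longrightarrow> \<exists>K>0. \<forall>w. \<bar>Re w\<bar> \<le> Im w \<longrightarrow> K \<le> Im w \<longrightarrow> norm (A w) \<le> \<epsilon> * norm w"
    and Bc: "\<And>\<epsilon>. \<epsilon> > 0 \<Longrightarrow> \<exists>K>0. \<forall>w. \<bar>Re w\<bar> \<le> Im w \<longrightarrow> K \<le> Im w \<longrightarrow> norm (B w) \<le> \<epsilon> * norm w"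
  obtains u where "u holomorphic_on {z. Im z > 0}" 
    "\<And>z. Im z > 0 \<Longrightarrow> Im (u z) > 0"
    "\<And>z. Im z > 0 \<Longrightarrow> u z = z + B (z + A (u z))"
    "((\<lambda>y::real. u (\<i> * of_real y) / (\<i> * of_real y)) \<longlongrightarrow> 1) at_top"
    "((\<lambda>y::real. A (u (\<i> * of_real y)) / (\<i> * of_real y)) \<longlongrightarrow> 0) at_top"
proof -
  let ?H = "{z::complex. Im z > 0}"
  have openH: "open ?H" by (simp add: open_halfspace_Im_gt)
  have convH: "convex ?H" by (simp add: convex_halfspace_Im_gt)
  define f where "f z w = z + B (z + A w)" for z w
  have f_up: "Im (f z w) > Im z" if "Im z > 0" "Im w > 0" for z w
    using A(2)[OF that(2)] B(2)[of "z + A w"] that by (simp add: f_def)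
  have f_up0: "Im (f z w) > 0" if "Im z > 0" "Im w > 0" for z w
    using f_up[OF that] that by linarith
  have f_hol: "f z holomorphic_on ?H" if "Im z > 0" for z
  proof -
    have "Im (z + A w) > 0" if "Im w > 0" for w using A(2)[OF that] \<open>Im z > 0\<close> by simp
    then show ?thesis unfolding f_def[abs_def]
      by (intro holomorphic_intros holomorphic_on_comp[OF B(1)] A(1)) auto
  qed
  define W where "W n z = (f z ^^ n) z" for n z
  have W0: "W 0 z = z" and WSuc: "W (Suc n) z = f z (W n z)" for n z
    by (simp_all add: W_def)
  have W_up: "Im (W n z) > 0" if "Im z > 0" for n z
    by (induction n) (use that f_up0 in \<open>auto simp: W0 WSuc\<close>)
  have W_hol: "W n holomorphic_on ?H" for n
  proof (induction n)
    case 0 then show ?case by (simp add: W0[abs_def])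
  next
    case (Suc n)
    have "(\<lambda>z. A (W n z)) holomorphic_on ?H"
      by (rule holomorphic_on_comp[OF A(1) Suc]) (use W_up in auto)
    then have "(\<lambda>z. z + B (z + A (W n z))) holomorphic_on ?H"
      by (intro holomorphic_intros holomorphic_on_comp[OF B(1)]) (use W_up A(2) in \<open>auto simp: add_pos_pos\<close>)
    then show ?case by (simp add: WSuc[abs_def] f_def)
  qed
  \<comment> \<open>On the imaginary axis the orbit stays in a small ball around its starting point.\<close>
  have ball: "\<exists>K>0. \<forall>y\<ge>K. \<forall>n. W n (\<i> * of_real y) \<in> cball (\<i> * of_real y) (\<delta> * y) \<and>
      norm (A (W n (\<i> * of_real y))) \<le> \<delta> * y" if \<delta>: "\<delta> > 0" "\<delta> \<le> 1 / 2" for \<delta> :: real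
  proof -
    obtain K1 where K1: "K1 > 0" "\<And>w. \<bar>Re w\<bar> \<le> Im w \<Longrightarrow> K1 \<le> Im w \<Longrightarrow> norm (A w) \<le> \<delta> / 2 * norm w"
      using Ac[of "\<delta> / 2"] \<delta> by auto
    obtain K2 where K2: "K2 > 0" "\<And>w. \<bar>Re w\<bar> \<le> Im w \<Longrightarrow> K2 \<le> Im w \<Longrightarrow> norm (B w) \<le> \<delta> / 2 * norm w"
      using Bc[of "\<delta> / 2"] \<delta> by auto
    define K where "K = 2 * max K1 K2"
    have K: "K > 0" "K \<ge> 2 * K1" "K \<ge> 2 * K2" using K1 K2 by (auto simp: K_def)
    have cone: "\<bar>Re w\<bar> \<le> Im w" "K / 2 \<le> Im w" "norm w \<le> 3 / 2 * y"
      if w: "w \<in> cball (\<i> * of_real y) (\<delta> * y)" and y: "y \<ge> K" for w y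
    proof -
      have y0: "y > 0" using y K by linarith
      then have "\<delta> * y \<le> 1 / 2 * y" using \<delta> by (intro mult_right_mono) auto
      then have n: "norm (w - \<i> * of_real y) \<le> y / 2" using w by (simp add: dist_norm norm_minus_commute)
      have "\<bar>Re (w - \<i> * of_real y)\<bar> \<le> y / 2" "\<bar>Im (w - \<i> * of_real y)\<bar> \<le> y / 2"
        using n abs_Re_le_cmod abs_Im_le_cmod order.trans by blast+
      then have "\<bar>Re w\<bar> \<le> y / 2" "\<bar>Im w - y\<bar> \<le> y / 2" by simp_all
      then show "\<bar>Re w\<bar> \<le> Im w" "K / 2 \<le> Im w" using y unfolding abs_le_iff by linarith+
      show "norm w \<le> 3 / 2 * y"
        using norm_triangle_ineq[of "w - \<i> * of_real y" "\<i> * of_real y"] n y0 by (simp add: norm_mult)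
    qed
    have step: "norm (A w) \<le> \<delta> * y \<and> norm (B w) \<le> \<delta> * y"
      if w: "w \<in> cball (\<i> * of_real y) (\<delta> * y)" and y: "y \<ge> K" for w y
    proof -
      note c = cone[OF that]
      have "norm (A w) \<le> \<delta> / 2 * norm w" "norm (B w) \<le> \<delta> / 2 * norm w"
        using K1(2)[OF c(1)] K2(2)[OF c(1)] c(2) K by auto
      moreover have "\<delta> / 2 * norm w \<le> \<delta> / 2 * (2 * y)" 
        using c(3) \<delta> y K by (intro mult_left_mono) auto
      ultimately show ?thesis by simp
    qed
    have "W n (\<i> * of_real y) \<in> cball (\<i> * of_real y) (\<delta> * y)" if y: "y \<ge> K" for n y
    proof (induction n)
      case 0 then show ?case using y K \<delta> by (simp add: W0)
    next
      case (Suc n)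
      have "\<i> * of_real y + A (W n (\<i> * of_real y)) \<in> cball (\<i> * of_real y) (\<delta> * y)"
        using step[OF Suc y] by (simp add: dist_norm)
      from step[OF this y] show ?case by (simp add: WSuc f_def dist_norm)
    qed
    then show ?thesis using step K(1) by blast
  qed
  define C where "C n z = cayley \<i> (W n z)" for n z
  have C_hol: "C n holomorphic_on ?H" for n
    unfolding C_def[abs_def] by (rule holomorphic_on_comp[OF holomorphic_cayley W_hol]) (use W_up in auto)
  have C_less: "norm (C n z) < 1" if "Im z > 0" for n z
    unfolding C_def using that W_up by (intro norm_cayley_less_1) auto
  obtain g r where g: "g holomorphic_on ?H" and r: "strict_mono (r :: nat \<Rightarrow> nat)"
    and lim: "\<And>z. z \<in> ?H \<Longrightarrow> (\<lambda>n. C (r n) z) \<longlonglongrightarrow> g z"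
  proof (rule Montel[OF openH, of "range C" C])
    show "\<exists>B. \<forall>h\<in>range C. \<forall>z\<in>K. norm (h z) \<le> B" if "compact K" "K \<subseteq> ?H" for K
      using C_less that(2) by (intro exI[of _ 1]) (force intro: less_imp_le)
  qed (use C_hol in auto)
  have g_le: "norm (g z) \<le> 1" if "Im z > 0" for z
    using C_less[OF that] lim[of z] that
    by (intro LIMSEQ_le_const2[OF tendsto_norm[OF lim]]) (auto intro: less_imp_le)
  obtain K where K: "K > 0"
    "\<And>y n. y \<ge> K \<Longrightarrow> W n (\<i> * of_real y) \<in> cball (\<i> * of_real y) (1 / 2 * y)"
    using ball[of "1 / 2"] by auto
  define z0 where "z0 = \<i> * of_real K"
  have z0: "Im z0 > 0" using K by (simp add: z0_def)
  \<comment> \<open>All iterates at \<open>z0\<close> lie in one compact subset of the half-plane, so their limit does too.\<close>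
  have g_z0: "norm (g z0) < 1"
  proof -
    have Bs: "cball z0 (1 / 2 * K) \<subseteq> ?H"
    proof
      fix w assume "w \<in> cball z0 (1 / 2 * K)"
      then have "\<bar>Im (w - z0)\<bar> \<le> K / 2"
        using abs_Im_le_cmod[of "w - z0"] by (simp add: dist_norm norm_minus_commute)
      then have "\<bar>Im w - K\<bar> \<le> K / 2" by (simp add: z0_def)
      then have "Im w > 0" using K(1) unfolding abs_le_iff by linarith
      then show "w \<in> ?H" by simp
    qed
    then have "compact (cayley \<i> ` cball z0 (1 / 2 * K))"
      by (intro compact_continuous_image holomorphic_on_imp_continuous_on
          holomorphic_on_subset[OF holomorphic_cayley]) auto
    then have cl: "closed (cayley \<i> ` cball z0 (1 / 2 * K))" by (rule compact_imp_closed)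
    have "C (r n) z0 \<in> cayley \<i> ` cball z0 (1 / 2 * K)" for n
      using K(2)[of K] by (auto simp: C_def z0_def)
    then have "g z0 \<in> cayley \<i> ` cball z0 (1 / 2 * K)"
      by (intro closed_sequentially[OF cl _ lim]) (use z0 in auto)
    then obtain w where "w \<in> cball z0 (1 / 2 * K)" "g z0 = cayley \<i> w" by blast
    then show ?thesis using Bs norm_cayley_less_1[of w \<i>] by auto
  qed
  \<comment> \<open>By the maximum principle the limit is inside the disc everywhere or nowhere.\<close>
  have g_less: "norm (g z) < 1" if z: "Im z > 0" for z
  proof (rule ccontr)
    assume "\<not> ?thesis"
    then have "norm (g z) = 1" using g_le[OF z] by linarith
    then have "g constant_on ?H"
      using g_le z by (intro maximum_modulus_principle[OF g openH convex_connected[OF convH] openH]) auto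
    then have "g z0 = g z" using z z0 by (auto simp: constant_on_def)
    then show False using g_z0 \<open>norm (g z) = 1\<close> by simp
  qed
  define u where "u z = cayley_inv \<i> (g z)" for z
  have u_hol: "u holomorphic_on ?H"
    unfolding u_def[abs_def] by (rule holomorphic_on_comp[OF holomorphic_cayley_inv g]) (use g_less in auto)
  have u_up: "Im (u z) > 0" if "Im z > 0" for z
    unfolding u_def using g_less[OF that] by (intro Im_cayley_inv_pos) auto
  have W_lim: "(\<lambda>n. W (r n) z) \<longlonglongrightarrow> u z" if z: "Im z > 0" for z
  proof -
    have "isCont (cayley_inv \<i>) (g z)"
      using holomorphic_cayley_inv g_less[OF z]
      by (intro analytic_at_imp_isCont) (auto simp: analytic_at intro!: exI[of _ "ball 0 1"])
    then have "(\<lambda>n. cayley_inv \<i> (C (r n) z)) \<longlonglongrightarrow> cayley_inv \<i> (g z)"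
      using lim[of z] z isCont_tendsto_compose by blast
    moreover have "cayley_inv \<i> (C n z) = W n z" for n
      unfolding C_def using W_up[OF z] by (intro cayley_inv_cayley) auto
    ultimately show ?thesis by (simp add: u_def)
  qed
  have u_fix: "f z (u z) = u z" if z: "Im z > 0" for z
  proof (rule ccontr)
    assume neq: "f z (u z) \<noteq> u z"
    have cont: "isCont (f z) w" if "Im w > 0" for w
      using f_hol[OF z] openH that by (intro analytic_at_imp_isCont) (auto simp: analytic_at)
    define d where "d p q = norm (p - q) / norm (p - cnj q)" for p q :: complex
    have d_less: "d (f z p) (f z q) < d p q" if pq: "Im p > 0" "Im q > 0" "p \<noteq> q" for p q
      using strict_Schwarz_Pick[OF f_hol[OF z] z f_up[OF z] pq] 
        diff_cnj_nonzero[OF pq(1,2)] diff_cnj_nonzero[OF f_up0[OF z pq(1)] f_up0[OF z pq(2)]]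
      by (simp add: d_def divide_simps mult_ac)
    have d_le: "d (f z p) (f z q) \<le> d p q" if "Im p > 0" "Im q > 0" for p q
      using d_less[OF that] by (cases "p = q") (auto simp: d_def intro: less_imp_le)
    define D where "D n = d (W (Suc n) z) (W n z)" for n
    have "decseq D"
      unfolding decseq_Suc_iff D_def WSuc using d_le f_up0 z W_up by auto
    moreover have "D n \<ge> 0" for n by (simp add: D_def d_def)
    ultimately obtain L where L: "D \<longlonglongrightarrow> L"
      using decseq_convergent[of D 0] by blast
    have lim1: "(\<lambda>n. f z (W (r n) z)) \<longlonglongrightarrow> f z (u z)"
      by (rule isCont_tendsto_compose[OF cont[OF u_up[OF z]] W_lim[OF z]])
    have lim2: "(\<lambda>n. f z (f z (W (r n) z))) \<longlonglongrightarrow> f z (f z (u z))"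
      by (rule isCont_tendsto_compose[OF cont[OF f_up0[OF z u_up[OF z]]] lim1])
    have "(\<lambda>n. D (r n)) \<longlonglongrightarrow> d (f z (u z)) (u z)"
      unfolding D_def d_def WSuc
      using diff_cnj_nonzero[OF f_up0[OF z u_up[OF z]] u_up[OF z]]
      by (intro tendsto_intros lim1 W_lim z) auto
    moreover have "(\<lambda>n. D (r n)) \<longlonglongrightarrow> L"
      using LIMSEQ_subseq_LIMSEQ[OF L r] by (simp add: o_def)
    ultimately have L1: "L = d (f z (u z)) (u z)" using LIMSEQ_unique by blast
    have "(\<lambda>n. D (Suc (r n))) \<longlonglongrightarrow> d (f z (f z (u z))) (f z (u z))"
      unfolding D_def d_def WSuc
      using diff_cnj_nonzero[OF f_up0[OF z f_up0[OF z u_up[OF z]]] f_up0[OF z u_up[OF z]]]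
      by (intro tendsto_intros lim1 lim2) auto
    moreover have "(\<lambda>n. D (Suc (r n))) \<longlonglongrightarrow> L"
      using LIMSEQ_subseq_LIMSEQ[OF LIMSEQ_Suc[OF L] r] by (simp add: o_def)
    ultimately have "L = d (f z (f z (u z))) (f z (u z))" using LIMSEQ_unique by blast
    then show False
      using d_less[OF f_up0[OF z u_up[OF z]] u_up[OF z] neq] L1 by simp
  qed
  have asym: "\<exists>K. \<forall>y\<ge>K. norm (u (\<i> * of_real y) / (\<i> * of_real y) - 1) \<le> \<delta> \<and>
       norm (A (u (\<i> * of_real y)) / (\<i> * of_real y)) \<le> \<delta>"
    if \<delta>: "\<delta> > 0" "\<delta> \<le> 1 / 2" for \<delta> :: real
  proof -
    obtain K where K: "K > 0"
      "\<And>y n. y \<ge> K \<Longrightarrow> W n (\<i> * of_real y) \<in> cball (\<i> * of_real y) (\<delta> * y)"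
      "\<And>y n. y \<ge> K \<Longrightarrow> norm (A (W n (\<i> * of_real y))) \<le> \<delta> * y"
      using ball[OF \<delta>] by blast
    show ?thesis
    proof (intro exI[of _ K] allI impI conjI)
      fix y assume y: "y \<ge> K"
      define z where "z = \<i> * of_real y"
      have y0: "y > 0" using K y by linarith
      then have z: "Im z > 0" and nz: "norm z = y" "z \<noteq> 0" by (auto simp: z_def norm_mult)
      have "u z \<in> cball z (\<delta> * y)"
        by (rule closed_sequentially[OF closed_cball _ W_lim[OF z]]) (use K(2)[OF y] in \<open>auto simp: z_def\<close>)
      then have "norm (u z - z) \<le> \<delta> * norm z" using nz by (simp add: dist_norm norm_minus_commute)
      moreover have "u z / z - 1 = (u z - z) / z" using nz by (simp add: field_simps)
      ultimately show "norm (u (\<i> * of_real y) / (\<i> * of_real y) - 1) \<le> \<delta>"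
        using y0 nz unfolding z_def[symmetric] by (simp add: norm_divide divide_simps)
      have "isCont A (u z)"
        using A(1) openH u_up[OF z] by (intro analytic_at_imp_isCont) (auto simp: analytic_at)
      then have "(\<lambda>n. norm (A (W (r n) z))) \<longlonglongrightarrow> norm (A (u z))"
        by (intro tendsto_norm isCont_tendsto_compose[OF _ W_lim[OF z]])
      then have "norm (A (u z)) \<le> \<delta> * y"
        by (rule LIMSEQ_le_const2) (use K(3)[OF y] in \<open>auto simp: z_def\<close>)
      then show "norm (A (u (\<i> * of_real y)) / (\<i> * of_real y)) \<le> \<delta>"
        using y0 nz unfolding z_def[symmetric] by (simp add: norm_divide divide_simps)
    qed
  qed
  have small: "\<exists>\<delta>>0. \<delta> \<le> 1 / 2 \<and> \<delta> < e" if "e > 0" for e :: real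
    using that by (intro exI[of _ "min (1 / 2) (e / 2)"]) auto
  show ?thesis
  proof (rule that[OF u_hol u_up])
    show "u z = z + B (z + A (u z))" if "Im z > 0" for z
      using u_fix[OF that] by (simp add: f_def)
    show "((\<lambda>y::real. u (\<i> * of_real y) / (\<i> * of_real y)) \<longlongrightarrow> 1) at_top"
      unfolding tendsto_iff eventually_at_top_linorder dist_norm
    proof (intro allI impI)
      fix e :: real assume "e > 0"
      then obtain \<delta> where \<delta>: "\<delta> > 0" "\<delta> \<le> 1 / 2" "\<delta> < e" using small by blast
      show "\<exists>N. \<forall>n\<ge>N. norm (u (\<i> * of_real n) / (\<i> * of_real n) - 1) < e"
        using asym[OF \<delta>(1,2)] \<delta>(3) by (meson le_less_trans)
    qed
    show "((\<lambda>y::real. A (u (\<i> * of_real y)) / (\<i> * of_real y)) \<longlongrightarrow> 0) at_top"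
      unfolding tendsto_iff eventually_at_top_linorder dist_norm
    proof (intro allI impI)
      fix e :: real assume "e > 0"
      then obtain \<delta> where \<delta>: "\<delta> > 0" "\<delta> \<le> 1 / 2" "\<delta> < e" using small by blast
      show "\<exists>N. \<forall>n\<ge>N. norm (A (u (\<i> * of_real n)) / (\<i> * of_real n) - 0) < e"
        unfolding diff_zero using asym[OF \<delta>(1,2)] \<delta>(3) by (meson le_less_trans)
    qed
  qed
qed

section \<open>Functions that are Cauchy transforms\<close>

text \<open>Integrate \<open>g\<close> against \<open>1 / (w - z) - 1 / (w - cnj z)\<close> around the rectangle over \<open>[-R, R]\<close> of height
  \<open>R\<close>. On the base this kernel is a multiple of the Poisson kernel; on the other three sides it is of order
  \<open>1 / R\<^sup>2\<close>, so for bounded \<open>g\<close> their contribution is of order \<open>1 / R\<close>.\<close>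

lemma half_plane_Poisson_truncated:
  fixes g :: "complex \<Rightarrow> complex"
  assumes hol: "g holomorphic_on {w. Im w > - \<epsilon>}" and \<epsilon>: "\<epsilon> > 0"
    and C: "\<And>w. Im w \<ge> 0 \<Longrightarrow> norm (g w) \<le> C"
    and z: "Im z > 0" and R: "R > 2 * norm z"
  obtains i where
    "((\<lambda>t. - Im (g (of_real t)) / pi * (Im z / (norm (z - of_real t))\<^sup>2)) has_integral i) {-R..R}"
    "\<bar>i - (- Im (g z))\<bar> \<le> 32 * C * Im z / R"
proof -
  have R0: "R > 0" using R norm_ge_zero[of z] by linarith
  have C0: "C \<ge> 0" using C[of 0] norm_ge_zero[of "g 0"] by (simp, linarith)
  have Imz: "Im z < R" "\<bar>Re z\<bar> < R" "norm z < R / 2"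
    using abs_Im_le_cmod[of z] abs_Re_le_cmod[of z] z R norm_ge_zero[of z] by linarith+
  \<comment> \<open>A convex region that contains the rectangle and avoids the reflected pole \<open>cnj z\<close>.\<close>
  define S where "S = {w. Im w > - min \<epsilon> (Im z)}"
  have S: "open S" "convex S"
    unfolding S_def by (simp_all add: open_halfspace_Im_gt convex_halfspace_Im_gt)
  have gS: "g holomorphic_on S" by (rule holomorphic_on_subset[OF hol]) (auto simp: S_def)
  have zS: "z \<in> S" using z \<epsilon> by (auto simp: S_def)
  have up: "w \<in> S" if "Im w \<ge> 0" for w using that z \<epsilon> by (auto simp: S_def)
  have ncnj: "w - cnj z \<noteq> 0" if "w \<in> S" for w
  proof
    assume "w - cnj z = 0"
    then have "Im w = - Im z" by (simp add: complex_eq_iff)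
    then show False using that by (simp add: S_def)
  qed
  let ?a = "Complex (-R) 0" and ?b = "Complex R R"
  define f where "f w = g w / (w - z) - g w / (w - cnj z)" for w
  have cb: "path_image (rectpath ?a ?b) \<subseteq> cbox ?a ?b"
    by (rule path_image_rectpath_subset_cbox) (use R0 in auto)
  have zbox: "z \<in> box ?a ?b" using Imz z by (auto simp: in_box_complex_iff)
  have pS: "path_image (rectpath ?a ?b) \<subseteq> S"
    using cb up by (auto simp: in_cbox_complex_iff)
  have pz: "z \<notin> path_image (rectpath ?a ?b)"
    using zbox R0 path_image_rectpath_inter_box[of ?a ?b] by auto
  have 1: "((\<lambda>w. g w / (w - z)) has_contour_integral (2 * pi * \<i> * winding_number (rectpath ?a ?b) z * g z)) (rectpath ?a ?b)"
    by (rule Cauchy_integral_formula_convex_simple[OF S(2) gS])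
       (use S zS pS pz in \<open>auto simp: interior_open\<close>)
  have 2: "((\<lambda>w. g w / (w - cnj z)) has_contour_integral 0) (rectpath ?a ?b)"
    by (rule Cauchy_theorem_convex_simple[of _ S])
       (use gS S pS ncnj in \<open>auto intro!: holomorphic_intros\<close>)
  have tot: "(f has_contour_integral (2 * pi * \<i> * g z)) (rectpath ?a ?b)"
    using has_contour_integral_diff[OF 1 2] winding_number_rectpath[OF zbox] by (simp add: f_def[abs_def])
  have fcont: "continuous_on (S - {z}) f"
    unfolding f_def[abs_def] using ncnj
    by (intro holomorphic_on_imp_continuous_on holomorphic_intros holomorphic_on_subset[OF gS]) auto
  let ?a2 = "Complex R 0" and ?a4 = "Complex (-R) R"
  have seg_bound: "norm (f w) \<le> 8 * C * Im z / R\<^sup>2" "w \<in> S - {z}" if w: "Im w \<ge> 0" "norm w \<ge> R" for w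
  proof -
    have b: "norm (w - z) \<ge> R / 2" "norm (w - cnj z) \<ge> R / 2"
      using norm_triangle_ineq2[of w z] norm_triangle_ineq2[of w "cnj z"] w Imz by auto
    then have ne: "w - z \<noteq> 0" "w - cnj z \<noteq> 0" using R0 by auto
    then show "w \<in> S - {z}" using up w by auto
    have "f w = g w * ((z - cnj z) / ((w - z) * (w - cnj z)))"
      using ne by (simp add: f_def field_simps)
    also have "z - cnj z = 2 * \<i> * Im z" by (simp add: complex_eq_iff)
    finally have "norm (f w) = norm (g w) * (2 * Im z / (norm (w - z) * norm (w - cnj z)))"
      using z by (simp add: norm_mult norm_divide)
    also have "\<dots> \<le> C * (2 * Im z / ((R / 2) * (R / 2)))"
      using C[OF w(1)] b R0 z C0 by (intro mult_mono frac_le) auto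
    finally show "norm (f w) \<le> 8 * C * Im z / R\<^sup>2"
      by (simp add: power2_eq_square field_simps)
  qed
  have s1: "closed_segment ?a ?a2 \<subseteq> S - {z}"
    using z up by (auto simp: closed_segment_same_Im)
  have n1: "norm w \<ge> R" if "\<bar>Re w\<bar> = R \<or> \<bar>Im w\<bar> = R" for w
    using that abs_Re_le_cmod[of w] abs_Im_le_cmod[of w] by auto
  have q2: "Im w \<ge> 0 \<and> norm w \<ge> R" if "w \<in> closed_segment ?a2 ?b" for w
    using that R0 n1[of w] by (auto simp: closed_segment_same_Re closed_segment_eq_real_ivl)
  have q3: "Im w \<ge> 0 \<and> norm w \<ge> R" if "w \<in> closed_segment ?b ?a4" for w
    using that R0 n1[of w] by (auto simp: closed_segment_same_Im closed_segment_eq_real_ivl)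
  have q4: "Im w \<ge> 0 \<and> norm w \<ge> R" if "w \<in> closed_segment ?a4 ?a" for w
    using that R0 n1[of w] by (auto simp: closed_segment_same_Re closed_segment_eq_real_ivl)
  have int: "f contour_integrable_on linepath u v" if "closed_segment u v \<subseteq> S - {z}" for u v
    by (rule contour_integrable_continuous_linepath) (rule continuous_on_subset[OF fcont that])
  have I1: "f contour_integrable_on linepath ?a ?a2" using int s1 by blast
  have I2: "f contour_integrable_on linepath ?a2 ?b" using int q2 seg_bound by blast
  have I3: "f contour_integrable_on linepath ?b ?a4" using int q3 seg_bound by blast
  have I4: "f contour_integrable_on linepath ?a4 ?a" using int q4 seg_bound by blast
  define i1 i2 i3 i4 where "i1 = contour_integral (linepath ?a ?a2) f"
    and "i2 = contour_integral (linepath ?a2 ?b) f"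
    and "i3 = contour_integral (linepath ?b ?a4) f" and "i4 = contour_integral (linepath ?a4 ?a) f"
  note hi = I1[THEN has_contour_integral_integral, folded i1_def]
            I2[THEN has_contour_integral_integral, folded i2_def]
            I3[THEN has_contour_integral_integral, folded i3_def]
            I4[THEN has_contour_integral_integral, folded i4_def]
  have "(f has_contour_integral (i1 + (i2 + (i3 + i4)))) (rectpath ?a ?b)"
    unfolding rectpath_def Let_def complex.sel
    by (intro has_contour_integral_join hi valid_path_join valid_path_linepath) auto
  then have sum: "i1 + (i2 + (i3 + i4)) = 2 * pi * \<i> * g z"
    using tot has_contour_integral_unique by blast
  have B: "0 \<le> 8 * C * Im z / R\<^sup>2" using C0 z by simp
  have "norm i2 \<le> 8 * C * Im z / R\<^sup>2 * norm (?b - ?a2)"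
    by (rule has_contour_integral_bound_linepath[OF hi(2) B]) (use q2 seg_bound in blast)
  moreover have "norm i3 \<le> 8 * C * Im z / R\<^sup>2 * norm (?a4 - ?b)"
    by (rule has_contour_integral_bound_linepath[OF hi(3) B]) (use q3 seg_bound in blast)
  moreover have "norm i4 \<le> 8 * C * Im z / R\<^sup>2 * norm (?a - ?a4)"
    by (rule has_contour_integral_bound_linepath[OF hi(4) B]) (use q4 seg_bound in blast)
  moreover have "norm (?b - ?a2) = R" "norm (?a4 - ?b) = 2 * R" "norm (?a - ?a4) = R"
    using R0 by (simp_all add: cmod_def real_sqrt_mult)
  moreover have "norm (i2 + (i3 + i4)) \<le> norm i2 + (norm i3 + norm i4)"
    by (meson add_left_mono norm_triangle_ineq order_trans)
  ultimately have "norm (i2 + (i3 + i4)) \<le> 8 * C * Im z / R\<^sup>2 * R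
      + (8 * C * Im z / R\<^sup>2 * (2 * R) + 8 * C * Im z / R\<^sup>2 * R)"
    by (simp only:)
  also have "\<dots> = 32 * C * Im z / R" using R0 by (simp add: power2_eq_square field_simps)
  finally have rest: "norm (i2 + (i3 + i4)) \<le> 32 * C * Im z / R" .
  have "(f has_contour_integral i1) (linepath (of_real (-R)) (of_real R))"
    using hi(1) by (simp add: complex_of_real_def)
  then have "((\<lambda>t. f (of_real t)) has_integral i1) {-R..R}"
    by (subst (asm) has_contour_integral_linepath_Reals_iff) (use R0 in auto)
  then have "((\<lambda>t. f (of_real t) * (1 / (2 * pi * \<i>))) has_integral i1 * (1 / (2 * pi * \<i>))) {-R..R}"
    by (rule has_integral_mult_left)
  then have "((\<lambda>t. Im (f (of_real t) * (1 / (2 * pi * \<i>)))) has_integral Im (i1 * (1 / (2 * pi * \<i>)))) {-R..R}"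
    using has_integral_linear[OF _ bounded_linear_Im] by (auto simp: o_def)
  then have "((\<lambda>t. - Im (f (of_real t) * (1 / (2 * pi * \<i>)))) has_integral - Im (i1 * (1 / (2 * pi * \<i>)))) {-R..R}"
    by (rule has_integral_neg)
  also have "(\<lambda>t. - Im (f (of_real t) * (1 / (2 * pi * \<i>))))
      = (\<lambda>t. - Im (g (of_real t)) / pi * (Im z / (norm (z - of_real t))\<^sup>2))"
  proof
    fix t :: real
    have ne: "of_real t - z \<noteq> 0" "of_real t - cnj z \<noteq> 0"
      using z by (auto simp: complex_eq_iff)
    have "f (of_real t) = g (of_real t) * ((z - cnj z) / ((of_real t - z) * (of_real t - cnj z)))"
      using ne by (simp add: f_def field_simps)
    also have "z - cnj z = 2 * \<i> * Im z" by (simp add: complex_eq_iff)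
    also have "(of_real t - z) * (of_real t - cnj z) = of_real ((norm (z - of_real t))\<^sup>2)"
      unfolding cmod_power2 by (simp add: complex_eq_iff power2_eq_square algebra_simps)
    finally have "f (of_real t) * (1 / (2 * pi * \<i>)) = g (of_real t) * of_real (Im z / (norm (z - of_real t))\<^sup>2 / pi)"
      by (simp add: field_simps)
    then show "- Im (f (of_real t) * (1 / (2 * pi * \<i>)))
      = - Im (g (of_real t)) / pi * (Im z / (norm (z - of_real t))\<^sup>2)"
      by (simp only: Im_complex_of_real Re_complex_of_real times_complex.sel) simp
  qed
  finally have res: "((\<lambda>t. - Im (g (of_real t)) / pi * (Im z / (norm (z - of_real t))\<^sup>2)) has_integral
      - Im (i1 * (1 / (2 * pi * \<i>)))) {-R..R}" .
  have "i1 = 2 * pi * \<i> * g z - (i2 + (i3 + i4))" using sum by (simp add: algebra_simps)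
  then have "i1 * (1 / (2 * pi * \<i>)) = g z - (i2 + (i3 + i4)) * (1 / (2 * pi * \<i>))"
    by (simp add: field_simps)
  then have "- Im (i1 * (1 / (2 * pi * \<i>))) - (- Im (g z)) = Im ((i2 + (i3 + i4)) * (1 / (2 * pi * \<i>)))"
    by simp
  then have "\<bar>- Im (i1 * (1 / (2 * pi * \<i>))) - (- Im (g z))\<bar> \<le> norm ((i2 + (i3 + i4)) * (1 / (2 * pi * \<i>)))"
    using abs_Im_le_cmod by metis
  also have "\<dots> = norm (i2 + (i3 + i4)) / (2 * pi)" by (simp add: norm_mult norm_divide)
  also have "\<dots> \<le> norm (i2 + (i3 + i4)) / 1"
    using pi_gt3 by (intro divide_left_mono) auto
  also have "\<dots> \<le> 32 * C * Im z / R" using rest by simp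
  finally show ?thesis using that res by blast
qed

lemma half_plane_Poisson:
  fixes g :: "complex \<Rightarrow> complex"
  assumes hol: "g holomorphic_on {w. Im w > - \<epsilon>}" and \<epsilon>: "\<epsilon> > 0"
    and C: "\<And>w. Im w \<ge> 0 \<Longrightarrow> norm (g w) \<le> C"
    and neg: "\<And>w. Im w \<ge> 0 \<Longrightarrow> Im (g w) \<le> 0"
    and z: "Im z > 0"
  shows "(\<integral>\<^sup>+t. ennreal (- Im (g (of_real t)) / pi * (Im z / (norm (z - of_real t))\<^sup>2)) \<partial>lborel)
      = ennreal (- Im (g z))"
proof -
  define p where "p t = - Im (g (of_real t)) / pi * (Im z / (norm (z - of_real t))\<^sup>2)" for t :: real
  have p0: "p t \<ge> 0" for t
    unfolding p_def using neg[of "of_real t"] z by (intro mult_nonneg_nonneg divide_nonneg_nonneg) auto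
  have gc: "continuous_on UNIV (\<lambda>t::real. g (of_real t))"
    by (rule continuous_on_compose2[OF holomorphic_on_imp_continuous_on[OF hol]])
       (use \<epsilon> in \<open>auto intro!: continuous_intros\<close>)
  have pm: "p \<in> borel_measurable borel"
    unfolding p_def[abs_def]
    by (intro borel_measurable_continuous_onI continuous_intros gc) (use diff_real_nonzero[OF z] in auto)
  define R where "R n = 2 * norm z + 1 + real n" for n
  have "\<exists>i. (p has_integral i) {-R n..R n} \<and> \<bar>i - (- Im (g z))\<bar> \<le> 32 * C * Im z / R n" for n
    unfolding p_def[abs_def]
    by (rule half_plane_Poisson_truncated[OF hol \<epsilon> C z, of "R n"]) (auto simp: R_def)
  then obtain i where i: "\<And>n. (p has_integral i n) {-R n..R n}"
      "\<And>n. \<bar>i n - (- Im (g z))\<bar> \<le> 32 * C * Im z / R n" by metis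
  have "filterlim R at_top sequentially"
    unfolding R_def by real_asymp
  then have "(\<lambda>n. 32 * C * Im z / R n) \<longlonglongrightarrow> 0"
    by (rule real_tendsto_divide_at_top[OF tendsto_const])
  then have "(\<lambda>n. i n - (- Im (g z))) \<longlonglongrightarrow> 0"
    by (rule Lim_null_comparison[rotated]) (use i(2) in auto)
  then have "i \<longlonglongrightarrow> - Im (g z)" by (rule LIM_zero_cancel)
  then have l1: "(\<lambda>n. ennreal (i n)) \<longlonglongrightarrow> ennreal (- Im (g z))" by (rule tendsto_ennrealI)
  have "(\<lambda>n. \<integral>\<^sup>+t. ennreal (indicator {-R n..R n} t * p t) \<partial>lborel) \<longlonglongrightarrow> (\<integral>\<^sup>+t. ennreal (p t) \<partial>lborel)"
  proof (rule nn_integral_LIMSEQ)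
    show "incseq (\<lambda>n t. ennreal (indicator {- R n..R n} t * p t))"
      by (auto simp: incseq_def le_fun_def R_def p0 intro!: ennreal_leI split: split_indicator)
    show "(\<lambda>t. ennreal (indicator {- R n..R n} t * p t)) \<in> borel_measurable lborel" for n
      using pm by measurable
    show "(\<lambda>n. ennreal (indicator {- R n..R n} t * p t)) \<longlonglongrightarrow> ennreal (p t)" for t
    proof (rule tendsto_eventually)
      obtain N where "\<bar>t\<bar> \<le> real N" using real_arch_simple by blast
      then have "t \<in> {- R n..R n}" if "n \<ge> N" for n
        using that norm_ge_zero[of z] of_nat_mono[OF that, where 'a = real]
        unfolding R_def atLeastAtMost_iff abs_le_iff by linarith
      then have "ennreal (indicator {- R n..R n} t * p t) = ennreal (p t)" if "n \<ge> N" for n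
        using that by simp
      then show "\<forall>\<^sub>F n in sequentially. ennreal (indicator {- R n..R n} t * p t) = ennreal (p t)"
        unfolding eventually_sequentially by blast
    qed
  qed
  moreover have "(\<integral>\<^sup>+t. ennreal (indicator {-R n..R n} t * p t) \<partial>lborel) = ennreal (i n)" for n
    using nn_integral_has_integral_lebesgue[OF p0 i(1)] .
  ultimately have "(\<lambda>n. ennreal (i n)) \<longlonglongrightarrow> (\<integral>\<^sup>+t. ennreal (p t) \<partial>lborel)" by simp
  from LIMSEQ_unique[OF this l1] show ?thesis by (simp add: p_def)
qed

text \<open>A nonconstant holomorphic function is open, and the real line contains no open subset of the plane.\<close>

lemma holomorphic_real_valued_const:
  assumes "h holomorphic_on S" "open S" "connected S" "\<And>z. z \<in> S \<Longrightarrow> Im (h z) = 0"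
  shows "h constant_on S"
proof (rule ccontr)
  assume nc: "\<not> h constant_on S"
  then have op: "open (h ` S)" using assms open_mapping_thm[OF assms(1-3) assms(2)] by blast
  have "S \<noteq> {}" using nc by (auto simp: constant_on_def)
  then obtain w where w: "w \<in> h ` S" by blast
  then obtain e where e: "e > 0" "ball w e \<subseteq> h ` S" using op open_contains_ball by blast
  have "w + \<i> * of_real (e / 2) \<in> ball w e" using e by (simp add: dist_norm norm_mult)
  then have "w + \<i> * of_real (e / 2) \<in> h ` S" using e by blast
  then have "Im (w + \<i> * of_real (e / 2)) = 0" using assms(4) by (metis imageE)
  moreover have "Im w = 0" using w assms(4) by (metis imageE)
  ultimately show False using e by simp
qed

text \<open>The candidate density is \<open>- Im g / \<pi>\<close> on the real line. The Poisson formula identifies the imaginary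
  part of its Cauchy transform with that of \<open>g\<close>; multiplied by \<open>y\<close> at the point \<open>iy\<close> and with \<open>y \<rightarrow> \<infinity>\<close> it
  shows that the total mass is \<open>1\<close>. The remaining real constant vanishes because both functions decay along
  the imaginary axis.\<close>

lemma cauchy_transform_of_shift:
  fixes g :: "complex \<Rightarrow> complex"
  assumes hol: "g holomorphic_on {w. Im w > - \<epsilon>}" and \<epsilon>: "\<epsilon> > 0"
    and C: "\<And>w. Im w \<ge> 0 \<Longrightarrow> norm (g w) \<le> C"
    and neg: "\<And>w. Im w \<ge> 0 \<Longrightarrow> Im (g w) \<le> 0"
    and lim: "((\<lambda>y::real. \<i> * of_real y * g (\<i> * of_real y)) \<longlongrightarrow> 1) at_top"
  obtains \<rho> where "real_distribution \<rho>" "\<And>z. Im z > 0 \<Longrightarrow> cauchy_transform \<rho> z = g z"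
proof -
  define p where "p t = - Im (g (of_real t)) / pi" for t :: real
  have p0: "p t \<ge> 0" for t
    unfolding p_def using neg[of "of_real t"] by (intro divide_nonneg_nonneg) auto
  have gc: "continuous_on UNIV (\<lambda>t::real. g (of_real t))"
    by (rule continuous_on_compose2[OF holomorphic_on_imp_continuous_on[OF hol]])
       (use \<epsilon> in \<open>auto intro!: continuous_intros\<close>)
  have pm[measurable]: "p \<in> borel_measurable borel"
    unfolding p_def[abs_def]
    by (intro borel_measurable_continuous_onI continuous_intros gc) auto
  have poisson: "(\<integral>\<^sup>+t. ennreal (p t * (Im z / (norm (z - of_real t))\<^sup>2)) \<partial>lborel) = ennreal (- Im (g z))"
    if "Im z > 0" for z
    unfolding p_def by (rule half_plane_Poisson[OF hol \<epsilon> C neg that])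
  define \<rho> where "\<rho> = density lborel (\<lambda>t. ennreal (p t))"
  have limRe: "((\<lambda>y::real. y * - Im (g (\<i> * of_real y))) \<longlongrightarrow> 1) at_top"
    using tendsto_Re[OF lim] by simp
  have total: "(\<integral>\<^sup>+t. ennreal (p t) \<partial>lborel) = 1"
  proof -
    \<comment> \<open>\<open>y\<close> times the Poisson kernel at \<open>iy\<close> increases to \<open>1\<close> as \<open>y \<rightarrow> \<infinity>\<close>.\<close>
    define k where "k n t = (real (Suc n))\<^sup>2 / ((real (Suc n))\<^sup>2 + t\<^sup>2)" for n and t :: real
    have k_eq: "k n t = 1 - t\<^sup>2 / ((real (Suc n))\<^sup>2 + t\<^sup>2)" for n t
    proof -
      have "(real (Suc n))\<^sup>2 + t\<^sup>2 > 0" by (intro add_pos_nonneg) auto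
      then show ?thesis by (simp add: k_def field_simps)
    qed
    have pk: "(\<integral>\<^sup>+t. ennreal (p t * k n t) \<partial>lborel) = ennreal (Suc n * - Im (g (\<i> * of_real (Suc n))))" for n
    proof -
      let ?y = "real (Suc n)"
      have "ennreal (p t * k n t) = ennreal ?y * ennreal (p t * (Im (\<i> * of_real ?y) / (norm (\<i> * of_real ?y - of_real t))\<^sup>2))" for t
      proof -
        have "(norm (\<i> * of_real ?y - of_real t))\<^sup>2 = ?y\<^sup>2 + t\<^sup>2"
          by (simp only: cmod_power2) (simp del: of_nat_Suc)
        then have "p t * k n t = ?y * (p t * (Im (\<i> * of_real ?y) / (norm (\<i> * of_real ?y - of_real t))\<^sup>2))"
          by (simp only: k_def) (simp add: power2_eq_square del: of_nat_Suc)
        then show ?thesis by (simp only: ennreal_mult[OF of_nat_0_le_iff] p0 mult_nonneg_nonneg divide_nonneg_nonneg)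
             (subst ennreal_mult, auto simp: p0)
      qed
      then have "(\<integral>\<^sup>+t. ennreal (p t * k n t) \<partial>lborel)
          = ennreal ?y * (\<integral>\<^sup>+t. ennreal (p t * (Im (\<i> * of_real ?y) / (norm (\<i> * of_real ?y - of_real t))\<^sup>2)) \<partial>lborel)"
        by (simp only:) (subst nn_integral_cmult, auto)
      also have "\<dots> = ennreal ?y * ennreal (- Im (g (\<i> * of_real ?y)))"
        by (subst poisson) auto
      also have "\<dots> = ennreal (?y * - Im (g (\<i> * of_real ?y)))"
        using neg[of "\<i> * of_real ?y"] by (subst ennreal_mult) auto
      finally show ?thesis .
    qed
    have "(\<lambda>n. \<integral>\<^sup>+t. ennreal (p t * k n t) \<partial>lborel) \<longlonglongrightarrow> (\<integral>\<^sup>+t. ennreal (p t) \<partial>lborel)"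
    proof (rule nn_integral_LIMSEQ)
      show "incseq (\<lambda>n t. ennreal (p t * k n t))"
        unfolding k_eq
        by (auto simp: incseq_def le_fun_def p0 intro!: ennreal_leI mult_left_mono diff_left_mono divide_left_mono
            power_mono mult_pos_pos add_pos_nonneg)
      show "(\<lambda>t. ennreal (p t * k n t)) \<in> borel_measurable lborel" for n
        unfolding k_def[abs_def] by measurable
      show "(\<lambda>n. ennreal (p t * k n t)) \<longlonglongrightarrow> ennreal (p t)" for t
      proof -
        have "(\<lambda>n. t\<^sup>2 / ((real (Suc n))\<^sup>2 + t\<^sup>2)) \<longlonglongrightarrow> 0" by real_asymp
        then have "(\<lambda>n. p t * k n t) \<longlonglongrightarrow> p t * (1 - 0)"
          unfolding k_eq by (intro tendsto_intros) 
        then show ?thesis by (intro tendsto_ennrealI) simp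
      qed
    qed
    moreover have "(\<lambda>n. ennreal (Suc n * - Im (g (\<i> * of_real (Suc n))))) \<longlonglongrightarrow> ennreal 1"
      using filterlim_compose[OF limRe filterlim_compose[OF filterlim_real_sequentially filterlim_Suc]]
      by (intro tendsto_ennrealI) (simp add: o_def)
    ultimately show ?thesis unfolding pk using LIMSEQ_unique by fastforce
  qed
  have rd: "real_distribution \<rho>"
  proof -
    have "prob_space \<rho>"
      by (rule prob_spaceI) (simp add: \<rho>_def emeasure_density total)
    then show ?thesis by (simp add: real_distribution_def real_distribution_axioms_def \<rho>_def)
  qed
  interpret \<rho>: real_distribution \<rho> by (rule rd)
  have Im_eq: "Im (cauchy_transform \<rho> z) = Im (g z)" if z: "Im z > 0" for z
  proof -
    have "ennreal (cauchy_energy \<rho> z) = (\<integral>\<^sup>+t. ennreal (1 / (norm (z - of_real t))\<^sup>2) \<partial>\<rho>)"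
      unfolding cauchy_energy_def
      by (rule nn_integral_eq_integral[symmetric, OF \<rho>.integrable_cauchy_kernel_sq[OF z]]) auto
    also have "\<dots> = (\<integral>\<^sup>+t. ennreal (p t) * ennreal (1 / (norm (z - of_real t))\<^sup>2) \<partial>lborel)"
      unfolding \<rho>_def by (subst nn_integral_density) auto
    finally have "ennreal (Im z) * ennreal (cauchy_energy \<rho> z)
        = (\<integral>\<^sup>+t. ennreal (Im z) * (ennreal (p t) * ennreal (1 / (norm (z - of_real t))\<^sup>2)) \<partial>lborel)"
      by (simp add: nn_integral_cmult)
    also have "\<dots> = (\<integral>\<^sup>+t. ennreal (p t * (Im z / (norm (z - of_real t))\<^sup>2)) \<partial>lborel)"
      using z by (intro nn_integral_cong) (simp add: ennreal_mult[symmetric] p0 mult_ac)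
    also have "\<dots> = ennreal (- Im (g z))" by (rule poisson[OF z])
    finally have "ennreal (Im z * cauchy_energy \<rho> z) = ennreal (- Im (g z))"
      using z \<rho>.cauchy_energy_pos[OF z] by (simp add: ennreal_mult)
    then have "Im z * cauchy_energy \<rho> z = - Im (g z)"
      using z \<rho>.cauchy_energy_pos[OF z] neg[of z] by (subst (asm) ennreal_inj) auto
    then show ?thesis using \<rho>.Im_cauchy_transform[OF z] by simp
  qed
  define h where "h z = cauchy_transform \<rho> z - g z" for z
  have "h constant_on {z. Im z > 0}"
  proof (rule holomorphic_real_valued_const)
    show "h holomorphic_on {z. Im z > 0}"
      unfolding h_def[abs_def]
      by (intro holomorphic_intros \<rho>.holomorphic_cauchy_transform holomorphic_on_subset[OF hol])
         (use \<epsilon> in auto)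
    show "connected {z::complex. Im z > 0}"
      by (simp add: convex_connected convex_halfspace_Im_gt)
  qed (use Im_eq in \<open>auto simp: h_def open_halfspace_Im_gt\<close>)
  then obtain c where c: "\<And>z. Im z > 0 \<Longrightarrow> h z = c" by (auto simp: constant_on_def)
  have inv: "((\<lambda>y::real. 1 / y) \<longlongrightarrow> 0) at_top" by real_asymp
  have "((\<lambda>y::real. h (\<i> * of_real y)) \<longlongrightarrow> 0 - 0) at_top"
    unfolding h_def
  proof (rule tendsto_diff)
    show "((\<lambda>y::real. cauchy_transform \<rho> (\<i> * of_real y)) \<longlongrightarrow> 0) at_top"
    proof (rule Lim_null_comparison[OF _ inv])
      show "\<forall>\<^sub>F y::real in at_top. norm (cauchy_transform \<rho> (\<i> * of_real y)) \<le> 1 / y"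
        using eventually_gt_at_top[of 0]
      proof eventually_elim
        case (elim y)
        then show ?case using \<rho>.norm_cauchy_transform_le[of "\<i> * of_real y"] by simp
      qed
    qed
    have "((\<lambda>y::real. (- \<i> * of_real (1 / y)) * (\<i> * of_real y * g (\<i> * of_real y))) \<longlongrightarrow> (- \<i> * of_real 0) * 1) at_top"
      by (intro tendsto_intros lim inv)
    moreover have "\<forall>\<^sub>F y::real in at_top. (- \<i> * of_real (1 / y)) * (\<i> * of_real y * g (\<i> * of_real y)) = g (\<i> * of_real y)"
      using eventually_gt_at_top[of "0::real"] by eventually_elim simp
    ultimately show "((\<lambda>y::real. g (\<i> * of_real y)) \<longlongrightarrow> 0) at_top"
      using Lim_transform_eventually by fastforce
  qed
  moreover have "((\<lambda>y::real. h (\<i> * of_real y)) \<longlongrightarrow> c) at_top"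
    by (rule tendsto_eventually) (use eventually_gt_at_top[of "0::real"] in \<open>eventually_elim, simp add: c\<close>)
  ultimately have "c = 0" using tendsto_unique by force
  then show ?thesis using that[OF rd] c by (simp add: h_def)
qed

text \<open>Each shift \<open>g(z + i\<epsilon>)\<close> is a Cauchy transform. The measures are tight as \<open>\<epsilon> \<rightarrow> 0\<close>, since the mass
  outside \<open>[-y, y]\<close> is controlled by \<open>1 + y Im g(iy + i\<epsilon>)\<close>, so a subsequence converges weakly, and the
  kernel \<open>1 / (z - t)\<close> is a bounded continuous function of \<open>t\<close>.\<close>

lemma cauchy_transform_exists:
  fixes g :: "complex \<Rightarrow> complex"
  assumes hol: "g holomorphic_on {w. Im w > 0}"
    and bound: "\<And>w. Im w > 0 \<Longrightarrow> norm (g w) \<le> 1 / Im w"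
    and neg: "\<And>w. Im w > 0 \<Longrightarrow> Im (g w) \<le> 0"
    and lim: "((\<lambda>y::real. \<i> * of_real y * g (\<i> * of_real y)) \<longlongrightarrow> 1) at_top"
  obtains \<rho> where "real_distribution \<rho>" "\<And>z. Im z > 0 \<Longrightarrow> cauchy_transform \<rho> z = g z"
proof -
  define \<epsilon> where "\<epsilon> n = 1 / real (Suc n)" for n
  have \<epsilon>: "\<epsilon> n > 0" "\<epsilon> n \<le> 1" for n by (auto simp: \<epsilon>_def)
  have "\<exists>\<rho>. real_distribution \<rho> \<and> (\<forall>z. Im z > 0 \<longrightarrow> cauchy_transform \<rho> z = g (z + \<i> * of_real (\<epsilon> n)))" for n
  proof (rule cauchy_transform_of_shift[of "\<lambda>z. g (z + \<i> * of_real (\<epsilon> n))" "\<epsilon> n" "1 / \<epsilon> n"])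
    show "(\<lambda>z. g (z + \<i> * of_real (\<epsilon> n))) holomorphic_on {w. - \<epsilon> n < Im w}"
      by (rule holomorphic_on_comp[OF hol]) (auto intro!: holomorphic_intros)
    show "norm (g (w + \<i> * of_real (\<epsilon> n))) \<le> 1 / \<epsilon> n" if "Im w \<ge> 0" for w
    proof -
      have "norm (g (w + \<i> * of_real (\<epsilon> n))) \<le> 1 / (Im w + \<epsilon> n)"
        using bound[of "w + \<i> * of_real (\<epsilon> n)"] that \<epsilon>(1)[of n] by simp
      also have "\<dots> \<le> 1 / \<epsilon> n" using that \<epsilon>(1)[of n] by (intro divide_left_mono) auto
      finally show ?thesis .
    qed
    show "Im (g (w + \<i> * of_real (\<epsilon> n))) \<le> 0" if "Im w \<ge> 0" for w
      using neg[of "w + \<i> * of_real (\<epsilon> n)"] that \<epsilon>(1)[of n] by simp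
    have "filterlim (\<lambda>y::real. y + \<epsilon> n) at_top at_top"
      by real_asymp
    from filterlim_compose[OF lim this]
    have 1: "((\<lambda>y::real. \<i> * of_real (y + \<epsilon> n) * g (\<i> * of_real (y + \<epsilon> n))) \<longlongrightarrow> 1) at_top" .
    have 2: "((\<lambda>y::real. y / (y + \<epsilon> n)) \<longlongrightarrow> 1) at_top" by real_asymp
    have "((\<lambda>y::real. of_real (y / (y + \<epsilon> n)) * (\<i> * of_real (y + \<epsilon> n) * g (\<i> * of_real (y + \<epsilon> n)))) \<longlongrightarrow> of_real 1 * 1) at_top"
      by (intro tendsto_intros 1 2)
    moreover have "\<forall>\<^sub>F y::real in at_top. of_real (y / (y + \<epsilon> n)) * (\<i> * of_real (y + \<epsilon> n) * g (\<i> * of_real (y + \<epsilon> n)))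
         = \<i> * of_real y * g (\<i> * of_real y + \<i> * of_real (\<epsilon> n))"
      using eventually_gt_at_top[of 0]
    proof eventually_elim
      case (elim y)
      have cancel: "of_real (y / s) * (\<i> * of_real s * X) = \<i> * of_real y * X" if "s \<noteq> 0" for s :: real and X
        using that by simp
      have "\<i> * of_real (y + \<epsilon> n) = \<i> * of_real y + \<i> * of_real (\<epsilon> n)" by (simp add: distrib_left)
      then show ?case using cancel[of "y + \<epsilon> n"] elim \<epsilon>(1)[of n] by simp
    qed
    ultimately show "((\<lambda>y::real. \<i> * of_real y * g (\<i> * of_real y + \<i> * of_real (\<epsilon> n))) \<longlongrightarrow> 1) at_top"
      using Lim_transform_eventually by fastforce
  qed (use \<epsilon> in auto)
  then obtain \<rho> where rd: "\<And>n. real_distribution (\<rho> n)"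
    and G: "\<And>n z. Im z > 0 \<Longrightarrow> cauchy_transform (\<rho> n) z = g (z + \<i> * of_real (\<epsilon> n))" by metis
  interpret \<rho>: real_distribution "\<rho> n" for n by (rule rd)
  have "tight \<rho>"
    unfolding tight_def
  proof (intro conjI allI impI)
    show "real_distribution (\<rho> n)" for n by (rule rd)
    fix e :: real assume e: "e > 0"
    define d where "d = min (e / 8) (1 / 2)"
    have d: "d > 0" "d \<le> 1 / 2" "8 * d \<le> e" using e by (auto simp: d_def)
    have "((\<lambda>y::real. y * - Im (g (\<i> * of_real y))) \<longlongrightarrow> 1) at_top"
      using tendsto_Re[OF lim] by simp
    then have "\<forall>\<^sub>F y::real in at_top. y * - Im (g (\<i> * of_real y)) > 1 - d"
      by (rule order_tendstoD(1)) (use d in simp)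
    then obtain Y where Y: "\<And>y. y \<ge> Y \<Longrightarrow> y * - Im (g (\<i> * of_real y)) > 1 - d"
      unfolding eventually_at_top_linorder by blast
    define y where "y = max (max Y 1) (1 / d)"
    have yy: "y \<ge> 1" "y \<ge> 1 / d" "y \<ge> Y" by (auto simp: y_def)
    then have y: "y \<ge> Y" "y > 0" "1 / y \<le> d"
      using d by (auto simp: divide_le_eq mult.commute)
    have small: "measure (\<rho> n) {-y<..y} > 1 - e" for n
    proof -
      \<comment> \<open>Both \<open>s * - Im (g (is))\<close> and \<open>y / s\<close> exceed \<open>1 - d\<close>, and \<open>y * - Im (g (is))\<close> is the integral of \<open>y\<^sup>2 / (y\<^sup>2 + t\<^sup>2)\<close>.\<close>
      define s where "s = y + \<epsilon> n"
      have s: "s \<ge> Y" "s > 0" "s \<le> y + 1" using y \<epsilon>[of n] by (auto simp: s_def)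
      have gs: "s * - Im (g (\<i> * of_real s)) > 1 - d" using Y s by blast
      have "y / s \<ge> y / (y + 1)" using s y by (intro divide_left_mono) auto
      also have "y / (y + 1) \<ge> 1 - d" using y d by (simp add: field_simps) 
      finally have ys: "y / s \<ge> 1 - d" using \<open>y / (y + 1) \<ge> 1 - d\<close> \<open>y / s \<ge> y / (y + 1)\<close> by linarith
      have z: "Im (\<i> * of_real y) > 0" using y by simp
      define E where "E = cauchy_energy (\<rho> n) (\<i> * of_real y)"
      have "(1 - d) * (1 - d) \<le> (y / s) * (s * - Im (g (\<i> * of_real s)))"
        using ys gs d by (intro mult_mono) auto
      also have "\<dots> = y * - Im (cauchy_transform (\<rho> n) (\<i> * of_real y))"
        using s by (simp add: G[OF z] s_def distrib_left)
      also have "\<dots> = y\<^sup>2 * E"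
        using \<rho>.Im_cauchy_transform[OF z] by (simp add: E_def power2_eq_square)
      finally have yE: "y\<^sup>2 * E \<ge> (1 - d) * (1 - d)" .
      have "y\<^sup>2 * E = (LINT t|\<rho> n. y\<^sup>2 * (1 / (norm (\<i> * of_real y - of_real t))\<^sup>2))"
        unfolding E_def cauchy_energy_def by (rule integral_mult_right_zero[symmetric])
      also have "\<dots> \<le> (LINT t|\<rho> n. 1 / 2 + 1 / 2 * indicator {-y<..y} t)"
      proof (rule integral_mono)
        show "integrable (\<rho> n) (\<lambda>t. y\<^sup>2 * (1 / (norm (\<i> * of_real y - of_real t))\<^sup>2))"
          by (intro integrable_mult_right \<rho>.integrable_cauchy_kernel_sq z)
        show "integrable (\<rho> n) (\<lambda>t. 1 / 2 + 1 / 2 * indicator {-y<..y} t :: real)"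
          by (intro Bochner_Integration.integrable_add integrable_mult_right)
             (auto intro: integrable_real_indicator simp: less_top[symmetric])
        fix t
        have n: "(norm (\<i> * of_real y - of_real t))\<^sup>2 = y\<^sup>2 + t\<^sup>2" by (simp only: cmod_power2) simp
        have p: "y\<^sup>2 > 0" "t\<^sup>2 \<ge> 0" using y by auto
        have frac: "p * (1 / (p + q)) \<le> 1" "p \<le> q \<Longrightarrow> p * (1 / (p + q)) \<le> 1 / 2"
          if "p > 0" "q \<ge> 0" for p q :: real
          using that by (simp_all add: divide_simps)
        show "y\<^sup>2 * (1 / (norm (\<i> * of_real y - of_real t))\<^sup>2) \<le> 1 / 2 + 1 / 2 * indicator {-y<..y} t"
        proof (cases "t \<in> {-y<..y}")
          case True
          then show ?thesis unfolding n using frac(1)[OF p] by simp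
        next
          case False
          then have "\<bar>y\<bar> \<le> \<bar>t\<bar>" using y(2) by (cases "t \<le> - y") auto
          then have "y\<^sup>2 \<le> t\<^sup>2" by (simp add: abs_le_square_iff)
          from frac(2)[OF p this] show ?thesis unfolding n using False by (simp del: greaterThanAtMost_iff)
        qed
      qed
      also have "\<dots> = 1 / 2 + 1 / 2 * measure (\<rho> n) {-y<..y}"
        by (subst Bochner_Integration.integral_add)
           (auto intro: integrable_mult_right integrable_real_indicator simp: less_top[symmetric])
      finally have "measure (\<rho> n) {-y<..y} \<ge> 2 * ((1 - d) * (1 - d)) - 1" using yE by linarith
      moreover have "2 * ((1 - d) * (1 - d)) - 1 = 1 - 4 * d + 2 * (d * d)" by (simp add: algebra_simps)
      moreover have "d * d > 0" using d by simp
      ultimately show ?thesis using d by linarith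
    qed
    show "\<exists>a b. a < b \<and> (\<forall>n. 1 - e < measure (\<rho> n) {a<..b})"
      using small y by (intro exI[of _ "-y"] exI[of _ y]) auto
  qed
  from tight_imp_convergent_subsubsequence[OF this strict_mono_id]
  obtain r \<sigma> where r: "strict_mono (r :: nat \<Rightarrow> nat)" and \<sigma>: "real_distribution \<sigma>"
    and conv: "weak_conv_m (\<rho> \<circ> id \<circ> r) \<sigma>" by blast
  have "cauchy_transform \<sigma> z = g z" if z: "Im z > 0" for z
  proof (rule LIMSEQ_unique)
    show "(\<lambda>n. cauchy_transform (\<rho> (r n)) z) \<longlonglongrightarrow> cauchy_transform \<sigma> z"
      unfolding cauchy_transform_def
    proof (rule weak_conv_imp_integral_bdd_continuous_conv[of "\<lambda>n. \<rho> (r n)", OF rd \<sigma>])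
      show "weak_conv_m (\<lambda>n. \<rho> (r n)) \<sigma>" using conv by (simp add: o_def)
      show "isCont (\<lambda>t. 1 / (z - complex_of_real t)) t" for t
        using diff_real_nonzero[OF z] by (intro continuous_intros) auto
      show "norm (1 / (z - complex_of_real t)) \<le> 1 / Im z" for t
        by (rule norm_cauchy_kernel_le[OF z])
    qed
    have "(\<lambda>n. \<epsilon> (r n)) \<longlonglongrightarrow> 0"
    proof -
      have "\<epsilon> \<longlonglongrightarrow> 0" unfolding \<epsilon>_def by real_asymp
      from LIMSEQ_subseq_LIMSEQ[OF this r] show ?thesis by (simp add: o_def)
    qed
    then have "(\<lambda>n. z + \<i> * of_real (\<epsilon> (r n))) \<longlonglongrightarrow> z + \<i> * of_real 0"
      by (intro tendsto_intros)
    moreover have "isCont g z"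
      using hol z by (intro analytic_at_imp_isCont)
        (auto simp: analytic_at open_halfspace_Im_gt intro!: exI[of _ "{w. Im w > 0}"])
    ultimately have "(\<lambda>n. g (z + \<i> * of_real (\<epsilon> (r n)))) \<longlonglongrightarrow> g z"
      using isCont_tendsto_compose[of z g] by simp
    then show "(\<lambda>n. cauchy_transform (\<rho> (r n)) z) \<longlonglongrightarrow> g z"
      by (simp add: G[OF z])
  qed
  then show ?thesis using that \<sigma> by blast
qed

section \<open>Stieltjes inversion\<close>

lemma Complex_minus_real_norm_sq: "(norm (Complex x y - of_real t))\<^sup>2 = (x - t)\<^sup>2 + y\<^sup>2"
  unfolding cmod_power2 by simp

lemma cauchy_kernel_integral:
  assumes "y > 0" "a \<le> b"
  shows "(\<integral>\<^sup>+x. ennreal (y / ((x - t)\<^sup>2 + y\<^sup>2)) * indicator {a..b} x \<partial>lborel)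
    = ennreal (arctan ((b - t) / y) - arctan ((a - t) / y))"
proof (rule nn_integral_FTC_Icc)
  have d: "((\<lambda>x. arctan ((x - t) / y)) has_real_derivative y / ((x - t)\<^sup>2 + y\<^sup>2)) (at x)" for x
  proof -
    have "((\<lambda>x. arctan ((x - t) / y)) has_real_derivative (inverse (1 + ((x - t) / y)\<^sup>2) * (1 / y))) (at x)"
      by (rule DERIV_chain2[OF DERIV_arctan]) (use assms in \<open>auto intro!: derivative_eq_intros\<close>)
    moreover have "inverse (1 + ((x - t) / y)\<^sup>2) * (1 / y) = y / ((x - t)\<^sup>2 + y\<^sup>2)"
    proof -
      have "1 + ((x - t) / y)\<^sup>2 = ((x - t)\<^sup>2 + y\<^sup>2) / y\<^sup>2"
        using assms(1) by (simp add: power_divide add_divide_distrib)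
      then show ?thesis using assms(1) by (simp add: power2_eq_square)
    qed
    ultimately show ?thesis by metis
  qed
  then show "\<And>x. x \<in> {a..b} \<Longrightarrow> ((\<lambda>x. arctan ((x - t) / y)) has_real_derivative y / ((x - t)\<^sup>2 + y\<^sup>2)) (at x)"
    by blast
qed (use assms in auto)

lemma arctan_Suc_scaled_limit:
  fixes c :: real
  shows "(\<lambda>n. arctan (c / (1 / real (Suc n)))) \<longlonglongrightarrow> (if c > 0 then pi / 2 else if c < 0 then - (pi / 2) else 0)"
proof -
  consider "c > 0" | "c < 0" | "c = 0" by linarith
  then show ?thesis
  proof cases
    case 1
    then have "filterlim (\<lambda>n. c / (1 / real (Suc n))) at_top sequentially" by real_asymp
    from filterlim_compose[OF tendsto_arctan_at_top this] 1 show ?thesis by simp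
  next
    case 2
    then have "filterlim (\<lambda>n. c / (1 / real (Suc n))) at_bot sequentially" by real_asymp
    from filterlim_compose[OF tendsto_arctan_at_bot this] 2 show ?thesis by simp
  qed simp
qed

context real_distribution
begin

text \<open>Fubini's theorem for the Poisson kernel, whose primitive in \<open>x\<close> is an arctangent.\<close>

lemma nn_integral_cauchy_transform:
  assumes y: "y > 0" and ab: "a \<le> b"
  shows "(\<integral>\<^sup>+x. ennreal (- Im (cauchy_transform M (Complex x y))) * indicator {a..b} x \<partial>lborel)
    = ennreal (LINT t|M. arctan ((b - t) / y) - arctan ((a - t) / y))"
proof -
  have k: "ennreal (- Im (cauchy_transform M (Complex x y))) = (\<integral>\<^sup>+t. ennreal (y / ((x - t)\<^sup>2 + y\<^sup>2)) \<partial>M)" for x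
  proof -
    have z: "Im (Complex x y) > 0" using y by simp
    have "- Im (cauchy_transform M (Complex x y)) = (LINT t|M. y * (1 / (norm (Complex x y - of_real t))\<^sup>2))"
      unfolding Im_cauchy_transform[OF z] cauchy_energy_def integral_mult_right_zero by simp
    also have "\<dots> = (LINT t|M. y / ((x - t)\<^sup>2 + y\<^sup>2))"
      unfolding Complex_minus_real_norm_sq by simp
    finally show ?thesis
      using y integrable_mult_right[OF integrable_cauchy_kernel_sq[OF z], of y]
      unfolding Complex_minus_real_norm_sq by (subst nn_integral_eq_integral) auto
  qed
  interpret pair_sigma_finite M "lborel :: real measure" by standard
  have "(\<integral>\<^sup>+x. ennreal (- Im (cauchy_transform M (Complex x y))) * indicator {a..b} x \<partial>lborel)
    = (\<integral>\<^sup>+x. (\<integral>\<^sup>+t. ennreal (y / ((x - t)\<^sup>2 + y\<^sup>2)) * indicator {a..b} x \<partial>M) \<partial>lborel)"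
    unfolding k by (intro nn_integral_cong nn_integral_multc[symmetric]) measurable
  also have "\<dots> = (\<integral>\<^sup>+t. (\<integral>\<^sup>+x. ennreal (y / ((x - t)\<^sup>2 + y\<^sup>2)) * indicator {a..b} x \<partial>lborel) \<partial>M)"
    by (rule Fubini') measurable
  also have "\<dots> = (\<integral>\<^sup>+t. ennreal (arctan ((b - t) / y) - arctan ((a - t) / y)) \<partial>M)"
    using cauchy_kernel_integral[OF y ab] by simp
  also have "\<dots> = ennreal (LINT t|M. arctan ((b - t) / y) - arctan ((a - t) / y))"
  proof (rule nn_integral_eq_integral)
    show "integrable M (\<lambda>t. arctan ((b - t) / y) - arctan ((a - t) / y))"
    proof (rule integrable_const_bound[where B = "pi"])
      show "AE t in M. norm (arctan ((b - t) / y) - arctan ((a - t) / y)) \<le> pi"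
      proof (rule AE_I2)
        fix t
        show "norm (arctan ((b - t) / y) - arctan ((a - t) / y)) \<le> pi"
          using arctan_bounded[of "(b - t) / y"] arctan_bounded[of "(a - t) / y"] by (auto simp: abs_le_iff)
      qed
    qed measurable
  qed (use y ab in \<open>auto intro!: AE_I2 arctan_monotone' divide_right_mono\<close>)
  finally show ?thesis .
qed

text \<open>The distribution function with half of the jump at \<open>x\<close>; this is the normalisation that the limit
  of \<open>arctan\<close> produces.\<close>

definition sym_cdf :: "real \<Rightarrow> real"
  where "sym_cdf x = (prob {..x} + prob {..<x}) / 2"

lemma Stieltjes_inversion:
  assumes "a < b"
  shows "(\<lambda>n. \<integral>\<^sup>+x. ennreal (- Im (cauchy_transform M (Complex x (1 / real (Suc n))))) * indicator {a..b} x \<partial>lborel)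
    \<longlonglongrightarrow> ennreal (pi * (sym_cdf b - sym_cdf a))"
proof -
  \<comment> \<open>The limit of \<open>arctan (c / y)\<close> as \<open>y\<close> decreases to \<open>0\<close>.\<close>
  define s where "s c = (if c > 0 then pi / 2 else if c < 0 then - (pi / 2) else 0)" for c :: real
  have s_eq: "s (c - t) = pi / 2 * (indicator {..c} t + indicator {..<c} t - 1)" for c t
    by (auto simp: s_def indicator_def)
  have "(\<lambda>n. LINT t|M. arctan ((b - t) / (1 / real (Suc n))) - arctan ((a - t) / (1 / real (Suc n))))
      \<longlonglongrightarrow> (LINT t|M. s (b - t) - s (a - t))"
  proof (rule integral_dominated_convergence[where w = "\<lambda>_. pi"])
    show "(\<lambda>t. s (b - t) - s (a - t)) \<in> borel_measurable M" unfolding s_eq by measurable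
    show "AE t in M. (\<lambda>n. arctan ((b - t) / (1 / real (Suc n))) - arctan ((a - t) / (1 / real (Suc n))))
       \<longlonglongrightarrow> s (b - t) - s (a - t)"
      unfolding s_def by (intro AE_I2 tendsto_diff arctan_Suc_scaled_limit)
    show "AE t in M. norm (arctan ((b - t) / (1 / real (Suc n))) - arctan ((a - t) / (1 / real (Suc n)))) \<le> pi" for n
    proof (rule AE_I2)
      fix t
      show "norm (arctan ((b - t) / (1 / real (Suc n))) - arctan ((a - t) / (1 / real (Suc n)))) \<le> pi"
        using arctan_bounded[of "(b - t) / (1 / real (Suc n))"] arctan_bounded[of "(a - t) / (1 / real (Suc n))"]
        unfolding real_norm_def abs_le_iff by linarith
    qed
  qed auto
  also have "(LINT t|M. s (b - t) - s (a - t)) = pi * (sym_cdf b - sym_cdf a)"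
  proof -
    have i: "integrable M (indicator {..c} :: real \<Rightarrow> real)" "integrable M (indicator {..<c} :: real \<Rightarrow> real)" for c
      by (auto intro!: integrable_real_indicator simp: less_top[symmetric])
    have "s (b - t) - s (a - t) = pi / 2 * ((indicator {..b} t + indicator {..<b} t) - (indicator {..a} t + indicator {..<a} t))" for t
      unfolding s_eq by (simp add: algebra_simps)
    then have "(LINT t|M. s (b - t) - s (a - t)) = pi / 2 * ((prob {..b} + prob {..<b}) - (prob {..a} + prob {..<a}))"
      using i by (simp only: integral_mult_right_zero Bochner_Integration.integral_diff Bochner_Integration.integral_add
          Bochner_Integration.integrable_add integral_indicator) simp
    then show ?thesis by (simp add: sym_cdf_def field_simps)
  qed
  finally have "(\<lambda>n. ennreal (LINT t|M. arctan ((b - t) / (1 / real (Suc n))) - arctan ((a - t) / (1 / real (Suc n)))))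
      \<longlonglongrightarrow> ennreal (pi * (sym_cdf b - sym_cdf a))" by (rule tendsto_ennrealI)
  then show ?thesis
    using nn_integral_cauchy_transform[of _ a b] assms by (simp del: of_nat_Suc)
qed

lemma sym_cdf_mono: "a \<le> b \<Longrightarrow> sym_cdf a \<le> sym_cdf b"
  unfolding sym_cdf_def by (intro divide_right_mono add_mono finite_measure_mono) auto

lemma sym_cdf_bounds: 
  shows "sym_cdf x \<le> cdf M x" and "x < y \<Longrightarrow> cdf M x \<le> sym_cdf y" and "0 \<le> sym_cdf x"
proof -
  have "prob {..<x} \<le> prob {..x}" by (intro finite_measure_mono) auto
  then show "sym_cdf x \<le> cdf M x" by (simp add: sym_cdf_def cdf_def)
  show "0 \<le> sym_cdf x" by (simp add: sym_cdf_def)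
  assume "x < y"
  then have "prob {..x} \<le> prob {..<y}" "prob {..x} \<le> prob {..y}"
    by (auto intro!: finite_measure_mono)
  then show "cdf M x \<le> sym_cdf y" by (simp add: sym_cdf_def cdf_def)
qed

lemma sym_cdf_at_right: "(sym_cdf \<longlongrightarrow> cdf M x) (at_right x)"
proof (rule tendsto_sandwich)
  show "\<forall>\<^sub>F y in at_right x. cdf M x \<le> sym_cdf y"
    using eventually_at_right_less[of x] by eventually_elim (rule sym_cdf_bounds(2))
  show "(cdf M \<longlongrightarrow> cdf M x) (at_right x)"
    using cdf_is_right_cont by (simp add: continuous_within)
qed (auto simp: sym_cdf_bounds)

end

text \<open>Stieltjes inversion determines the increments of \<^const>\<open>real_distribution.sym_cdf\<close>, hence the function
  itself because it vanishes at \<open>-\<infinity>\<close>, hence the distribution function as its right limit.\<close>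

lemma cauchy_transform_inject:
  assumes "real_distribution \<rho>" "real_distribution \<sigma>"
    and eq: "\<And>z. Im z > 0 \<Longrightarrow> cauchy_transform \<rho> z = cauchy_transform \<sigma> z"
  shows "\<rho> = \<sigma>"
proof (rule cdf_unique)
  interpret \<rho>: real_distribution \<rho> by fact
  interpret \<sigma>: real_distribution \<sigma> by fact
  have diff: "\<rho>.sym_cdf b - \<rho>.sym_cdf a = \<sigma>.sym_cdf b - \<sigma>.sym_cdf a" if "a < b" for a b
  proof -
    have "ennreal (pi * (\<rho>.sym_cdf b - \<rho>.sym_cdf a)) = ennreal (pi * (\<sigma>.sym_cdf b - \<sigma>.sym_cdf a))"
      by (rule LIMSEQ_unique[OF \<rho>.Stieltjes_inversion[OF that]])
         (use \<sigma>.Stieltjes_inversion[OF that] in \<open>simp add: eq\<close>)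
    then show ?thesis
      using \<rho>.sym_cdf_mono[of a b] \<sigma>.sym_cdf_mono[of a b] that
      by (subst (asm) ennreal_inj) auto
  qed
  have eq_sym: "\<rho>.sym_cdf b = \<sigma>.sym_cdf b" for b
  proof -
    have l: "(\<lambda>n. \<rho>.sym_cdf (- real n)) \<longlonglongrightarrow> 0" "(\<lambda>n. \<sigma>.sym_cdf (- real n)) \<longlonglongrightarrow> 0"
      by (rule tendsto_sandwich[OF _ _ tendsto_const \<rho>.cdf_lim_neg_infty]
            tendsto_sandwich[OF _ _ tendsto_const \<sigma>.cdf_lim_neg_infty];
          use \<rho>.sym_cdf_bounds \<sigma>.sym_cdf_bounds in auto)+
    have "\<forall>\<^sub>F n in sequentially. \<rho>.sym_cdf b - \<rho>.sym_cdf (- real n) = \<sigma>.sym_cdf b - \<sigma>.sym_cdf (- real n)"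
    proof -
      obtain N where "- b < real N" using reals_Archimedean2 by blast
      then have "- real n < b" if "n \<ge> N" for n using of_nat_mono[OF that, where 'a = real] by linarith
      then show ?thesis unfolding eventually_sequentially using diff by blast
    qed
    moreover have "(\<lambda>n. \<rho>.sym_cdf b - \<rho>.sym_cdf (- real n)) \<longlonglongrightarrow> \<rho>.sym_cdf b - 0"
      by (intro tendsto_intros l)
    ultimately have "(\<lambda>n. \<sigma>.sym_cdf b - \<sigma>.sym_cdf (- real n)) \<longlonglongrightarrow> \<rho>.sym_cdf b - 0"
      by (rule Lim_transform_eventually[rotated])
    moreover have "(\<lambda>n. \<sigma>.sym_cdf b - \<sigma>.sym_cdf (- real n)) \<longlonglongrightarrow> \<sigma>.sym_cdf b - 0"
      by (intro tendsto_intros l)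
    ultimately show ?thesis using LIMSEQ_unique by fastforce
  qed
  then have "\<rho>.sym_cdf = \<sigma>.sym_cdf" by auto
  then show "cdf \<rho> = cdf \<sigma>"
    using \<rho>.sym_cdf_at_right \<sigma>.sym_cdf_at_right tendsto_unique[OF trivial_limit_at_right_real] by (metis ext)
qed (use assms in auto)


section \<open>The density where the Cauchy transform continues analytically\<close>

text \<open>The condition \<open>Im (h t) < 0\<close> on real \<open>t\<close> is part of the definition: it makes the boundary density positive
  and not merely nonnegative.\<close>

definition analytic_boundary_at :: "real measure \<Rightarrow> real \<Rightarrow> real \<Rightarrow> (complex \<Rightarrow> complex) \<Rightarrow> bool"
  where "analytic_boundary_at \<sigma> x r h \<longleftrightarrow> r > 0 \<and> h holomorphic_on ball (of_real x) r \<and>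
    (\<forall>z\<in>ball (of_real x) r. Im z > 0 \<longrightarrow> h z = cauchy_transform \<sigma> z) \<and>
    (\<forall>t. \<bar>t - x\<bar> < r \<longrightarrow> Im (h (of_real t)) < 0)"

definition analytic_boundary :: "real measure \<Rightarrow> real set"
  where "analytic_boundary \<sigma> = {x. \<exists>r h. analytic_boundary_at \<sigma> x r h}"

definition boundary_density :: "real measure \<Rightarrow> real \<Rightarrow> real"
  where "boundary_density \<sigma> x = - Im (Lim (at_right 0) (\<lambda>y. cauchy_transform \<sigma> (Complex x y))) / pi"

lemma dist_of_real_complex: "dist (complex_of_real x) (of_real t) = \<bar>t - x\<bar>"
  by (metis dist_commute dist_of_real dist_real_def)

lemma analytic_boundary_at_shift:
  assumes "analytic_boundary_at \<sigma> x r h" "\<bar>t - x\<bar> < r"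
  shows "analytic_boundary_at \<sigma> t (r - \<bar>t - x\<bar>) h"
proof -
  have sub: "ball (complex_of_real t) (r - \<bar>t - x\<bar>) \<subseteq> ball (of_real x) r"
  proof
    fix z assume "z \<in> ball (complex_of_real t) (r - \<bar>t - x\<bar>)"
    then show "z \<in> ball (of_real x) r"
      using dist_triangle[of "of_real x" z "of_real t"] dist_of_real_complex[of x t] by simp
  qed
  then show ?thesis
    using assms unfolding analytic_boundary_at_def
    by (auto intro: holomorphic_on_subset)
qed

lemma open_analytic_boundary: "open (analytic_boundary \<sigma>)"
  unfolding open_dist
proof
  fix x assume "x \<in> analytic_boundary \<sigma>"
  then obtain r h where rh: "analytic_boundary_at \<sigma> x r h" by (auto simp: analytic_boundary_def)
  then have "r > 0" by (simp add: analytic_boundary_at_def)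
  moreover have "t \<in> analytic_boundary \<sigma>" if "dist t x < r" for t
    using analytic_boundary_at_shift[OF rh] that by (auto simp: analytic_boundary_def dist_real_def)
  ultimately show "\<exists>e>0. \<forall>y. dist y x < e \<longrightarrow> y \<in> analytic_boundary \<sigma>" by blast
qed

lemma boundary_density_eq:
  assumes rh: "analytic_boundary_at \<sigma> x r h" and t: "\<bar>t - x\<bar> < r"
  shows "boundary_density \<sigma> t = - Im (h (of_real t)) / pi"
proof -
  have h': "analytic_boundary_at \<sigma> t (r - \<bar>t - x\<bar>) h" by (rule analytic_boundary_at_shift[OF rh t])
  define s where "s = r - \<bar>t - x\<bar>"
  have s: "s > 0" "h holomorphic_on ball (of_real t) s"
    "\<And>z. z \<in> ball (of_real t) s \<Longrightarrow> Im z > 0 \<Longrightarrow> h z = cauchy_transform \<sigma> z"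
    using h' unfolding analytic_boundary_at_def s_def by auto
  have "isCont h (of_real t)"
    using s(1,2) by (intro analytic_at_imp_isCont) (auto simp: analytic_at intro!: exI[of _ "ball (of_real t) s"])
  moreover have "((\<lambda>y. Complex t y) \<longlongrightarrow> of_real t) (at_right 0)"
    by (auto intro!: tendsto_eq_intros simp: complex_of_real_def)
  ultimately have "((\<lambda>y. h (Complex t y)) \<longlongrightarrow> h (of_real t)) (at_right 0)"
    by (rule isCont_tendsto_compose)
  moreover have "\<forall>\<^sub>F y in at_right 0. h (Complex t y) = cauchy_transform \<sigma> (Complex t y)"
  proof -
    have "\<forall>\<^sub>F y in at_right 0. y \<in> {0<..<s}" using s(1) by (rule eventually_at_right_real)
    then show ?thesis
    proof eventually_elim
      case (elim y)
      have "of_real t - Complex t y = - (\<i> * of_real y)" by (simp add: complex_eq_iff)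
      then have "dist (of_real t) (Complex t y) = y" using elim by (simp add: dist_norm norm_mult)
      then show ?case using s(3)[of "Complex t y"] elim by simp
    qed
  qed
  ultimately have "((\<lambda>y. cauchy_transform \<sigma> (Complex t y)) \<longlongrightarrow> h (of_real t)) (at_right 0)"
    by (rule Lim_transform_eventually)
  then have "Lim (at_right 0) (\<lambda>y. cauchy_transform \<sigma> (Complex t y)) = h (of_real t)"
    by (intro tendsto_Lim) auto
  then show ?thesis by (simp add: boundary_density_def)
qed

lemma boundary_density_pos: "x \<in> analytic_boundary \<sigma> \<Longrightarrow> boundary_density \<sigma> x > 0"
proof -
  assume "x \<in> analytic_boundary \<sigma>"
  then obtain r h where rh: "analytic_boundary_at \<sigma> x r h" by (auto simp: analytic_boundary_def)
  then have "r > 0" "Im (h (of_real x)) < 0" by (auto simp: analytic_boundary_at_def)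
  then show ?thesis using boundary_density_eq[OF rh, of x] by (simp add: divide_neg_pos)
qed

lemma continuous_on_boundary_density: "continuous_on (analytic_boundary \<sigma>) (boundary_density \<sigma>)"
proof -
  have "isCont (boundary_density \<sigma>) x" if x: "x \<in> analytic_boundary \<sigma>" for x
  proof -
    obtain r h where rh: "analytic_boundary_at \<sigma> x r h" using x by (auto simp: analytic_boundary_def)
    then have r: "r > 0" "h holomorphic_on ball (of_real x) r" by (auto simp: analytic_boundary_at_def)
    have "isCont h (of_real x)"
      using r by (intro analytic_at_imp_isCont) (auto simp: analytic_at intro!: exI[of _ "ball (of_real x) r"])
    then have "isCont (\<lambda>t::real. h (of_real t)) x"
      by (intro isCont_o2[of x complex_of_real h]) auto
    then have c: "isCont (\<lambda>t. - Im (h (of_real t)) / pi) x" by (intro continuous_intros) auto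
    have "\<forall>\<^sub>F t in nhds x. boundary_density \<sigma> t = - Im (h (of_real t)) / pi"
    proof -
      have "\<forall>\<^sub>F t in nhds x. t \<in> ball x r" using r by (intro eventually_nhds_in_open) auto
      then show ?thesis
        by eventually_elim (use boundary_density_eq[OF rh] in \<open>auto simp: dist_real_def abs_minus_commute\<close>)
    qed
    from isCont_cong[OF this] c show ?thesis by simp
  qed
  then show ?thesis by (simp add: continuous_at_imp_continuous_on)
qed


context real_distribution
begin

text \<open>Stieltjes inversion where the Cauchy transform is continuous up to the line: the integrands converge
  boundedly, so the limit may be taken under the integral. Half of the radius is used for the interval and
  a quarter for the height, which keeps all points in a compact disc.\<close>

lemma sym_cdf_increment_at_analytic_boundary:
  assumes rh: "analytic_boundary_at M x0 r h" and ab: "a < b" "\<bar>a - x0\<bar> \<le> r / 2" "\<bar>b - x0\<bar> \<le> r / 2"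
  shows "(\<integral>\<^sup>+x. ennreal (- Im (h (of_real x))) * indicator {a..b} x \<partial>lborel)
      = ennreal (pi * (sym_cdf b - sym_cdf a))"
proof -
  have r: "r > 0" "h holomorphic_on ball (of_real x0) r"
    and hG: "\<And>z. z \<in> ball (of_real x0) r \<Longrightarrow> Im z > 0 \<Longrightarrow> h z = cauchy_transform M z"
    using rh by (auto simp: analytic_boundary_at_def)
  define K where "K = cball (complex_of_real x0) (3 / 4 * r)"
  have K: "K \<subseteq> ball (of_real x0) r" "compact K" using r(1) by (auto simp: K_def)
  have hc: "continuous_on (ball (of_real x0) r) h" using r(2) by (rule holomorphic_on_imp_continuous_on)
  have "compact (h ` K)" using K hc by (intro compact_continuous_image continuous_on_subset[OF hc])
  then obtain B where B: "\<And>z. z \<in> K \<Longrightarrow> norm (h z) \<le> B"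
    using compact_imp_bounded bounded_iff by (metis imageI)
  have "(\<lambda>n. 1 / real (Suc n)) \<longlonglongrightarrow> 0" by real_asymp
  then have "\<forall>\<^sub>F n in sequentially. 1 / real (Suc n) < r / 4"
    by (rule order_tendstoD) (use r in simp)
  then obtain N where N: "\<And>n. n \<ge> N \<Longrightarrow> 1 / real (Suc n) < r / 4"
    unfolding eventually_sequentially by blast
  define y where "y n = 1 / real (Suc (n + N))" for n
  have y: "0 < y n" "y n < r / 4" for n using N[of "n + N"] by (auto simp: y_def)
  have y0: "y \<longlonglongrightarrow> 0" unfolding y_def by real_asymp
  have inK: "Complex x s \<in> K" if "x \<in> {a..b}" "0 \<le> s" "s < r / 4" for x s
  proof -
    have "\<bar>x0 - x\<bar> \<le> r / 2" using that ab unfolding abs_le_iff atLeastAtMost_iff by linarith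
    moreover have "norm (of_real x0 - Complex x s) \<le> \<bar>x0 - x\<bar> + \<bar>s\<bar>"
      using cmod_le[of "of_real x0 - Complex x s"] by simp
    ultimately show ?thesis using that by (simp add: K_def dist_norm)
  qed
  have "(\<lambda>n. \<integral>\<^sup>+x. ennreal (- Im (cauchy_transform M (Complex x (y n)))) * indicator {a..b} x \<partial>lborel)
     \<longlonglongrightarrow> (\<integral>\<^sup>+x. ennreal (- Im (h (of_real x))) * indicator {a..b} x \<partial>lborel)"
  proof (rule nn_integral_dominated_convergence[where w = "\<lambda>x. ennreal B * indicator {a..b} x"])
    show "(\<lambda>x. ennreal (- Im (cauchy_transform M (Complex x (y n)))) * indicator {a..b} x) \<in> borel_measurable lborel" for n
    proof -
      have "continuous_on UNIV (\<lambda>x. - Im (cauchy_transform M (Complex x (y n))))"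
        by (intro continuous_intros continuous_on_compose2[OF holomorphic_on_imp_continuous_on[OF holomorphic_cauchy_transform]])
           (use y in \<open>auto intro!: continuous_intros\<close>)
      then have "(\<lambda>x. - Im (cauchy_transform M (Complex x (y n)))) \<in> borel_measurable borel"
        by (rule borel_measurable_continuous_onI)
      then show ?thesis by measurable
    qed
    have "continuous_on {a..b} (\<lambda>x. - Im (h (of_real x)))"
    proof (intro continuous_intros continuous_on_compose2[OF hc])
      show "complex_of_real ` {a..b} \<subseteq> ball (of_real x0) r"
        using inK[of _ 0] r K(1) by (force simp: complex_of_real_def)
    qed
    then have m: "(\<lambda>x. indicator {a..b} x *\<^sub>R (- Im (h (of_real x)))) \<in> borel_measurable borel"
      by (intro borel_measurable_continuous_on_indicator) auto
    have "(\<lambda>x. ennreal (- Im (h (of_real x))) * indicator {a..b} x)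
        = (\<lambda>x. ennreal (indicator {a..b} x *\<^sub>R (- Im (h (of_real x)))))"
      by (auto simp: indicator_def)
    then show "(\<lambda>x. ennreal (- Im (h (of_real x))) * indicator {a..b} x) \<in> borel_measurable lborel"
      using m by simp
    show "AE x in lborel. ennreal (- Im (cauchy_transform M (Complex x (y n)))) * indicator {a..b} x
       \<le> ennreal B * indicator {a..b} x" for n
    proof (rule AE_I2)
      fix x
      show "ennreal (- Im (cauchy_transform M (Complex x (y n)))) * indicator {a..b} x
       \<le> ennreal B * indicator {a..b} x"
      proof (cases "x \<in> {a..b}")
        case True
        then have k: "Complex x (y n) \<in> K" using inK y less_imp_le by blast
        then have "h (Complex x (y n)) = cauchy_transform M (Complex x (y n))"
          using hG K y by auto
        then have "- Im (cauchy_transform M (Complex x (y n))) \<le> B"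
          using B[OF k] abs_Im_le_cmod[of "h (Complex x (y n))"] abs_ge_minus_self order_trans by metis
        then show ?thesis using True by (simp add: ennreal_leI)
      qed simp
    qed
    show "(\<integral>\<^sup>+x. ennreal B * indicator {a..b} x \<partial>lborel) < \<infinity>"
      using ab by (simp add: nn_integral_cmult_indicator ennreal_mult_less_top)
    show "AE x in lborel. (\<lambda>n. ennreal (- Im (cauchy_transform M (Complex x (y n)))) * indicator {a..b} x)
       \<longlonglongrightarrow> ennreal (- Im (h (of_real x))) * indicator {a..b} x"
    proof (rule AE_I2)
      fix x
      show "(\<lambda>n. ennreal (- Im (cauchy_transform M (Complex x (y n)))) * indicator {a..b} x)
       \<longlonglongrightarrow> ennreal (- Im (h (of_real x))) * indicator {a..b} x"
      proof (cases "x \<in> {a..b}")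
        case True
        have eq: "h (Complex x (y n)) = cauchy_transform M (Complex x (y n))" for n
          using inK[OF True less_imp_le[OF y(1)] y(2), of n] K y(1)[of n] by (intro hG) auto
        have x: "of_real x \<in> ball (complex_of_real x0) r"
          using inK[OF True, of 0] r K(1) by (auto simp: complex_of_real_def)
        have "isCont h (of_real x)"
          using x r by (intro analytic_at_imp_isCont) (auto simp: analytic_at intro!: exI[of _ "ball (of_real x0) r"])
        moreover have "(\<lambda>n. Complex x (y n)) \<longlonglongrightarrow> of_real x"
          using y0 by (auto intro!: tendsto_eq_intros simp: complex_of_real_def)
        ultimately have "(\<lambda>n. h (Complex x (y n))) \<longlonglongrightarrow> h (of_real x)"
          by (rule isCont_tendsto_compose)
        then have "(\<lambda>n. ennreal (- Im (h (Complex x (y n))))) \<longlonglongrightarrow> ennreal (- Im (h (of_real x)))"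
          by (intro tendsto_intros tendsto_ennrealI)
        then show ?thesis using True by (simp add: eq)
      qed simp
    qed
  qed auto
  moreover have "(\<lambda>n. \<integral>\<^sup>+x. ennreal (- Im (cauchy_transform M (Complex x (y n)))) * indicator {a..b} x \<partial>lborel)
     \<longlonglongrightarrow> ennreal (pi * (sym_cdf b - sym_cdf a))"
    unfolding y_def using LIMSEQ_ignore_initial_segment[OF Stieltjes_inversion[OF ab(1)], of N] .
  ultimately show ?thesis using LIMSEQ_unique by blast
qed

text \<open>The increments of \<^const>\<open>sym_cdf\<close> are bounded by a multiple of the length of the interval, so \<^const>\<open>sym_cdf\<close> is
  continuous there and agrees with the distribution function.\<close>

lemma emeasure_Ioc_at_analytic_boundary:
  assumes rh: "analytic_boundary_at M x0 r h" and ab: "a \<le> b" "\<bar>a - x0\<bar> < r / 2" "\<bar>b - x0\<bar> < r / 2"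
  shows "emeasure M {a<..b} = (\<integral>\<^sup>+x. ennreal (- Im (h (of_real x)) / pi) * indicator {a..b} x \<partial>lborel)"
proof (cases "a = b")
  case True then show ?thesis by (simp add: nn_integral_null_set)
next
  case False
  then have ab': "a < b" using ab by simp
  have r: "r > 0" "h holomorphic_on ball (of_real x0) r"
    and hneg: "\<And>t. \<bar>t - x0\<bar> < r \<Longrightarrow> Im (h (of_real t)) < 0"
    using rh by (auto simp: analytic_boundary_at_def)
  define I where "I a b = (\<integral>\<^sup>+x. ennreal (- Im (h (of_real x))) * indicator {a..b} x \<partial>lborel)" for a b
  have I: "I a b = ennreal (pi * (sym_cdf b - sym_cdf a))"
    if "a < b" "\<bar>a - x0\<bar> \<le> r / 2" "\<bar>b - x0\<bar> \<le> r / 2" for a b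
    unfolding I_def by (rule sym_cdf_increment_at_analytic_boundary[OF rh that])
  have hc: "continuous_on (ball (of_real x0) r) h" using r(2) by (rule holomorphic_on_imp_continuous_on)
  have "compact (h ` cball (complex_of_real x0) (r / 2))"
    using r(1) by (intro compact_continuous_image continuous_on_subset[OF hc]) auto
  then obtain B0 where B0: "\<And>z. z \<in> cball (complex_of_real x0) (r / 2) \<Longrightarrow> norm (h z) \<le> B0"
    using compact_imp_bounded bounded_iff by (metis imageI)
  define B where "B = max B0 0"
  have B: "B \<ge> 0" "\<And>x. \<bar>x - x0\<bar> \<le> r / 2 \<Longrightarrow> - Im (h (of_real x)) \<le> B"
  proof -
    show "B \<ge> 0" by (simp add: B_def)
    fix x assume "\<bar>x - x0\<bar> \<le> r / 2"
    then have "norm (h (of_real x)) \<le> B0" by (intro B0) (simp add: dist_real_def abs_minus_commute)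
    then show "- Im (h (of_real x)) \<le> B"
      using abs_Im_le_cmod[of "h (of_real x)"] unfolding B_def by linarith
  qed
  have lip: "pi * (sym_cdf v - sym_cdf u) \<le> B * (v - u)"
    if uv: "u < v" "\<bar>u - x0\<bar> \<le> r / 2" "\<bar>v - x0\<bar> \<le> r / 2" for u v
  proof -
    have "ennreal (pi * (sym_cdf v - sym_cdf u)) = I u v" using I[OF uv] by simp
    also have "\<dots> \<le> (\<integral>\<^sup>+x. ennreal B * indicator {u..v} x \<partial>lborel)"
      unfolding I_def
    proof (intro nn_integral_mono)
      fix x
      have "\<bar>x - x0\<bar> \<le> r / 2" if "x \<in> {u..v}"
        using that uv unfolding abs_le_iff atLeastAtMost_iff by linarith
      then show "ennreal (- Im (h (of_real x))) * indicator {u..v} x \<le> ennreal B * indicator {u..v} x"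
        using B(2)[of x] by (auto simp: indicator_def intro: ennreal_leI)
    qed
    also have "\<dots> = ennreal (B * (v - u))"
      using uv B(1) by (simp add: nn_integral_cmult_indicator ennreal_mult)
    finally show ?thesis using uv B(1) by (subst (asm) ennreal_le_iff) auto
  qed
  have cont: "sym_cdf x = cdf M x" if x: "\<bar>x - x0\<bar> < r / 2" for x
  proof -
    have "(sym_cdf \<longlongrightarrow> sym_cdf x) (at_right x)"
    proof (rule tendsto_sandwich)
      show "\<forall>\<^sub>F v in at_right x. sym_cdf x \<le> sym_cdf v"
        using eventually_at_right_less[of x] by eventually_elim (rule sym_cdf_mono, simp)
      have "x < x0 + r / 2" using x unfolding abs_less_iff by linarith
      then have "\<forall>\<^sub>F v in at_right x. v \<in> {x<..<x0 + r / 2}" by (rule eventually_at_right_real)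
      then show "\<forall>\<^sub>F v in at_right x. sym_cdf v \<le> sym_cdf x + B * (v - x) / pi"
      proof eventually_elim
        case (elim v)
        have "\<bar>v - x0\<bar> \<le> r / 2" 
          using elim x unfolding abs_less_iff abs_le_iff greaterThanLessThan_iff by linarith
        then have "pi * (sym_cdf v - sym_cdf x) \<le> B * (v - x)"
          using x elim by (intro lip) auto
        then show ?case by (simp add: field_simps)
      qed
      have "((\<lambda>v. sym_cdf x + B * (v - x) / pi) \<longlongrightarrow> sym_cdf x + B * (x - x) / pi) (at_right x)"
        by (intro tendsto_intros) auto
      then show "((\<lambda>v. sym_cdf x + B * (v - x) / pi) \<longlongrightarrow> sym_cdf x) (at_right x)" by simp
    qed auto
    then show ?thesis using sym_cdf_at_right tendsto_unique[OF trivial_limit_at_right_real] by blast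
  qed
  have "(\<integral>\<^sup>+x. ennreal (- Im (h (of_real x)) / pi) * indicator {a..b} x \<partial>lborel)
     = (\<integral>\<^sup>+x. ennreal (- Im (h (of_real x))) * indicator {a..b} x / ennreal pi \<partial>lborel)"
  proof (rule nn_integral_cong)
    fix x
    have "- Im (h (of_real x)) \<ge> 0" if "x \<in> {a..b}"
    proof -
      have "\<bar>x - x0\<bar> < r" using that ab r(1) unfolding abs_less_iff atLeastAtMost_iff by linarith
      then show ?thesis using hneg[of x] by simp
    qed
    then show "ennreal (- Im (h (of_real x)) / pi) * indicator {a..b} x
        = ennreal (- Im (h (of_real x))) * indicator {a..b} x / ennreal pi"
      by (cases "x \<in> {a..b}") (simp_all add: divide_ennreal)
  qed
  also have "\<dots> = I a b / ennreal pi"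
  proof -
    have "continuous_on {a..b} (\<lambda>x. - Im (h (of_real x)))"
    proof (intro continuous_intros continuous_on_compose2[OF hc])
      show "complex_of_real ` {a..b} \<subseteq> ball (of_real x0) r"
      proof
        fix z assume "z \<in> complex_of_real ` {a..b}"
        then obtain x where x: "z = of_real x" "x \<in> {a..b}" by blast
        then have "\<bar>x - x0\<bar> < r" using ab r(1) unfolding abs_less_iff atLeastAtMost_iff by linarith
        then show "z \<in> ball (of_real x0) r" using x by (simp add: dist_real_def abs_minus_commute)
      qed
    qed
    then have m: "(\<lambda>x. indicator {a..b} x *\<^sub>R (- Im (h (of_real x)))) \<in> borel_measurable borel"
      by (intro borel_measurable_continuous_on_indicator) auto
    have "(\<lambda>x. ennreal (- Im (h (of_real x))) * indicator {a..b} x)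
        = (\<lambda>x. ennreal (indicator {a..b} x *\<^sub>R (- Im (h (of_real x)))))"
      by (auto simp: indicator_def)
    then have "(\<lambda>x. ennreal (- Im (h (of_real x))) * indicator {a..b} x) \<in> borel_measurable lborel"
      using m by simp
    then show ?thesis unfolding I_def by (rule nn_integral_divide)
  qed
  also have "\<dots> = ennreal (pi * (cdf M b - cdf M a)) / ennreal pi"
    using I[OF ab'] cont ab by simp
  also have "\<dots> = ennreal (cdf M b - cdf M a)"
    using cdf_nondecreasing[OF ab(1)] by (simp add: divide_ennreal)
  also have "\<dots> = emeasure M {a<..b}" by (rule emeasure_Ioc[OF ab(1), symmetric])
  finally show ?thesis by simp
qed

text \<open>On a small interval the measure and the density agree on half-open subintervals, and two finite
  measures with the same distribution function are equal.\<close>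

lemma emeasure_near_analytic_boundary:
  assumes "x0 \<in> analytic_boundary M"
  obtains \<delta> where "\<delta> > 0" "\<And>A. A \<in> sets borel \<Longrightarrow> A \<subseteq> ball x0 \<delta> \<Longrightarrow>
    emeasure M A = (\<integral>\<^sup>+x. ennreal (boundary_density M x) * indicator A x \<partial>lborel)"
proof -
  obtain r h where rh: "analytic_boundary_at M x0 r h" using assms by (auto simp: analytic_boundary_def)
  then have r: "r > 0" by (auto simp: analytic_boundary_at_def)
  define a where "a = x0 - r / 4"
  define b where "b = x0 + r / 4"
  define J where "J = {a<..b}"
  have ab: "a < b" using r by (simp add: a_def b_def)
  have ball_J: "ball x0 (r / 4) \<subseteq> J"
  proof
    fix x assume "x \<in> ball x0 (r / 4)"
    then have "\<bar>x0 - x\<bar> < r / 4" by (simp add: dist_real_def)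
    then show "x \<in> J" unfolding J_def a_def b_def abs_less_iff greaterThanAtMost_iff by linarith
  qed
  have near: "\<bar>x - x0\<bar> < r / 2" if "x \<in> {a..b}" for x
    using that r unfolding a_def b_def abs_less_iff atLeastAtMost_iff by linarith
  have bd: "boundary_density M x = - Im (h (of_real x)) / pi" if "x \<in> {a..b}" for x
    using boundary_density_eq[OF rh] near[OF that] r by simp
  have J_sub: "J \<subseteq> analytic_boundary M"
  proof
    fix x assume "x \<in> J"
    then have "\<bar>x - x0\<bar> < r" using near[of x] r by (simp add: J_def)
    from analytic_boundary_at_shift[OF rh this] show "x \<in> analytic_boundary M"
      unfolding analytic_boundary_def by blast
  qed
  have Ioc: "emeasure M {a<..c} = (\<integral>\<^sup>+x. ennreal (boundary_density M x) * indicator {a<..c} x \<partial>lborel)"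
    if "c \<in> {a..b}" for c
  proof -
    have "emeasure M {a<..c} = (\<integral>\<^sup>+x. ennreal (- Im (h (of_real x)) / pi) * indicator {a..c} x \<partial>lborel)"
      by (rule emeasure_Ioc_at_analytic_boundary[OF rh]) (use that ab near[of a] near[of c] in auto)
    also have "\<dots> = (\<integral>\<^sup>+x. ennreal (boundary_density M x) * indicator {a<..c} x \<partial>lborel)"
    proof (rule nn_integral_cong_AE)
      show "AE x in lborel. ennreal (- Im (h (of_real x)) / pi) * indicator {a..c} x
          = ennreal (boundary_density M x) * indicator {a<..c} x"
        using AE_lborel_singleton[of a]
        by eventually_elim (use bd that in \<open>auto simp: indicator_def\<close>)
    qed
    finally show ?thesis .
  qed
  define g where "g x = indicator J x *\<^sub>R boundary_density M x" for x
  have gm[measurable]: "g \<in> borel_measurable borel"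
    unfolding g_def[abs_def] J_def
    by (rule borel_measurable_continuous_on_indicator)
       (use continuous_on_subset[OF continuous_on_boundary_density J_sub] in \<open>auto simp: J_def\<close>)
  have Jm[measurable]: "J \<in> sets borel" by (simp add: J_def)
  define M1 where "M1 = density M (indicator J)"
  define M2 where "M2 = density lborel (\<lambda>x. ennreal (g x))"
  have e1: "emeasure M1 A = emeasure M (A \<inter> J)" if "A \<in> sets borel" for A
  proof -
    have "emeasure M1 A = (\<integral>\<^sup>+x. indicator J x * indicator A x \<partial>M)"
      unfolding M1_def using that by (subst emeasure_density) auto
    also have "\<dots> = (\<integral>\<^sup>+x. indicator (A \<inter> J) x \<partial>M)"
      by (intro nn_integral_cong) (auto simp: indicator_def)
    also have "\<dots> = emeasure M (A \<inter> J)" using that by simp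
    finally show ?thesis .
  qed
  have e2: "emeasure M2 A = (\<integral>\<^sup>+x. ennreal (boundary_density M x) * indicator (A \<inter> J) x \<partial>lborel)"
    if "A \<in> sets borel" for A
  proof -
    have "emeasure M2 A = (\<integral>\<^sup>+x. ennreal (g x) * indicator A x \<partial>lborel)"
      unfolding M2_def using that by (subst emeasure_density) auto
    also have "\<dots> = (\<integral>\<^sup>+x. ennreal (boundary_density M x) * indicator (A \<inter> J) x \<partial>lborel)"
      by (intro nn_integral_cong) (auto simp: g_def indicator_def)
    finally show ?thesis .
  qed
  have eqIic: "emeasure M1 {..c} = emeasure M2 {..c}" for c
  proof (cases "c \<le> a")
    case True
    then have "{..c} \<inter> J = {}" by (auto simp: J_def)
    then show ?thesis by (simp add: e1 e2)
  next
    case False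
    then have "{..c} \<inter> J = {a<..min c b}" by (auto simp: J_def)
    then show ?thesis using Ioc[of "min c b"] False ab by (simp add: e1 e2)
  qed
  have eqU: "emeasure M1 UNIV = emeasure M2 UNIV"
    using Ioc[of b] ab by (simp add: e1 e2 J_def)
  have f1: "emeasure M1 UNIV < \<infinity>" by (simp add: e1 less_top[symmetric])
  have fb: "finite_borel_measure M1" "finite_borel_measure M2"
    using f1 eqU
    by (auto simp: finite_borel_measure_def finite_borel_measure_axioms_def M1_def M2_def intro!: finite_measureI)
  have "M1 = M2"
    by (rule cdf_unique'[OF fb]) (simp add: cdf_def measure_def eqIic fun_eq_iff)
  show ?thesis
  proof (rule that[of "r / 4"])
    fix A :: "real set" assume A: "A \<in> sets borel" "A \<subseteq> ball x0 (r / 4)"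
    then have "A \<inter> J = A" using ball_J by blast
    then show "emeasure M A = (\<integral>\<^sup>+x. ennreal (boundary_density M x) * indicator A x \<partial>lborel)"
      using e1[OF A(1)] e2[OF A(1)] \<open>M1 = M2\<close> by simp
  qed (use r in simp)
qed

lemma borel_measurable_boundary_density:
  "(\<lambda>x. ennreal (boundary_density M x) * indicator (analytic_boundary M) x) \<in> borel_measurable borel"
proof -
  have "(\<lambda>x. indicator (analytic_boundary M) x *\<^sub>R boundary_density M x) \<in> borel_measurable borel"
    by (intro borel_measurable_continuous_on_indicator continuous_on_boundary_density)
       (simp add: open_analytic_boundary)
  then have "(\<lambda>x. ennreal (indicator (analytic_boundary M) x *\<^sub>R boundary_density M x)) \<in> borel_measurable borel"
    by simp
  moreover have "(\<lambda>x. ennreal (indicator (analytic_boundary M) x *\<^sub>R boundary_density M x))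
    = (\<lambda>x. ennreal (boundary_density M x) * indicator (analytic_boundary M) x)"
    by (auto simp: indicator_def)
  ultimately show ?thesis by simp
qed

text \<open>Globalisation by countably many of the small intervals (by the Lindelof property), made disjoint.\<close>

lemma emeasure_analytic_boundary:
  assumes A: "A \<in> sets borel" "A \<subseteq> analytic_boundary M"
  shows "emeasure M A = (\<integral>\<^sup>+x. ennreal (boundary_density M x) * indicator A x \<partial>lborel)"
proof -
  have "\<exists>\<delta>>0. \<forall>A\<in>sets borel. A \<subseteq> ball x \<delta> \<longrightarrow>
      emeasure M A = (\<integral>\<^sup>+x. ennreal (boundary_density M x) * indicator A x \<partial>lborel)"
    if "x \<in> analytic_boundary M" for x
    using emeasure_near_analytic_boundary[OF that] by metis
  then obtain \<delta> where \<delta>: "\<And>x. x \<in> analytic_boundary M \<Longrightarrow> \<delta> x > 0"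
    "\<And>x A. x \<in> analytic_boundary M \<Longrightarrow> A \<in> sets borel \<Longrightarrow> A \<subseteq> ball x (\<delta> x) \<Longrightarrow>
      emeasure M A = (\<integral>\<^sup>+x. ennreal (boundary_density M x) * indicator A x \<partial>lborel)"
    by metis
  obtain \<F> where F: "\<F> \<subseteq> (\<lambda>x. ball x (\<delta> x)) ` analytic_boundary M" "countable \<F>"
    "\<Union>\<F> = \<Union>((\<lambda>x. ball x (\<delta> x)) ` analytic_boundary M)"
    using Lindelof[of "(\<lambda>x. ball x (\<delta> x)) ` analytic_boundary M"] by auto
  have cover: "analytic_boundary M \<subseteq> \<Union>\<F>" unfolding F(3) using \<delta>(1) by force
  show ?thesis
  proof (cases "\<F> = {}")
    case True
    then have "A = {}" using A cover by auto
    then show ?thesis by simp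
  next
    case False
    define B where "B n = from_nat_into \<F> n" for n
    have rangeB: "range B = \<F>" unfolding B_def using F(2) False by (simp add: range_from_nat_into)
    have "B n \<in> \<F>" for n using rangeB by blast
    then have "\<exists>x\<in>analytic_boundary M. B n = ball x (\<delta> x)" for n using F(1) by blast
    then obtain c where c: "\<And>n. c n \<in> analytic_boundary M" "\<And>n. B n = ball (c n) (\<delta> (c n))" by metis
    define D where "D n = A \<inter> disjointed B n" for n
    have Bm: "range B \<subseteq> sets borel" using c(2) by auto
    have Dm: "D n \<in> sets borel" for n
      unfolding D_def using A(1) sets.range_disjointed_sets[OF Bm] by auto
    have Dsub: "D n \<subseteq> ball (c n) (\<delta> (c n))" for n
      unfolding D_def c(2)[symmetric] using disjointed_subset[of B n] by auto
    have disj: "disjoint_family D"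
      using disjoint_family_disjointed[of B] by (auto simp: D_def disjoint_family_on_def)
    have UD: "(\<Union>n. D n) = A"
      using A(2) cover rangeB by (auto simp: D_def UN_disjointed_eq simp flip: Int_UN_distrib)
    define \<nu> where "\<nu> = density lborel (\<lambda>x. ennreal (boundary_density M x) * indicator (analytic_boundary M) x)"
    have \<nu>: "emeasure \<nu> X = (\<integral>\<^sup>+x. ennreal (boundary_density M x) * indicator X x \<partial>lborel)"
      if "X \<in> sets borel" "X \<subseteq> analytic_boundary M" for X
    proof -
      have "emeasure \<nu> X = (\<integral>\<^sup>+x. ennreal (boundary_density M x) * indicator (analytic_boundary M) x * indicator X x \<partial>lborel)"
        unfolding \<nu>_def using that borel_measurable_boundary_density by (subst emeasure_density) auto
      also have "\<dots> = (\<integral>\<^sup>+x. ennreal (boundary_density M x) * indicator X x \<partial>lborel)"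
        using that(2) by (intro nn_integral_cong) (auto simp: indicator_def)
      finally show ?thesis .
    qed
    have "emeasure M A = (\<Sum>n. emeasure M (D n))"
      unfolding UD[symmetric] using Dm disj by (intro suminf_emeasure[symmetric]) auto
    also have "\<dots> = (\<Sum>n. emeasure \<nu> (D n))"
    proof (rule suminf_cong)
      fix n
      have "D n \<subseteq> analytic_boundary M" using UD A(2) by blast
      then show "emeasure M (D n) = emeasure \<nu> (D n)"
        using \<delta>(2)[OF c(1) Dm Dsub] \<nu>[OF Dm] by simp
    qed
    also have "\<dots> = emeasure \<nu> A"
      unfolding UD[symmetric] using Dm disj by (intro suminf_emeasure) (auto simp: \<nu>_def)
    finally show ?thesis using \<nu>[OF A] by simp
  qed
qed

end

section \<open>The free additive convolution\<close>

lemma subordination_equations: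
  assumes "subordination_pair \<mu> \<nu> \<omega>1 \<omega>2" and z: "Im z > 0"
  shows "Im (\<omega>1 z) \<ge> Im z" "Im (\<omega>2 z) \<ge> Im z"
    and "\<omega>1 z = z + h_transform \<nu> (\<omega>2 z)" "\<omega>2 z = z + h_transform \<mu> (\<omega>1 z)"
proof -
  note p = assms(1)[unfolded subordination_pair_def upper_half_plane_def]
  show "Im (\<omega>1 z) \<ge> Im z" "Im (\<omega>2 z) \<ge> Im z" using p z by auto
  have F: "F_transform \<mu> (\<omega>1 z) = F_transform \<nu> (\<omega>2 z)" "\<omega>1 z + \<omega>2 z = z + F_transform \<mu> (\<omega>1 z)"
    using p z by auto
  have "z + h_transform \<mu> (\<omega>1 z) = (z + F_transform \<mu> (\<omega>1 z)) - \<omega>1 z" by (simp add: h_transform_def)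
  then show "\<omega>2 z = z + h_transform \<mu> (\<omega>1 z)" unfolding F(2)[symmetric] by simp
  have "z + h_transform \<nu> (\<omega>2 z) = (z + F_transform \<mu> (\<omega>1 z)) - \<omega>2 z" by (simp add: h_transform_def F(1))
  then show "\<omega>1 z = z + h_transform \<nu> (\<omega>2 z)" unfolding F(2)[symmetric] by simp
qed

lemma free_conv_exists:
  assumes \<mu>: "real_distribution \<mu>" "\<And>a. \<mu> \<noteq> return borel a"
    and \<nu>: "real_distribution \<nu>" "\<And>a. \<nu> \<noteq> return borel a"
  shows "\<exists>\<rho>. real_distribution \<rho> \<and>
       (\<exists>\<omega>1 \<omega>2. subordination_pair \<mu> \<nu> \<omega>1 \<omega>2 \<and>
          (\<forall>z\<in>upper_half_plane.
             F_transform \<rho> z = F_transform \<mu> (\<omega>1 z) \<and>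
             F_transform \<rho> z = F_transform \<nu> (\<omega>2 z)))"
proof -
  interpret \<mu>: real_distribution \<mu> by fact
  interpret \<nu>: real_distribution \<nu> by fact
  let ?A = "h_transform \<mu>" and ?B = "h_transform \<nu>"
  obtain u where u: "u holomorphic_on {z. Im z > 0}" 
    "\<And>z. Im z > 0 \<Longrightarrow> Im (u z) > 0"
    "\<And>z. Im z > 0 \<Longrightarrow> u z = z + ?B (z + ?A (u z))"
    "((\<lambda>y::real. u (\<i> * of_real y) / (\<i> * of_real y)) \<longlongrightarrow> 1) at_top"
    "((\<lambda>y::real. ?A (u (\<i> * of_real y)) / (\<i> * of_real y)) \<longlongrightarrow> 0) at_top"
  proof (rule subordination_exists[of ?A ?B])
    show "\<exists>K>0. \<forall>w. \<bar>Re w\<bar> \<le> Im w \<longrightarrow> K \<le> Im w \<longrightarrow> norm (?A w) \<le> \<epsilon> * norm w" if "\<epsilon> > 0" for \<epsilon>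
      using \<mu>.h_transform_small_in_cone[OF that] by metis
    show "\<exists>K>0. \<forall>w. \<bar>Re w\<bar> \<le> Im w \<longrightarrow> K \<le> Im w \<longrightarrow> norm (?B w) \<le> \<epsilon> * norm w" if "\<epsilon> > 0" for \<epsilon>
      using \<nu>.h_transform_small_in_cone[OF that] by metis
  qed (use \<mu>.holomorphic_h_transform \<nu>.holomorphic_h_transform \<mu>.Im_h_transform_pos \<nu>.Im_h_transform_pos
        \<mu>(2) \<nu>(2) in auto)
  define v where "v z = z + ?A (u z)" for z
  have A_pos: "Im (?A (u z)) > 0" if "Im z > 0" for z
    using \<mu>.Im_h_transform_pos[OF u(2)[OF that] \<mu>(2)] .
  have v_ge: "Im (v z) \<ge> Im z" "Im (v z) > 0" if "Im z > 0" for z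
    using A_pos[OF that] that by (auto simp: v_def)
  have u_ge: "Im (u z) \<ge> Im z" if "Im z > 0" for z
  proof -
    have "Im (u z) = Im z + Im (?B (v z))"
      using u(3)[OF that] by (metis v_def plus_complex.sel(2))
    then show ?thesis using \<nu>.Im_h_transform_pos[OF v_ge(2)[OF that] \<nu>(2)] by simp
  qed
  have Fu: "F_transform \<mu> (u z) = u z + v z - z" if "Im z > 0" for z
    by (simp add: v_def h_transform_def)
  have Fv: "F_transform \<nu> (v z) = u z + v z - z" if "Im z > 0" for z
    using u(3)[OF that] by (simp add: v_def h_transform_def algebra_simps)
  have v_hol: "v holomorphic_on {z. Im z > 0}"
    unfolding v_def[abs_def]
    by (intro holomorphic_intros holomorphic_on_comp[OF \<mu>.holomorphic_h_transform u(1)]) (use u(2) in auto)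
  have v_lim: "((\<lambda>y::real. v (\<i> * of_real y) / (\<i> * of_real y)) \<longlongrightarrow> 1) at_top"
  proof -
    have "((\<lambda>y::real. 1 + ?A (u (\<i> * of_real y)) / (\<i> * of_real y)) \<longlongrightarrow> 1 + 0) at_top"
      by (intro tendsto_intros u(5))
    moreover have "\<forall>\<^sub>F y::real in at_top. 1 + ?A (u (\<i> * of_real y)) / (\<i> * of_real y) = v (\<i> * of_real y) / (\<i> * of_real y)"
      using eventually_gt_at_top[of "0::real"] by eventually_elim (simp add: v_def add_divide_distrib)
    ultimately show ?thesis using Lim_transform_eventually by fastforce
  qed
  have pair: "subordination_pair \<mu> \<nu> u v"
    unfolding subordination_pair_def upper_half_plane_def
    using u(1,2,4) v_hol v_ge u_ge v_lim Fu Fv by auto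
  obtain \<rho> where \<rho>: "real_distribution \<rho>" "\<And>z. Im z > 0 \<Longrightarrow> cauchy_transform \<rho> z = cauchy_transform \<mu> (u z)"
  proof (rule cauchy_transform_exists[of "\<lambda>z. cauchy_transform \<mu> (u z)"])
    show "(\<lambda>z. cauchy_transform \<mu> (u z)) holomorphic_on {w. 0 < Im w}"
      by (rule holomorphic_on_comp[OF \<mu>.holomorphic_cauchy_transform u(1)]) (use u(2) in auto)
    show "norm (cauchy_transform \<mu> (u w)) \<le> 1 / Im w" if "Im w > 0" for w
    proof -
      have "norm (cauchy_transform \<mu> (u w)) \<le> 1 / Im (u w)"
        by (rule \<mu>.norm_cauchy_transform_le[OF u(2)[OF that]])
      also have "\<dots> \<le> 1 / Im w" using u_ge[OF that] u(2)[OF that] that by (intro divide_left_mono) auto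
      finally show ?thesis .
    qed
    show "Im (cauchy_transform \<mu> (u w)) \<le> 0" if "Im w > 0" for w
      using \<mu>.Im_cauchy_transform_neg[OF u(2)[OF that]] by simp
    have "((\<lambda>y::real. inverse (u (\<i> * of_real y) / (\<i> * of_real y) + ?A (u (\<i> * of_real y)) / (\<i> * of_real y)))
       \<longlongrightarrow> inverse (1 + 0)) at_top"
      by (intro tendsto_intros u(4,5)) auto
    moreover have "\<forall>\<^sub>F y::real in at_top. inverse (u (\<i> * of_real y) / (\<i> * of_real y) + ?A (u (\<i> * of_real y)) / (\<i> * of_real y))
        = \<i> * of_real y * cauchy_transform \<mu> (u (\<i> * of_real y))"
      using eventually_gt_at_top[of "0::real"]
    proof eventually_elim
      case (elim y)
      define z where "z = \<i> * of_real y"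
      have z: "Im z > 0" "z \<noteq> 0" using elim by (auto simp: z_def)
      have "inverse (u z / z + ?A (u z) / z) = z * inverse (F_transform \<mu> (u z))"
      proof -
        have "u z / z + ?A (u z) / z = F_transform \<mu> (u z) / z"
          by (simp add: h_transform_def add_divide_distrib[symmetric])
        then show ?thesis by (simp add: divide_inverse)
      qed
      also have "\<dots> = z * cauchy_transform \<mu> (u z)" by (simp add: F_transform_def)
      finally show ?case by (simp add: z_def)
    qed
    ultimately show "((\<lambda>y::real. \<i> * of_real y * cauchy_transform \<mu> (u (\<i> * of_real y))) \<longlongrightarrow> 1) at_top"
      using Lim_transform_eventually by fastforce
  qed (blast intro: that)
  have "\<forall>z\<in>upper_half_plane. F_transform \<rho> z = F_transform \<mu> (u z) \<and> F_transform \<rho> z = F_transform \<nu> (v z)"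
    using \<rho>(2) Fu Fv by (auto simp: upper_half_plane_def F_transform_def)
  then show ?thesis using \<rho>(1) pair by blast
qed

lemma free_conv_unique:
  assumes \<mu>: "real_distribution \<mu>" "\<And>a. \<mu> \<noteq> return borel a"
    and \<nu>: "real_distribution \<nu>" "\<And>a. \<nu> \<noteq> return borel a"
    and \<rho>: "real_distribution \<rho>" "subordination_pair \<mu> \<nu> \<omega>1 \<omega>2"
      "\<And>z. Im z > 0 \<Longrightarrow> F_transform \<rho> z = F_transform \<mu> (\<omega>1 z)"
    and \<rho>': "real_distribution \<rho>'" "subordination_pair \<mu> \<nu> \<omega>1' \<omega>2'"
      "\<And>z. Im z > 0 \<Longrightarrow> F_transform \<rho>' z = F_transform \<mu> (\<omega>1' z)"
  shows "\<rho> = \<rho>'"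
proof (rule cauchy_transform_inject[OF \<rho>(1) \<rho>'(1)])
  interpret \<mu>: real_distribution \<mu> by fact
  interpret \<nu>: real_distribution \<nu> by fact
  fix z :: complex assume z: "Im z > 0"
  have "\<omega>1 z = \<omega>1' z"
  proof (rule subordination_unique[of "h_transform \<mu>" "h_transform \<nu>" z])
    show "Im (\<omega>1 z) > 0" "Im (\<omega>1' z) > 0"
      using subordination_equations(1)[OF \<rho>(2) z] subordination_equations(1)[OF \<rho>'(2) z] z by auto
  qed (use \<mu>.holomorphic_h_transform \<nu>.holomorphic_h_transform \<mu>.Im_h_transform_pos \<nu>.Im_h_transform_pos
        \<mu>(2) \<nu>(2) z subordination_equations(3,4)[OF \<rho>(2) z] subordination_equations(3,4)[OF \<rho>'(2) z] in auto)
  then show "cauchy_transform \<rho> z = cauchy_transform \<rho>' z"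
    using \<rho>(3)[OF z] \<rho>'(3)[OF z] by (simp add: F_transform_def)
qed

text \<open>The consequences of the definition of the free convolution \<open>\<rho>\<close> on which everything below depends.\<close>

locale subordination =
  \<mu>: real_distribution \<mu> + \<nu>: real_distribution \<nu> + \<rho>: real_distribution \<rho>
  for \<mu> \<nu> \<rho> :: "real measure" +
  fixes \<omega>1 \<omega>2 :: "complex \<Rightarrow> complex"
  assumes \<mu>_not_return: "\<And>a. \<mu> \<noteq> return borel a" and \<nu>_not_return: "\<And>a. \<nu> \<noteq> return borel a"
    and holomorphic_\<omega>: "\<omega>1 holomorphic_on {z. Im z > 0}" "\<omega>2 holomorphic_on {z. Im z > 0}"
    and Im_\<omega>: "\<And>z. Im z > 0 \<Longrightarrow> Im (\<omega>1 z) > 0" "\<And>z. Im z > 0 \<Longrightarrow> Im (\<omega>2 z) > 0"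
    and \<omega>_eq: "\<And>z. Im z > 0 \<Longrightarrow> \<omega>1 z = z + h_transform \<nu> (\<omega>2 z)"
      "\<And>z. Im z > 0 \<Longrightarrow> \<omega>2 z = z + h_transform \<mu> (\<omega>1 z)"
    and cauchy_eq: "\<And>z. Im z > 0 \<Longrightarrow> cauchy_transform \<rho> z = cauchy_transform \<mu> (\<omega>1 z)"
      "\<And>z. Im z > 0 \<Longrightarrow> cauchy_transform \<rho> z = cauchy_transform \<nu> (\<omega>2 z)"

lemma subordination_free_conv:
  assumes \<mu>: "real_distribution \<mu>" "\<And>a. \<mu> \<noteq> return borel a"
    and \<nu>: "real_distribution \<nu>" "\<And>a. \<nu> \<noteq> return borel a"
  obtains \<omega>1 \<omega>2 where "subordination \<mu> \<nu> (free_conv \<mu> \<nu>) \<omega>1 \<omega>2"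
proof -
  let ?P = "\<lambda>\<rho>. real_distribution \<rho> \<and>
       (\<exists>\<omega>1 \<omega>2. subordination_pair \<mu> \<nu> \<omega>1 \<omega>2 \<and>
          (\<forall>z\<in>upper_half_plane.
             F_transform \<rho> z = F_transform \<mu> (\<omega>1 z) \<and>
             F_transform \<rho> z = F_transform \<nu> (\<omega>2 z)))"
  have "\<exists>!\<rho>. ?P \<rho>"
  proof (rule ex_ex1I)
    show "\<exists>\<rho>. ?P \<rho>" by (rule free_conv_exists[OF assms])
    fix \<rho> \<rho>' assume "?P \<rho>" "?P \<rho>'"
    then show "\<rho> = \<rho>'"
      unfolding upper_half_plane_def using free_conv_unique[OF assms] by (metis (no_types, lifting) mem_Collect_eq)
  qed
  then have "?P (free_conv \<mu> \<nu>)" unfolding free_conv_def by (rule theI')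
  then obtain \<omega>1 \<omega>2 where \<rho>: "real_distribution (free_conv \<mu> \<nu>)" and pair: "subordination_pair \<mu> \<nu> \<omega>1 \<omega>2"
    and F: "\<And>z. Im z > 0 \<Longrightarrow> F_transform (free_conv \<mu> \<nu>) z = F_transform \<mu> (\<omega>1 z)"
      "\<And>z. Im z > 0 \<Longrightarrow> F_transform (free_conv \<mu> \<nu>) z = F_transform \<nu> (\<omega>2 z)"
    unfolding upper_half_plane_def by blast
  have "subordination \<mu> \<nu> (free_conv \<mu> \<nu>) \<omega>1 \<omega>2"
  proof (intro subordination.intro subordination_axioms.intro assms \<rho>)
    show "\<omega>1 holomorphic_on {z. Im z > 0}" "\<omega>2 holomorphic_on {z. Im z > 0}"
      using pair by (auto simp: subordination_pair_def upper_half_plane_def)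
    fix z assume z: "Im z > 0"
    note eqs = subordination_equations[OF pair z]
    show "Im (\<omega>1 z) > 0" "Im (\<omega>2 z) > 0" using eqs(1,2) z by linarith+
    show "\<omega>1 z = z + h_transform \<nu> (\<omega>2 z)" "\<omega>2 z = z + h_transform \<mu> (\<omega>1 z)" by (fact eqs)+
    show "cauchy_transform (free_conv \<mu> \<nu>) z = cauchy_transform \<mu> (\<omega>1 z)"
      "cauchy_transform (free_conv \<mu> \<nu>) z = cauchy_transform \<nu> (\<omega>2 z)"
      using F[OF z] by (simp_all add: F_transform_def)
  qed
  then show ?thesis by (rule that)
qed

section \<open>Points where the F-transform tends to zero\<close>

text \<open>The quotient \<open>Im w / Im F(w)\<close>, in a form that shows the Cauchy--Schwarz inequality: it is at most \<open>1\<close>,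
  and it measures how far the kernel \<open>1 / (w - t)\<close> is from being constant in \<open>t\<close>.\<close>

definition energy_ratio :: "real measure \<Rightarrow> complex \<Rightarrow> real"
  where "energy_ratio \<sigma> w = (norm (cauchy_transform \<sigma> w))\<^sup>2 / cauchy_energy \<sigma> w"

context real_distribution
begin

lemma energy_ratio_times_Im_F:
  assumes "Im w > 0" shows "energy_ratio M w * Im (F_transform M w) = Im w"
  using cauchy_energy_pos[OF assms] cauchy_transform_nonzero[OF assms]
  by (simp add: energy_ratio_def Im_F_transform[OF assms])

text \<open>Split the kernel at the set \<open>A\<close>. Away from \<open>A\<close> it is bounded by \<open>1 / \<delta>\<close>; on \<open>A\<close> the Cauchy--Schwarz
  inequality yields \<open>sqrt (\<sigma>(A) J)\<close>, where \<open>J\<close> is the energy. It is used in the form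
  \<open>x \<le> s / 2 + x\<^sup>2 / (2 s)\<close> with the optimal \<open>s = sqrt (J / p)\<close>.\<close>

lemma norm_cauchy_transform_le_split:
  assumes w: "Im w > 0" and A: "A \<in> sets borel" and \<delta>: "\<delta> > 0" "\<And>t. t \<notin> A \<Longrightarrow> norm (w - of_real t) \<ge> \<delta>"
    and p: "p > 0" "prob A \<le> p"
  shows "norm (cauchy_transform M w) \<le> 1 / \<delta> + sqrt (p * cauchy_energy M w)"
proof -
  define J where "J = cauchy_energy M w"
  have J: "J > 0" unfolding J_def by (rule cauchy_energy_pos[OF w])
  define s where "s = sqrt (J / p)"
  have s: "s > 0" using J p by (simp add: s_def)
  have [measurable]: "A \<in> sets M" by (rule sets_M[OF A])
  have iA: "integrable M (indicator A :: real \<Rightarrow> real)"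
    using A by (auto intro!: integrable_real_indicator simp: less_top[symmetric])
  have "norm (cauchy_transform M w) \<le> (LINT t|M. 1 / \<delta> + (s / 2 * indicator A t + 1 / (2 * s) * (1 / (norm (w - of_real t))\<^sup>2)))"
    unfolding cauchy_transform_def
  proof (rule Bochner_Integration.integral_norm_bound_integral[OF integrable_cauchy_kernel[OF w]])
    show "integrable M (\<lambda>t. 1 / \<delta> + (s / 2 * indicator A t + 1 / (2 * s) * (1 / (norm (w - of_real t))\<^sup>2)))"
      by (intro Bochner_Integration.integrable_add integrable_mult_right iA integrable_cauchy_kernel_sq w) auto
    fix t
    define x where "x = 1 / norm (w - of_real t)"
    have x: "x \<ge> 0" by (simp add: x_def)
    have am: "x \<le> s / 2 + 1 / (2 * s) * x\<^sup>2"
    proof -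
      have "0 \<le> (x - s)\<^sup>2 / (2 * s)" using s by simp
      also have "\<dots> = s / 2 + 1 / (2 * s) * x\<^sup>2 - x"
        using s by (simp add: power2_eq_square field_simps)
      finally show ?thesis by simp
    qed
    have "x \<le> 1 / \<delta> + (s / 2 * indicator A t + 1 / (2 * s) * x\<^sup>2)"
    proof (cases "t \<in> A")
      case True then show ?thesis using am \<delta>(1) by (simp add: add_increasing)
    next
      case False
      have "x \<le> 1 / \<delta>" unfolding x_def using \<delta>(1) \<delta>(2)[OF False] by (intro divide_left_mono mult_pos_pos) auto
      moreover have "0 \<le> 1 / (2 * s) * x\<^sup>2" using s by simp
      ultimately show ?thesis using False by simp
    qed
    then show "norm (1 / (w - of_real t)) \<le> 1 / \<delta> + (s / 2 * indicator A t + 1 / (2 * s) * (1 / (norm (w - of_real t))\<^sup>2))"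
      by (simp add: x_def norm_divide power_divide)
  qed
  also have "\<dots> = 1 / \<delta> + (s / 2 * prob A + 1 / (2 * s) * J)"
  proof -
    have i2: "integrable M (\<lambda>t. s / 2 * indicator A t)" by (rule integrable_mult_right[OF iA])
    have i3: "integrable M (\<lambda>t. 1 / (2 * s) * (1 / (norm (w - of_real t))\<^sup>2))"
      by (rule integrable_mult_right[OF integrable_cauchy_kernel_sq[OF w]])
    have i1: "integrable M (\<lambda>t. 1 / \<delta>)" by simp
    have "(LINT t|M. s / 2 * indicator A t) = s / 2 * prob A"
      using A by (subst integral_mult_right_zero) simp
    moreover have "(LINT t|M. 1 / (2 * s) * (1 / (norm (w - of_real t))\<^sup>2)) = 1 / (2 * s) * J"
      unfolding J_def cauchy_energy_def by (rule integral_mult_right_zero)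
    ultimately show ?thesis
      unfolding Bochner_Integration.integral_add[OF i1 Bochner_Integration.integrable_add[OF i2 i3]]
        Bochner_Integration.integral_add[OF i2 i3] by simp
  qed
  also have "\<dots> \<le> 1 / \<delta> + sqrt (p * J)"
  proof -
    define a where "a = sqrt J"
    define b where "b = sqrt p"
    have ab: "a > 0" "b > 0" "J = a * a" "p = b * b" using J p by (auto simp: a_def b_def)
    have s_eq: "s = a / b" and r_eq: "sqrt (p * J) = a * b"
      by (simp_all add: s_def a_def b_def real_sqrt_divide real_sqrt_mult)
    have "s * p = a * b" "1 / (2 * s) * J = a * b / 2"
      unfolding s_eq ab(3,4) using ab(1,2) by (simp_all add: field_simps)
    then have "s * p = sqrt (p * J)" "1 / (2 * s) * J = sqrt (p * J) / 2"
      by (simp_all only: r_eq)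
    moreover have "s / 2 * prob A \<le> s / 2 * p" using s p by (intro mult_left_mono) auto
    ultimately show ?thesis by simp
  qed
  finally show ?thesis by (simp add: J_def)
qed

text \<open>Divide the preceding estimate by \<open>sqrt J\<close>, which tends to infinity because \<open>J \<ge> |G|\<^sup>2\<close>: only the mass of
  \<open>A\<close> survives in the limit.\<close>

lemma energy_ratio_eventually_less:
  assumes w: "\<And>n. Im (w n) > 0" and F0: "(\<lambda>n. F_transform M (w n)) \<longlonglongrightarrow> 0"
    and A: "A \<in> sets borel" and \<delta>: "\<delta> > 0" "\<forall>\<^sub>F n in sequentially. \<forall>t. t \<notin> A \<longrightarrow> norm (w n - of_real t) \<ge> \<delta>"
    and p: "prob A < p"
  shows "\<forall>\<^sub>F n in sequentially. energy_ratio M (w n) < p"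
proof -
  define p0 where "p0 = (prob A + p) / 2"
  have p0: "p0 > 0" "prob A \<le> p0" "p0 < p"
  proof -
    have "0 \<le> prob A" by simp
    then have "0 < p" using p by linarith
    then show "p0 > 0" using \<open>0 \<le> prob A\<close> by (simp add: p0_def add_nonneg_pos)
    show "prob A \<le> p0" "p0 < p" using p by (simp_all add: p0_def)
  qed
  have "(\<lambda>n. (norm (F_transform M (w n)) / \<delta> + sqrt p0)\<^sup>2) \<longlonglongrightarrow> (norm (0::complex) / \<delta> + sqrt p0)\<^sup>2"
    by (intro tendsto_intros F0) (use \<delta> in auto)
  then have "(\<lambda>n. (norm (F_transform M (w n)) / \<delta> + sqrt p0)\<^sup>2) \<longlonglongrightarrow> p0"
    using p0 by simp
  then have "\<forall>\<^sub>F n in sequentially. (norm (F_transform M (w n)) / \<delta> + sqrt p0)\<^sup>2 < p"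
    by (rule order_tendstoD) (use p0 in simp)
  then show ?thesis using \<delta>(2)
  proof eventually_elim
    case (elim n)
    define G where "G = norm (cauchy_transform M (w n))"
    define J where "J = cauchy_energy M (w n)"
    have G: "G > 0" unfolding G_def using cauchy_transform_nonzero[OF w] by simp
    have J: "J > 0" unfolding J_def by (rule cauchy_energy_pos[OF w])
    have GJ: "G \<le> sqrt J" unfolding G_def J_def by (rule real_le_rsqrt[OF norm_cauchy_transform_sq_le[OF w]])
    have "G \<le> 1 / \<delta> + sqrt (p0 * J)"
      unfolding G_def J_def using norm_cauchy_transform_le_split[OF w A \<delta>(1) _ p0(1,2)] elim(2) by blast
    then have "G / sqrt J \<le> (1 / \<delta> + sqrt (p0 * J)) / sqrt J"
      using J by (intro divide_right_mono) auto
    also have "\<dots> = 1 / \<delta> / sqrt J + sqrt p0"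
      using J by (simp add: add_divide_distrib real_sqrt_mult)
    also have "1 / \<delta> / sqrt J \<le> 1 / \<delta> / G"
      using GJ G \<delta>(1) J by (intro divide_left_mono mult_pos_pos) auto
    finally have "G / sqrt J \<le> norm (F_transform M (w n)) / \<delta> + sqrt p0"
      by (simp add: F_transform_def norm_divide G_def field_simps)
    then have "(G / sqrt J)\<^sup>2 \<le> (norm (F_transform M (w n)) / \<delta> + sqrt p0)\<^sup>2"
      using G J by (intro power_mono) auto
    then have "energy_ratio M (w n) \<le> (norm (F_transform M (w n)) / \<delta> + sqrt p0)\<^sup>2"
      using J by (simp add: energy_ratio_def G_def J_def power_divide)
    then show ?case using elim(1) by linarith
  qed
qed

lemma energy_ratio_near_point:
  assumes w: "\<And>n. Im (w n) > 0" and F0: "(\<lambda>n. F_transform M (w n)) \<longlonglongrightarrow> 0"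
    and lim: "w \<longlonglongrightarrow> of_real b" and p: "prob {b} < p"
  shows "\<forall>\<^sub>F n in sequentially. energy_ratio M (w n) < p"
proof -
  have "(\<lambda>n. prob {b - 1 / real (Suc n)<..<b + 1 / real (Suc n)}) \<longlonglongrightarrow> prob (\<Inter>n. {b - 1 / real (Suc n)<..<b + 1 / real (Suc n)})"
  proof (rule finite_Lim_measure_decseq)
    show "decseq (\<lambda>n. {b - 1 / real (Suc n)<..<b + 1 / real (Suc n)})"
      unfolding decseq_def
    proof (intro allI impI subsetI)
      fix m n :: nat and t assume "m \<le> n" and t: "t \<in> {b - 1 / real (Suc n)<..<b + 1 / real (Suc n)}"
      then have "1 / real (Suc n) \<le> 1 / real (Suc m)" by (intro frac_le) auto
      then show "t \<in> {b - 1 / real (Suc m)<..<b + 1 / real (Suc m)}"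
        using t unfolding greaterThanLessThan_iff by linarith
    qed
  qed auto
  also have "(\<Inter>n. {b - 1 / real (Suc n)<..<b + 1 / real (Suc n)}) = {b}"
  proof -
    have "t = b" if t: "\<And>n. t \<in> {b - 1 / real (Suc n)<..<b + 1 / real (Suc n)}" for t
    proof (rule ccontr)
      assume "t \<noteq> b"
      then obtain n where "inverse (real (Suc n)) < \<bar>t - b\<bar>" using reals_Archimedean[of "\<bar>t - b\<bar>"] by auto
      then show False using t[of n] by (auto simp: inverse_eq_divide abs_if split: if_splits)
    qed
    then show ?thesis by force
  qed
  finally have "\<forall>\<^sub>F n in sequentially. prob {b - 1 / real (Suc n)<..<b + 1 / real (Suc n)} < p"
    using p by (rule order_tendstoD)
  then obtain n where n: "prob {b - 1 / real (Suc n)<..<b + 1 / real (Suc n)} < p"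
    using eventually_happens by fastforce
  define \<delta> where "\<delta> = 1 / real (Suc n)"
  have \<delta>: "\<delta> > 0" by (simp add: \<delta>_def)
  show ?thesis
  proof (rule energy_ratio_eventually_less[OF w F0 _ _ _ n])
    show "\<delta> / 2 > 0" using \<delta> by simp
    have "\<forall>\<^sub>F n in sequentially. dist (w n) (of_real b) < \<delta> / 2"
      by (rule tendstoD[OF lim]) (use \<delta> in simp)
    then show "\<forall>\<^sub>F m in sequentially. \<forall>t. t \<notin> {b - 1 / real (Suc n)<..<b + 1 / real (Suc n)} \<longrightarrow> \<delta> / 2 \<le> norm (w m - of_real t)"
    proof eventually_elim
      case (elim m)
      show ?case
      proof (intro allI impI)
        fix t assume "t \<notin> {b - 1 / real (Suc n)<..<b + 1 / real (Suc n)}"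
        then have "\<bar>b - t\<bar> \<ge> \<delta>" unfolding \<delta>_def[symmetric] by auto
        then have "\<delta> \<le> dist (of_real b) (complex_of_real t)" by (simp add: dist_real_def)
        also have "\<dots> \<le> dist (of_real b) (w m) + dist (w m) (of_real t)" by (rule dist_triangle)
        finally show "\<delta> / 2 \<le> norm (w m - of_real t)" using elim by (simp add: dist_norm norm_minus_commute)
      qed
    qed
  qed auto
qed

lemma energy_ratio_at_infinity:
  assumes w: "\<And>n. Im (w n) > 0" and F0: "(\<lambda>n. F_transform M (w n)) \<longlonglongrightarrow> 0"
    and lim: "filterlim w at_infinity sequentially" and p: "p > 0"
  shows "\<forall>\<^sub>F n in sequentially. energy_ratio M (w n) < p"
proof -
  obtain R where R: "R > 0" "prob {t. \<bar>t\<bar> > R} < p" using tail_measure_small[OF p] .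
  show ?thesis
  proof (rule energy_ratio_eventually_less[OF w F0 _ _ _ R(2)])
    show "{t::real. R < \<bar>t\<bar>} \<in> sets borel" by measurable
    have "\<forall>\<^sub>F n in sequentially. norm (w n) \<ge> R + 1"
      using lim R by (auto simp: filterlim_at_infinity[of 0])
    then show "\<forall>\<^sub>F n in sequentially. \<forall>t. t \<notin> {t. R < \<bar>t\<bar>} \<longrightarrow> 1 \<le> norm (w n - of_real t)"
    proof eventually_elim
      case (elim n)
      show ?case
      proof (intro allI impI)
        fix t assume "t \<notin> {t. R < \<bar>t\<bar>}"
        then have "norm (complex_of_real t) \<le> R" by simp
        then show "1 \<le> norm (w n - of_real t)" using norm_triangle_ineq2[of "w n" "of_real t"] elim by linarith
      qed
    qed
  qed auto
qed

end


lemma convergent_subseq_or_at_infinity: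
  fixes w :: "nat \<Rightarrow> complex"
  shows "(\<exists>r l. strict_mono (r :: nat \<Rightarrow> nat) \<and> (\<lambda>n. w (r n)) \<longlonglongrightarrow> l) \<or> filterlim w at_infinity sequentially"
proof (rule disjCI)
  assume "\<not> filterlim w at_infinity sequentially"
  then obtain B where "\<not> (\<forall>\<^sub>F n in sequentially. norm (w n) \<ge> B)"
    by (auto simp: filterlim_at_infinity[of 0])
  then have "\<exists>n\<ge>N. norm (w n) < B" for N by (auto simp: eventually_sequentially not_le)
  then have "infinite {n. norm (w n) < B}" unfolding infinite_nat_iff_unbounded_le by auto
  then obtain r :: "nat \<Rightarrow> nat" where r: "strict_mono r" "\<And>n. norm (w (r n)) < B"
    using infinite_enumerate by (metis mem_Collect_eq)
  have "compact (cball (0::complex) B)" by simp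
  moreover have "\<And>n. w (r n) \<in> cball 0 B" using r(2) by (simp add: less_imp_le)
  ultimately obtain l s where "strict_mono (s :: nat \<Rightarrow> nat)" "((\<lambda>n. w (r n)) \<circ> s) \<longlonglongrightarrow> l"
    unfolding compact_def by metis
  then show "\<exists>r l. strict_mono (r :: nat \<Rightarrow> nat) \<and> (\<lambda>n. w (r n)) \<longlonglongrightarrow> l"
    using strict_mono_o[OF r(1)] by (intro exI[of _ "r \<circ> s"] exI[of _ l]) (auto simp: o_def)
qed

context subordination
begin

lemma swap: "subordination \<nu> \<mu> \<rho> \<omega>2 \<omega>1"
  by (intro subordination.intro subordination_axioms.intro \<mu>.real_distribution_axioms
      \<nu>.real_distribution_axioms \<rho>.real_distribution_axioms \<mu>_not_return \<nu>_not_return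
      holomorphic_\<omega> Im_\<omega> \<omega>_eq cauchy_eq)

lemma F_eq:
  assumes "Im z > 0"
  shows "F_transform \<rho> z = F_transform \<mu> (\<omega>1 z)" "F_transform \<rho> z = F_transform \<nu> (\<omega>2 z)"
    and "\<omega>1 z + \<omega>2 z = z + F_transform \<rho> z"
proof -
  show 1: "F_transform \<rho> z = F_transform \<mu> (\<omega>1 z)" "F_transform \<rho> z = F_transform \<nu> (\<omega>2 z)"
    using cauchy_eq[OF assms] by (simp_all add: F_transform_def)
  show "\<omega>1 z + \<omega>2 z = z + F_transform \<rho> z"
    unfolding 1(1) using \<omega>_eq(2)[OF assms] by (simp add: h_transform_def)
qed

text \<open>The imaginary part of \<open>\<omega>1 + \<omega>2 = z + F(z)\<close>, divided by \<open>Im F(z)\<close>.\<close>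

lemma energy_ratio_sum:
  assumes z: "Im z > 0"
  shows "energy_ratio \<mu> (\<omega>1 z) + energy_ratio \<nu> (\<omega>2 z) = 1 + Im z / Im (F_transform \<rho> z)"
proof -
  have F: "Im (F_transform \<rho> z) > 0" using \<rho>.Im_F_transform_ge[OF z] z by linarith
  have "energy_ratio \<mu> (\<omega>1 z) * Im (F_transform \<rho> z) = Im (\<omega>1 z)"
    "energy_ratio \<nu> (\<omega>2 z) * Im (F_transform \<rho> z) = Im (\<omega>2 z)"
    using \<mu>.energy_ratio_times_Im_F[OF Im_\<omega>(1)[OF z]] \<nu>.energy_ratio_times_Im_F[OF Im_\<omega>(2)[OF z]] F_eq[OF z]
    by simp_all
  then have "(energy_ratio \<mu> (\<omega>1 z) + energy_ratio \<nu> (\<omega>2 z)) * Im (F_transform \<rho> z) = Im (\<omega>1 z + \<omega>2 z)"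
    by (simp add: distrib_right)
  also have "\<dots> = Im z + Im (F_transform \<rho> z)" unfolding F_eq(3)[OF z] by simp
  finally show ?thesis using F by (simp add: field_simps)
qed

text \<open>By the identity for the energy ratios their sum stays above \<open>1\<close>. If \<open>\<omega>1(z\<^sub>n)\<close> tended to infinity then so would
  \<open>\<omega>2(z\<^sub>n)\<close>, and both ratios would vanish in the limit. Hence \<open>\<omega>1\<close> converges along a subsequence, to a real
  point \<open>b\<close> because \<open>Im \<omega>1 \<le> Im (\<omega>1 + \<omega>2) \<rightarrow> 0\<close>; then \<open>\<omega>2 \<rightarrow> x - b\<close>, and the ratios are bounded by the masses
  at these two points. The sequence \<open>l\<close> serves both uses: it is \<open>0\<close> when only the existence of a heavy pair
  matters, and the quotient itself at an atom.\<close>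

lemma heavy_pair_of_F_tendsto_0:
  assumes z: "\<And>n. Im (z n) > 0" and x: "z \<longlonglongrightarrow> of_real x"
    and F0: "(\<lambda>n. F_transform \<rho> (z n)) \<longlonglongrightarrow> 0"
    and l: "\<And>n. l n \<le> Im (z n) / Im (F_transform \<rho> (z n))" "l \<longlonglongrightarrow> L"
  obtains b c where "x = b + c" "measure \<mu> {b} + measure \<nu> {c} \<ge> 1 + L"
proof -
  have sum0: "(\<lambda>n. \<omega>1 (z n) + \<omega>2 (z n)) \<longlonglongrightarrow> of_real x"
    using tendsto_add[OF x F0] F_eq(3)[OF z] by simp
  have ratio_ge: "energy_ratio \<mu> (\<omega>1 (z n)) + energy_ratio \<nu> (\<omega>2 (z n)) \<ge> 1 + l n" for n
    using energy_ratio_sum[OF z[of n]] l(1)[of n] by linarith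
  from convergent_subseq_or_at_infinity[of "\<lambda>n. \<omega>1 (z n)"]
  show ?thesis
  proof
    assume "filterlim (\<lambda>n. \<omega>1 (z n)) at_infinity sequentially"
    note inf1 = this
    have inf2: "filterlim (\<lambda>n. \<omega>2 (z n)) at_infinity sequentially"
    proof -
      have "filterlim (\<lambda>n. - \<omega>1 (z n)) at_infinity sequentially"
        using inf1 by (simp add: filterlim_at_infinity[of 0])
      from tendsto_add_filterlim_at_infinity[OF sum0 this] show ?thesis by simp
    qed
    have "\<forall>\<^sub>F n in sequentially. energy_ratio \<mu> (\<omega>1 (z n)) < 1 / 3"
      by (rule \<mu>.energy_ratio_at_infinity[OF _ _ inf1]) (use Im_\<omega> z F0 F_eq in auto)
    moreover have "\<forall>\<^sub>F n in sequentially. energy_ratio \<nu> (\<omega>2 (z n)) < 1 / 3"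
      by (rule \<nu>.energy_ratio_at_infinity[OF _ _ inf2]) (use Im_\<omega> z F0 F_eq in auto)
    ultimately have "\<forall>\<^sub>F n in sequentially. False"
    proof eventually_elim
      case (elim n)
      have "Im (z n) / Im (F_transform \<rho> (z n)) \<ge> 0"
        using \<rho>.Im_F_transform_ge[OF z[of n]] z[of n] by simp
      then show ?case using energy_ratio_sum[OF z[of n]] elim by linarith
    qed
    then show ?thesis by simp
  next
    assume "\<exists>r l. strict_mono r \<and> (\<lambda>n. \<omega>1 (z (r n))) \<longlonglongrightarrow> l"
    then obtain r w1 where r: "strict_mono (r :: nat \<Rightarrow> nat)" and w1: "(\<lambda>n. \<omega>1 (z (r n))) \<longlonglongrightarrow> w1" by blast
    have sub: "(\<lambda>n. f (r n)) \<longlonglongrightarrow> a" if "f \<longlonglongrightarrow> a" for f :: "nat \<Rightarrow> 'x::topological_space" and a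
      using LIMSEQ_subseq_LIMSEQ[OF that r] by (simp add: o_def)
    have "(\<lambda>n. Im (\<omega>1 (z (r n)))) \<longlonglongrightarrow> 0"
    proof (rule tendsto_sandwich[of "\<lambda>_. 0" _ _ "\<lambda>n. Im (\<omega>1 (z (r n)) + \<omega>2 (z (r n)))"])
      show "(\<lambda>n. Im (\<omega>1 (z (r n)) + \<omega>2 (z (r n)))) \<longlonglongrightarrow> 0"
        using tendsto_Im[OF sub[OF sum0]] by simp
    qed (use Im_\<omega> z in \<open>auto intro!: always_eventually less_imp_le add_pos_pos\<close>)
    then have "Im w1 = 0" using tendsto_Im[OF w1] LIMSEQ_unique by blast
    define b where "b = Re w1"
    have b: "w1 = of_real b" using \<open>Im w1 = 0\<close> by (simp add: b_def complex_eq_iff)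
    define c where "c = x - b"
    have w2: "(\<lambda>n. \<omega>2 (z (r n))) \<longlonglongrightarrow> of_real c"
      using tendsto_diff[OF sub[OF sum0] w1] by (simp add: b c_def)
    have "measure \<mu> {b} + measure \<nu> {c} \<ge> 1 + L"
    proof (rule field_le_epsilon)
      fix e :: real assume e: "e > 0"
      have "\<forall>\<^sub>F n in sequentially. energy_ratio \<mu> (\<omega>1 (z (r n))) < measure \<mu> {b} + e / 2"
        by (rule \<mu>.energy_ratio_near_point[OF _ _ w1[unfolded b]]) (use Im_\<omega> z sub[OF F0] F_eq e in auto)
      moreover have "\<forall>\<^sub>F n in sequentially. energy_ratio \<nu> (\<omega>2 (z (r n))) < measure \<nu> {c} + e / 2"
        by (rule \<nu>.energy_ratio_near_point[OF _ _ w2]) (use Im_\<omega> z sub[OF F0] F_eq e in auto)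
      ultimately have "\<forall>\<^sub>F n in sequentially. 1 + l (r n) \<le> measure \<mu> {b} + measure \<nu> {c} + e"
      proof eventually_elim
        case (elim n)
        then show ?case using ratio_ge[of "r n"] by linarith
      qed
      moreover have "(\<lambda>n. 1 + l (r n)) \<longlonglongrightarrow> 1 + L" by (intro tendsto_intros sub[OF l(2)])
      ultimately show "1 + L \<le> measure \<mu> {b} + measure \<nu> {c} + e"
        using tendsto_upperbound by (metis sequentially_bot)
    qed
    moreover have "x = b + c" by (simp add: c_def)
    ultimately show ?thesis using that by blast
  qed
qed

end

section \<open>Atoms\<close>

context real_distribution
begin

lemma prob_singleton_less_1:
  assumes "\<And>a. M \<noteq> return borel a" shows "prob {b} < 1"
proof -
  have "prob {b} \<noteq> 1"
  proof
    assume "prob {b} = 1"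
    then have "AE t in M. t = b" using prob_eq_1[of "{b}"] by auto
    from eq_return_of_AE[OF this] assms show False by blast
  qed
  then show ?thesis using prob_le_1[of "{b}"] by linarith
qed

lemma prob_two_points:
  assumes "b \<noteq> b'" shows "prob {b} + prob {b'} \<le> 1"
proof -
  have "prob {b} + prob {b'} = prob ({b} \<union> {b'})"
    using assms by (intro finite_measure_Union[symmetric]) auto
  then show ?thesis by simp
qed

lemma atom_limit:
  fixes a :: real
  defines "z \<equiv> \<lambda>n. Complex a (1 / real (Suc n))"
  shows "(\<lambda>n. \<i> * of_real (1 / real (Suc n)) * cauchy_transform M (z n)) \<longlonglongrightarrow> of_real (prob {a})"
proof -
  define y where "y n = 1 / real (Suc n)" for n
  have y: "y n > 0" for n by (simp add: y_def)
  have z: "z n = of_real a + \<i> * of_real (y n)" "Im (z n) > 0" for n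
    by (simp_all add: z_def y_def complex_eq_iff)
  have "(\<lambda>n. LINT t|M. \<i> * of_real (y n) * (1 / (z n - of_real t))) \<longlonglongrightarrow> (LINT t|M. indicator {a} t)"
  proof (rule integral_dominated_convergence[where w = "\<lambda>_. 1"])
    show "AE t in M. (\<lambda>n. \<i> * of_real (y n) * (1 / (z n - of_real t))) \<longlonglongrightarrow> (indicator {a} t :: complex)"
    proof (rule AE_I2)
      fix t
      show "(\<lambda>n. \<i> * of_real (y n) * (1 / (z n - of_real t))) \<longlonglongrightarrow> (indicator {a} t :: complex)"
      proof (cases "t = a")
        case True
        have "y n \<noteq> 0" for n using y[of n] by simp
        then show ?thesis using True by (simp add: z(1))
      next
        case False
        have y0: "y \<longlonglongrightarrow> 0" unfolding y_def by real_asymp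
        have "(\<lambda>n. \<i> * of_real (y n) * (1 / (of_real a + \<i> * of_real (y n) - of_real t)))
          \<longlonglongrightarrow> \<i> * of_real 0 * (1 / (of_real a + \<i> * of_real 0 - of_real t))"
          by (intro tendsto_intros y0) (use False in auto)
        then show ?thesis using False by (simp add: z(1))
      qed
    qed
    show "AE t in M. norm (\<i> * of_real (y n) * (1 / (z n - of_real t))) \<le> 1" for n
    proof (rule AE_I2)
      fix t
      have "norm (\<i> * of_real (y n) * (1 / (z n - of_real t))) = y n * norm (1 / (z n - of_real t))"
        using y[of n] by (simp add: norm_mult norm_divide)
      also have "\<dots> \<le> y n * (1 / Im (z n))"
        using norm_cauchy_kernel_le[OF z(2), of n t] y[of n] by (intro mult_left_mono) auto
      also have "\<dots> = 1" using y[of n] by (simp add: z_def y_def)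
      finally show "norm (\<i> * of_real (y n) * (1 / (z n - of_real t))) \<le> 1" .
    qed
  qed auto
  also have "(LINT t|M. indicator {a} t) = complex_of_real (prob {a})"
  proof -
    have "(LINT t|M. complex_of_real (indicator {a} t)) = complex_of_real (LINT t|M. indicator {a} t)"
      by (rule integral_complex_of_real)
    moreover have "(\<lambda>t. indicator {a} t :: complex) = (\<lambda>t. complex_of_real (indicator {a} t))"
      by (auto simp: indicator_def)
    ultimately show ?thesis by simp
  qed
  also have "(\<lambda>n. LINT t|M. \<i> * of_real (y n) * (1 / (z n - of_real t)))
     = (\<lambda>n. \<i> * of_real (y n) * cauchy_transform M (z n))"
    unfolding cauchy_transform_def by (simp only: integral_mult_right_zero)
  finally show ?thesis unfolding y_def .
qed

text \<open>The kernel takes the value \<open>1 / (w - b)\<close> with probability \<open>\<alpha>\<close>, which bounds its variance from below. This is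
  the Cauchy--Schwarz inequality for the kernel and the centred indicator \<open>indicator {b} - \<alpha>\<close>, in the form that the
  residual after projection onto that indicator has a nonnegative square.\<close>

lemma cauchy_variance_ge_atom:
  fixes b :: real and w :: complex
  assumes w: "Im w > 0" and b: "prob {b} < 1"
  defines "G \<equiv> cauchy_transform M w" and "\<alpha> \<equiv> prob {b}"
  shows "\<alpha> * (norm (1 / (w - of_real b) - G))\<^sup>2 \<le> (1 - \<alpha>) * (cauchy_energy M w - (norm G)\<^sup>2)"
proof -
  define v where "v = w - of_real b"
  define d where "d = 1 / v - G"
  \<comment> \<open>The coefficient of the orthogonal projection onto the centred indicator, whose variance is \<open>\<alpha> (1 - \<alpha>)\<close>.\<close>
  define s where "s = d / of_real (1 - \<alpha>)"
  have a1: "1 - \<alpha> > 0" using b by (simp add: \<alpha>_def)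
  define k where "k t = 1 / (w - of_real t)" for t :: real
  define e where "e t = complex_of_real (indicator {b} t)" for t
  have ik: "integrable M k" unfolding k_def[abs_def] by (rule integrable_cauchy_kernel[OF w])
  have ir: "integrable M (indicator {b} :: real \<Rightarrow> real)"
    by (auto intro!: integrable_real_indicator simp: less_top[symmetric])
  have ie: "integrable M e" unfolding e_def[abs_def] using ir by (rule integrable_of_real)
  have Ek: "(LINT t|M. k t) = G" by (simp add: k_def G_def cauchy_transform_def)
  have Ee: "(LINT t|M. e t) = of_real \<alpha>"
    unfolding e_def \<alpha>_def by (subst integral_complex_of_real) simp
  have cross: "(k t - G) * (e t - of_real \<alpha>) = d * e t + (of_real \<alpha> * G - of_real \<alpha> * k t)" for t
  proof (cases "t = b")
    case True
    have "k b = d + G" "e b = 1" by (simp_all add: k_def d_def v_def e_def)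
    then show ?thesis using True by (simp add: algebra_simps)
  qed (simp add: e_def algebra_simps)
  have i1: "integrable M (\<lambda>t. d * e t)" "integrable M (\<lambda>t. of_real \<alpha> * G - of_real \<alpha> * k t)"
    "integrable M (\<lambda>t. of_real \<alpha> * k t)"
    using ik ie by auto
  have icross: "integrable M (\<lambda>t. (k t - G) * (e t - of_real \<alpha>))"
    unfolding cross using i1 by auto
  have "(LINT t|M. (k t - G) * (e t - of_real \<alpha>)) = (LINT t|M. d * e t) + (LINT t|M. of_real \<alpha> * G - of_real \<alpha> * k t)"
    unfolding cross by (rule Bochner_Integration.integral_add[OF i1(1,2)])
  also have "(LINT t|M. of_real \<alpha> * G - of_real \<alpha> * k t) = of_real \<alpha> * G - (LINT t|M. of_real \<alpha> * k t)"
    using i1(3) by (subst Bochner_Integration.integral_diff) auto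
  also have "(LINT t|M. of_real \<alpha> * k t) = of_real \<alpha> * G" unfolding integral_mult_right_zero Ek ..
  also have "(LINT t|M. d * e t) = d * of_real \<alpha>" unfolding integral_mult_right_zero Ee ..
  finally have Ecross: "(LINT t|M. (k t - G) * (e t - of_real \<alpha>)) = d * of_real \<alpha>" by simp
  have sq: "(norm (e t - of_real \<alpha>))\<^sup>2 = (1 - 2 * \<alpha>) * indicator {b} t + \<alpha>\<^sup>2" for t
  proof (cases "t = b")
    case True
    have "norm (1 - complex_of_real \<alpha>) = 1 - \<alpha>"
      using a1 by (metis abs_of_pos norm_of_real of_real_1 of_real_diff)
    then have "norm (e t - of_real \<alpha>) = 1 - \<alpha>" using True by (simp add: e_def)
    then show ?thesis using True by (simp only:) (simp add: power2_eq_square algebra_simps)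
  qed (simp add: e_def)
  have isq: "integrable M (\<lambda>t. (norm (e t - of_real \<alpha>))\<^sup>2)" unfolding sq using ir by auto
  have Esq: "(LINT t|M. (norm (e t - of_real \<alpha>))\<^sup>2) = \<alpha> * (1 - \<alpha>)"
  proof -
    have "(LINT t|M. (norm (e t - of_real \<alpha>))\<^sup>2) = (1 - 2 * \<alpha>) * \<alpha> + \<alpha>\<^sup>2"
      unfolding sq using ir by (subst Bochner_Integration.integral_add) (auto simp: \<alpha>_def)
    then show ?thesis by (simp add: power2_eq_square algebra_simps)
  qed
  have expand: "(norm (k t - G - s * (e t - of_real \<alpha>)))\<^sup>2
     = (norm (k t - G))\<^sup>2 - 2 * Re (cnj s * ((k t - G) * cnj (e t - of_real \<alpha>))) + (norm s)\<^sup>2 * (norm (e t - of_real \<alpha>))\<^sup>2" for t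
  proof -
    have "(norm (p - s * q))\<^sup>2 = (norm p)\<^sup>2 - 2 * Re (cnj s * (p * cnj q)) + (norm s)\<^sup>2 * (norm q)\<^sup>2" for p q
      unfolding cmod_power2 by (simp add: power2_eq_square algebra_simps)
    then show ?thesis .
  qed
  have cnj_e: "cnj (e t - of_real \<alpha>) = e t - of_real \<alpha>" for t by (simp add: e_def)
  note V = cauchy_variance[OF w, folded G_def, folded k_def]
  define c where "c t = 2 * Re (cnj s * ((k t - G) * (e t - of_real \<alpha>)))" for t
  have ic: "integrable M c"
    unfolding c_def[abs_def] by (rule integrable_mult_right, rule integrable_Re, rule integrable_mult_right, rule icross)
  have Ec: "(LINT t|M. c t) = 2 * Re (cnj s * (d * of_real \<alpha>))"
  proof -
    have "(LINT t|M. c t) = 2 * (LINT t|M. Re (cnj s * ((k t - G) * (e t - of_real \<alpha>))))"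
      unfolding c_def by (rule integral_mult_right_zero)
    also have "(LINT t|M. Re (cnj s * ((k t - G) * (e t - of_real \<alpha>)))) = Re (LINT t|M. cnj s * ((k t - G) * (e t - of_real \<alpha>)))"
      by (rule integral_Re, rule integrable_mult_right, rule icross)
    also have "(LINT t|M. cnj s * ((k t - G) * (e t - of_real \<alpha>))) = cnj s * (d * of_real \<alpha>)"
      unfolding integral_mult_right_zero Ecross ..
    finally show ?thesis .
  qed
  have i3: "integrable M (\<lambda>t. (norm s)\<^sup>2 * (norm (e t - of_real \<alpha>))\<^sup>2)" by (rule integrable_mult_right[OF isq])
  have "0 \<le> (LINT t|M. (norm (k t - G - s * (e t - of_real \<alpha>)))\<^sup>2)"
    by (rule integral_nonneg_AE) auto
  also have "\<dots> = (LINT t|M. (norm (k t - G))\<^sup>2 - c t + (norm s)\<^sup>2 * (norm (e t - of_real \<alpha>))\<^sup>2)"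
    unfolding expand cnj_e c_def ..
  also have "\<dots> = (cauchy_energy M w - (norm G)\<^sup>2) - 2 * Re (cnj s * (d * of_real \<alpha>)) + (norm s)\<^sup>2 * (\<alpha> * (1 - \<alpha>))"
    unfolding Bochner_Integration.integral_add[OF Bochner_Integration.integrable_diff[OF V(2) ic] i3]
      Bochner_Integration.integral_diff[OF V(2) ic] integral_mult_right_zero V(1) Ec Esq ..
  also have "Re (cnj s * (d * of_real \<alpha>)) = \<alpha> * (norm d)\<^sup>2 / (1 - \<alpha>)"
  proof -
    have "cnj s * (d * of_real \<alpha>) = of_real (\<alpha> / (1 - \<alpha>)) * (d * cnj d)"
      by (simp add: s_def mult_ac)
    also have "d * cnj d = of_real ((norm d)\<^sup>2)" by (rule complex_norm_square[symmetric])
    finally have "cnj s * (d * of_real \<alpha>) = of_real (\<alpha> / (1 - \<alpha>) * (norm d)\<^sup>2)"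
      by (simp only: of_real_mult)
    then show ?thesis by (simp only: Re_complex_of_real) simp
  qed
  also have "(norm s)\<^sup>2 * (\<alpha> * (1 - \<alpha>)) = \<alpha> * (norm d)\<^sup>2 / (1 - \<alpha>)"
  proof -
    have "norm s = norm d / (1 - \<alpha>)"
      unfolding s_def norm_divide norm_of_real using a1 by simp
    then show ?thesis using a1 by (simp add: power_divide power2_eq_square)
  qed
  finally have "\<alpha> * (norm d)\<^sup>2 / (1 - \<alpha>) \<le> cauchy_energy M w - (norm G)\<^sup>2" by simp
  then have "\<alpha> * (norm d)\<^sup>2 \<le> (1 - \<alpha>) * (cauchy_energy M w - (norm G)\<^sup>2)"
    using a1 by (simp add: pos_divide_le_eq mult.commute)
  then show ?thesis by (simp add: d_def v_def)
qed

end

text \<open>The sublevel sets are the horodiscs at \<open>0\<close>; the function is the reciprocal of \<open>Im (- 1 / u)\<close>.\<close>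

definition horodisc_size :: "complex \<Rightarrow> real"
  where "horodisc_size u = (norm u)\<^sup>2 / Im u"

lemma horodisc_size_add:
  assumes "Im u > 0" "Im v > 0"
  shows "horodisc_size (u + v) \<le> horodisc_size u + horodisc_size v"
proof -
  define a b x y where "a = Im u" and "b = Im v" and "x = norm u" and "y = norm v"
  have pos: "a > 0" "b > 0" using assms by (auto simp: a_def b_def)
  have "horodisc_size (u + v) \<le> (x + y)\<^sup>2 / (a + b)"
    unfolding horodisc_size_def using pos norm_triangle_ineq[of u v]
    by (auto simp: a_def b_def x_def y_def intro!: divide_right_mono power_mono)
  also have "\<dots> \<le> x\<^sup>2 / a + y\<^sup>2 / b"
  proof -
    have "x\<^sup>2 / a + y\<^sup>2 / b - (x + y)\<^sup>2 / (a + b) = (b * x - a * y)\<^sup>2 / (a * b * (a + b))"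
      using pos by (simp add: divide_simps power2_eq_square) (simp add: algebra_simps)
    also have "\<dots> \<ge> 0" using pos by simp
    finally show ?thesis by simp
  qed
  finally show ?thesis by (simp add: horodisc_size_def a_def b_def x_def y_def)
qed

text \<open>Julia's inequality: an atom of mass \<open>\<alpha>\<close> at \<open>b\<close> gives \<open>h + b\<close> the angular derivative \<open>1 / \<alpha> - 1\<close> at \<open>b\<close>, and
  horodiscs are mapped into horodiscs scaled by this factor.\<close>

lemma (in real_distribution) horodisc_size_h_transform:
  assumes np: "\<And>a. M \<noteq> return borel a" and w: "Im w > 0"
  shows "prob {b} * horodisc_size (h_transform M w + of_real b) \<le> (1 - prob {b}) * horodisc_size (w - of_real b)"
proof -
  define G v \<alpha> V where "G = cauchy_transform M w" and "v = w - of_real b" and "\<alpha> = prob {b}"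
    and "V = cauchy_energy M w - (norm G)\<^sup>2"
  have G: "G \<noteq> 0" unfolding G_def by (rule cauchy_transform_nonzero[OF w])
  have v: "v \<noteq> 0" unfolding v_def by (rule diff_real_nonzero[OF w])
  have V: "V > 0" unfolding V_def G_def using norm_cauchy_transform_sq_less[OF w np] by simp
  have main: "\<alpha> * (norm (1 / v - G))\<^sup>2 \<le> (1 - \<alpha>) * V"
    unfolding \<alpha>_def G_def v_def V_def using cauchy_variance_ge_atom[OF w prob_singleton_less_1[OF np]] .
  have K: "h_transform M w + of_real b = v * (1 / v - G) / G"
    using G v by (simp add: h_transform_def F_transform_def G_def[symmetric] v_def field_simps)
  have ImK: "Im (h_transform M w + of_real b) = Im w * V / (norm G)\<^sup>2"
  proof -
    have "Im (h_transform M w + of_real b) = Im (F_transform M w) - Im w" by (simp add: h_transform_def)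
    also have "\<dots> = Im w * V / (norm G)\<^sup>2"
      unfolding Im_F_transform[OF w] V_def using G by (simp add: G_def[symmetric] field_simps)
    finally show ?thesis .
  qed
  have "horodisc_size (h_transform M w + of_real b) = (norm v)\<^sup>2 * (norm (1 / v - G))\<^sup>2 / (Im w * V)"
    unfolding horodisc_size_def ImK unfolding K using G w V
    by (simp add: norm_mult norm_divide power_mult_distrib power_divide)
  then have "\<alpha> * horodisc_size (h_transform M w + of_real b) = (norm v)\<^sup>2 / (Im w * V) * (\<alpha> * (norm (1 / v - G))\<^sup>2)"
    by simp
  also have "\<dots> \<le> (norm v)\<^sup>2 / (Im w * V) * ((1 - \<alpha>) * V)"
    using main w V by (intro mult_left_mono) auto
  also have "\<dots> = (1 - \<alpha>) * horodisc_size v"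
    using V by (simp add: horodisc_size_def v_def)
  finally show ?thesis by (simp add: \<alpha>_def v_def)
qed

text \<open>Julia's inequality for \<open>F\<close>, whose angular derivative at an atom of mass \<open>\<alpha>\<close> is \<open>1 / \<alpha>\<close>.\<close>

lemma (in real_distribution) horodisc_size_F_transform:
  assumes w: "Im w > 0"
  shows "prob {b} * horodisc_size (F_transform M w) \<le> horodisc_size (w - of_real b)"
proof -
  define G v J where "G = cauchy_transform M w" and "v = w - of_real b" and "J = cauchy_energy M w"
  have G: "G \<noteq> 0" unfolding G_def by (rule cauchy_transform_nonzero[OF w])
  have v: "v \<noteq> 0" unfolding v_def by (rule diff_real_nonzero[OF w])
  have J: "J > 0" unfolding J_def by (rule cauchy_energy_pos[OF w])
  have "prob {b} / (norm v)\<^sup>2 = (LINT t|M. 1 / (norm v)\<^sup>2 * indicator {b} t)"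
    by (subst integral_mult_right_zero) simp
  also have "\<dots> \<le> J"
  proof -
    have i: "integrable M (indicator {b} :: real \<Rightarrow> real)"
      by (auto intro!: integrable_real_indicator simp: less_top[symmetric])
    show ?thesis
      unfolding J_def cauchy_energy_def
      by (rule integral_mono[OF integrable_mult_right[OF i] integrable_cauchy_kernel_sq[OF w]])
         (auto simp: indicator_def v_def)
  qed
  finally have main: "prob {b} \<le> (norm v)\<^sup>2 * J" using v by (simp add: divide_le_eq mult.commute)
  have "horodisc_size (F_transform M w) = 1 / (Im w * J)"
    unfolding horodisc_size_def Im_F_transform[OF w] using G J w
    by (simp add: F_transform_def G_def[symmetric] J_def[symmetric] norm_divide power_divide)
  then have "prob {b} * horodisc_size (F_transform M w) = prob {b} / (Im w * J)" by simp
  also have "\<dots> \<le> (norm v)\<^sup>2 * J / (Im w * J)" using main w J by (intro divide_right_mono) auto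
  also have "\<dots> = horodisc_size v" using J by (simp add: horodisc_size_def v_def)
  finally show ?thesis by (simp add: v_def)
qed

context subordination
begin

text \<open>Let \<open>D1, D2\<close> be the horodisc sizes of \<open>\<omega>1 - b\<close> and \<open>\<omega>2 - c\<close> at \<open>z = b + c + iy\<close>. Julia's inequality and
  subadditivity turn the two subordination equations into \<open>\<beta> D1 \<le> \<beta> y + (1 - \<beta>) D2\<close> and
  \<open>\<alpha> D2 \<le> \<alpha> y + (1 - \<alpha>) D1\<close>. Elimination of \<open>D2\<close> leaves \<open>(\<alpha> + \<beta> - 1) D1 \<le> \<alpha> y\<close>, hence
  \<open>(\<alpha> + \<beta> - 1) |F(z)| \<le> y\<close>, and \<open>y / |F(z)|\<close> tends to the mass at \<open>b + c\<close>.\<close>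

lemma atom_lower_bound:
  assumes bc: "measure \<mu> {b} + measure \<nu> {c} > 1"
  shows "measure \<rho> {b + c} \<ge> measure \<mu> {b} + measure \<nu> {c} - 1"
proof -
  define \<alpha> \<beta> where "\<alpha> = measure \<mu> {b}" and "\<beta> = measure \<nu> {c}"
  have less: "\<alpha> < 1" "\<beta> < 1"
    unfolding \<alpha>_def \<beta>_def using \<mu>.prob_singleton_less_1 \<nu>.prob_singleton_less_1 \<mu>_not_return \<nu>_not_return by auto
  have sum: "\<alpha> + \<beta> > 1" using bc by (simp add: \<alpha>_def \<beta>_def)
  have pos: "\<alpha> > 0" "\<beta> > 0" using less sum by linarith+
  have bound: "(\<alpha> + \<beta> - 1) * norm (F_transform \<rho> z) \<le> y"
    if y: "y > 0" and z_def: "z = Complex (b + c) y" for y z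
  proof -
    have z: "Im z > 0" using y by (simp add: z_def)
    define u1 u2 where "u1 = \<omega>1 z - of_real b" and "u2 = \<omega>2 z - of_real c"
    define D1 D2 where "D1 = horodisc_size u1" and "D2 = horodisc_size u2"
    define k1 k2 where "k1 = h_transform \<mu> (\<omega>1 z) + of_real b" and "k2 = h_transform \<nu> (\<omega>2 z) + of_real c"
    have kpos: "Im k1 > 0" "Im k2 > 0"
      unfolding k1_def k2_def
      using \<mu>.Im_h_transform_pos[OF Im_\<omega>(1)[OF z] \<mu>_not_return]
        \<nu>.Im_h_transform_pos[OF Im_\<omega>(2)[OF z] \<nu>_not_return] by auto
    have iy: "Im (\<i> * of_real y) > 0" using y by simp
    have zy: "z = of_real b + of_real c + \<i> * of_real y" by (simp add: z_def complex_eq_iff)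
    have u: "u1 = \<i> * of_real y + k2" "u2 = \<i> * of_real y + k1"
      unfolding u1_def u2_def k1_def k2_def
      by (subst \<omega>_eq(1)[OF z], simp add: zy) (subst \<omega>_eq(2)[OF z], simp add: zy)
    have hy: "horodisc_size (\<i> * of_real y) = y"
      using y by (simp add: horodisc_size_def norm_mult power2_eq_square)
    have D: "D1 \<le> y + horodisc_size k2" "D2 \<le> y + horodisc_size k1"
      unfolding D1_def D2_def u
      using horodisc_size_add[OF iy kpos(2)] horodisc_size_add[OF iy kpos(1)] hy by simp_all
    have k: "\<alpha> * horodisc_size k1 \<le> (1 - \<alpha>) * D1" "\<beta> * horodisc_size k2 \<le> (1 - \<beta>) * D2"
      unfolding \<alpha>_def \<beta>_def k1_def k2_def D1_def D2_def u1_def u2_def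
      using \<mu>.horodisc_size_h_transform[OF \<mu>_not_return Im_\<omega>(1)[OF z]]
        \<nu>.horodisc_size_h_transform[OF \<nu>_not_return Im_\<omega>(2)[OF z]] by auto
    have e1: "\<beta> * D1 \<le> \<beta> * y + (1 - \<beta>) * D2"
      using mult_left_mono[OF D(1), of \<beta>] k(2) pos by (simp add: distrib_left)
    have e2: "\<alpha> * D2 \<le> \<alpha> * y + (1 - \<alpha>) * D1"
      using mult_left_mono[OF D(2), of \<alpha>] k(1) pos by (simp add: distrib_left)
    have "\<alpha> * (\<beta> * D1) \<le> \<alpha> * (\<beta> * y) + (1 - \<beta>) * (\<alpha> * D2)"
      using mult_left_mono[OF e1, of \<alpha>] pos by (simp add: algebra_simps)
    also have "(1 - \<beta>) * (\<alpha> * D2) \<le> (1 - \<beta>) * (\<alpha> * y + (1 - \<alpha>) * D1)"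
      using mult_left_mono[OF e2, of "1 - \<beta>"] less by simp
    finally have "(\<alpha> + \<beta> - 1) * D1 \<le> \<alpha> * y" by (simp add: algebra_simps)
    moreover have "\<alpha> * norm (F_transform \<rho> z) \<le> D1"
    proof -
      have F: "Im (F_transform \<rho> z) > 0" using \<rho>.Im_F_transform_ge[OF z] z by linarith
      have "norm (F_transform \<rho> z) * Im (F_transform \<rho> z) \<le> (norm (F_transform \<rho> z))\<^sup>2"
        unfolding power2_eq_square using abs_Im_le_cmod[of "F_transform \<rho> z"]
        by (intro mult_left_mono) auto
      then have "norm (F_transform \<rho> z) \<le> horodisc_size (F_transform \<rho> z)"
        using F by (simp add: horodisc_size_def pos_le_divide_eq)
      then have "\<alpha> * norm (F_transform \<rho> z) \<le> \<alpha> * horodisc_size (F_transform \<rho> z)"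
        using pos by (intro mult_left_mono) auto
      also have "\<dots> \<le> D1"
        unfolding \<alpha>_def D1_def u1_def F_eq(1)[OF z] by (rule \<mu>.horodisc_size_F_transform[OF Im_\<omega>(1)[OF z]])
      finally show ?thesis .
    qed
    ultimately have "(\<alpha> + \<beta> - 1) * (\<alpha> * norm (F_transform \<rho> z)) \<le> \<alpha> * y"
      using mult_left_mono[of "\<alpha> * norm (F_transform \<rho> z)" D1 "\<alpha> + \<beta> - 1"] sum by linarith
    then have "\<alpha> * ((\<alpha> + \<beta> - 1) * norm (F_transform \<rho> z)) \<le> \<alpha> * y" by (simp add: mult_ac)
    then show ?thesis using pos by simp
  qed
  have "(\<lambda>n. norm (\<i> * of_real (1 / real (Suc n)) * cauchy_transform \<rho> (Complex (b + c) (1 / real (Suc n)))))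
     \<longlonglongrightarrow> norm (complex_of_real (measure \<rho> {b + c}))"
    by (intro tendsto_norm \<rho>.atom_limit)
  moreover have "\<alpha> + \<beta> - 1 \<le> norm (\<i> * of_real (1 / real (Suc n)) * cauchy_transform \<rho> (Complex (b + c) (1 / real (Suc n))))" for n
  proof -
    define y z where "y = 1 / real (Suc n)" and "z = Complex (b + c) y"
    have y: "y > 0" by (simp add: y_def)
    then have z: "Im z > 0" by (simp add: z_def)
    have G: "norm (cauchy_transform \<rho> z) > 0" using \<rho>.cauchy_transform_nonzero[OF z] by simp
    have "(\<alpha> + \<beta> - 1) * (1 / norm (cauchy_transform \<rho> z)) \<le> y"
      using bound[OF y z_def] by (simp add: F_transform_def norm_divide)
    then have "\<alpha> + \<beta> - 1 \<le> y * norm (cauchy_transform \<rho> z)" using G by (simp add: divide_simps)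
    then show ?thesis using y unfolding y_def[symmetric] z_def[symmetric] by (simp add: norm_mult)
  qed
  ultimately have "\<alpha> + \<beta> - 1 \<le> norm (complex_of_real (measure \<rho> {b + c}))"
    by (intro tendsto_lowerbound[where F = sequentially]) auto
  then show ?thesis by (simp add: \<alpha>_def \<beta>_def)
qed

text \<open>At an atom \<open>iy G(a + iy)\<close> tends to its mass \<open>m\<close>, so \<open>F \<rightarrow> 0\<close> and \<open>y / Im F = |iyG|\<^sup>2 / Re (iyG) \<rightarrow> m\<^sup>2 / m\<close>.\<close>

lemma atom_upper_bound:
  assumes a: "measure \<rho> {a} > 0"
  obtains b c where "a = b + c" "measure \<mu> {b} + measure \<nu> {c} \<ge> 1 + measure \<rho> {a}"
proof -
  define y where "y n = 1 / real (Suc n)" for n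
  define z where "z n = Complex a (y n)" for n
  define g where "g n = \<i> * of_real (y n) * cauchy_transform \<rho> (z n)" for n
  have y: "y n > 0" for n by (simp add: y_def)
  have z: "Im (z n) > 0" for n using y by (simp add: z_def)
  have g_lim: "g \<longlonglongrightarrow> of_real (measure \<rho> {a})"
    unfolding g_def[abs_def] z_def y_def by (rule \<rho>.atom_limit)
  have y0: "y \<longlonglongrightarrow> 0" unfolding y_def by real_asymp
  have G0: "cauchy_transform \<rho> (z n) \<noteq> 0" for n by (rule \<rho>.cauchy_transform_nonzero[OF z])
  show ?thesis
  proof (rule heavy_pair_of_F_tendsto_0[OF z])
    show "z \<longlonglongrightarrow> of_real a"
      unfolding z_def using y0 by (auto intro!: tendsto_eq_intros simp: complex_of_real_def)
    have "(\<lambda>n. \<i> * of_real (y n) / g n) \<longlonglongrightarrow> \<i> * of_real 0 / of_real (measure \<rho> {a})"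
      by (intro tendsto_intros y0 g_lim) (use a in auto)
    moreover have "\<i> * of_real (y n) / g n = F_transform \<rho> (z n)" for n
      using y[of n] G0[of n] by (simp add: g_def F_transform_def)
    ultimately show "(\<lambda>n. F_transform \<rho> (z n)) \<longlonglongrightarrow> 0" by simp
    show "(\<lambda>n. (norm (g n))\<^sup>2 / Re (g n)) \<longlonglongrightarrow> measure \<rho> {a}"
    proof -
      have "(\<lambda>n. (norm (g n))\<^sup>2 / Re (g n)) \<longlonglongrightarrow> (norm (complex_of_real (measure \<rho> {a})))\<^sup>2 / Re (of_real (measure \<rho> {a}))"
        by (intro tendsto_intros g_lim) (use a in auto)
      then show ?thesis using a by (simp add: power2_eq_square)
    qed
    show "(norm (g n))\<^sup>2 / Re (g n) \<le> Im (z n) / Im (F_transform \<rho> (z n))" for n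
    proof -
      have "Re (g n) = y n * (y n * cauchy_energy \<rho> (z n))"
        using \<rho>.Im_cauchy_transform[OF z, of n] by (simp add: g_def z_def)
      moreover have "norm (g n) = y n * norm (cauchy_transform \<rho> (z n))"
        using y[of n] by (simp add: g_def norm_mult)
      ultimately show ?thesis
        unfolding \<rho>.Im_F_transform[OF z] using y[of n] \<rho>.cauchy_energy_pos[OF z, of n] G0[of n]
        by (simp add: z_def power_mult_distrib power2_eq_square)
    qed
  qed (rule that)
qed

text \<open>The pair found at the atom must be \<open>(b, c)\<close> itself: for two pairs with the same sum and different entries the
  four masses add up to at most \<open>2\<close>, but both pairs weigh more than \<open>1\<close>.\<close>

lemma atom_formula:
  assumes bc: "measure \<mu> {b} + measure \<nu> {c} > 1"
  shows "measure \<rho> {b + c} = measure \<mu> {b} + measure \<nu> {c} - 1"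
proof -
  have ge: "measure \<rho> {b + c} \<ge> measure \<mu> {b} + measure \<nu> {c} - 1" by (rule atom_lower_bound[OF bc])
  then have pos: "measure \<rho> {b + c} > 0" using bc by linarith
  obtain b' c' where b': "b + c = b' + c'" "measure \<mu> {b'} + measure \<nu> {c'} \<ge> 1 + measure \<rho> {b + c}"
    using atom_upper_bound[OF pos] .
  have "b' = b"
  proof (rule ccontr)
    assume "b' \<noteq> b"
    then have "c' \<noteq> c" using b'(1) by auto
    then show False
      using \<mu>.prob_two_points[OF \<open>b' \<noteq> b\<close>] \<nu>.prob_two_points[OF \<open>c' \<noteq> c\<close>] b'(2) pos bc by linarith
  qed
  then show ?thesis using b' ge by auto
qed

lemma atom_iff: "measure \<rho> {a} > 0 \<longleftrightarrow> (\<exists>b c. a = b + c \<and> measure \<mu> {b} + measure \<nu> {c} > 1)"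
proof
  assume "measure \<rho> {a} > 0"
  then show "\<exists>b c. a = b + c \<and> measure \<mu> {b} + measure \<nu> {c} > 1"
    using atom_upper_bound[of a] by (metis add_strict_increasing2 less_add_same_cancel1 less_le_trans)
next
  assume "\<exists>b c. a = b + c \<and> measure \<mu> {b} + measure \<nu> {c} > 1"
  then show "measure \<rho> {a} > 0" using atom_formula by force
qed

end

section \<open>Analytic continuation across the real line\<close>

text \<open>Far out, the kernel can only be large because of the small mass near infinity, and that contributes at most
  its mass divided by \<open>Im w\<close>.\<close>

lemma (in real_distribution) Im_tendsto_0_of_cauchy_bounded_below:
  assumes w: "\<And>n. Im (w n) > 0" and inf: "filterlim w at_infinity sequentially"
    and c: "c > 0" "\<And>n. norm (cauchy_transform M (w n)) \<ge> c"
  shows "(\<lambda>n. Im (w n)) \<longlonglongrightarrow> 0"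
proof (rule LIMSEQ_I)
  fix \<epsilon> :: real assume \<epsilon>: "\<epsilon> > 0"
  obtain R where R: "R > 0" "prob {t. \<bar>t\<bar> > R} < \<epsilon> * c / 2"
    using tail_measure_small[of "\<epsilon> * c / 2"] \<epsilon> c by auto
  have "\<forall>\<^sub>F n in sequentially. norm (w n) \<ge> R + 2 / c"
    using inf by (auto simp: filterlim_at_infinity[of 0] add_pos_pos R c)
  then obtain N where N: "\<And>n. n \<ge> N \<Longrightarrow> norm (w n) \<ge> R + 2 / c"
    unfolding eventually_sequentially by blast
  have "Im (w n) < \<epsilon>" if n: "n \<ge> N" for n
  proof -
    define P where "P = prob {t. \<bar>t\<bar> > R}"
    have meas: "{t::real. \<bar>t\<bar> > R} \<in> sets borel" by measurable
    have i: "integrable M (indicator {t. \<bar>t\<bar> > R} :: real \<Rightarrow> real)"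
      using meas by (auto intro!: integrable_real_indicator simp: less_top[symmetric])
    have "norm (cauchy_transform M (w n)) \<le> (LINT t|M. c / 2 + 1 / Im (w n) * indicator {t. \<bar>t\<bar> > R} t)"
      unfolding cauchy_transform_def
    proof (rule Bochner_Integration.integral_norm_bound_integral[OF integrable_cauchy_kernel[OF w]])
      show "integrable M (\<lambda>t. c / 2 + 1 / Im (w n) * indicator {t. \<bar>t\<bar> > R} t)"
        by (rule Bochner_Integration.integrable_add[OF _ integrable_mult_right[OF i]]) simp
      fix t
      show "norm (1 / (w n - of_real t)) \<le> c / 2 + 1 / Im (w n) * indicator {t. \<bar>t\<bar> > R} t"
      proof (cases "\<bar>t\<bar> > R")
        case True
        then show ?thesis using norm_cauchy_kernel_le[OF w[of n], of t] c(1) by (simp add: add_increasing)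
      next
        case False
        then have "norm (w n - of_real t) \<ge> 2 / c"
          using norm_triangle_ineq2[of "w n" "of_real t"] N[OF n] by simp
        then have "norm (1 / (w n - of_real t)) \<le> 1 / (2 / c)"
          unfolding norm_divide norm_one using c(1) diff_real_nonzero[OF w[of n], of t]
          by (intro divide_left_mono mult_pos_pos) auto
        then show ?thesis using False by simp
      qed
    qed
    also have "\<dots> = c / 2 + 1 / Im (w n) * P"
    proof -
      have "(LINT t|M. 1 / Im (w n) * indicator {t. \<bar>t\<bar> > R} t) = 1 / Im (w n) * P"
        unfolding P_def using meas by (subst integral_mult_right_zero) simp
      then show ?thesis
        by (subst Bochner_Integration.integral_add[OF _ integrable_mult_right[OF i]]) auto
    qed
    also have "1 / Im (w n) * P = P / Im (w n)" by simp
    finally have "c / 2 \<le> P / Im (w n)" using c(2)[of n] by linarith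
    then have "Im (w n) * (c / 2) \<le> P" using w[of n] by (simp add: pos_le_divide_eq mult.commute)
    also have "\<dots> < \<epsilon> * (c / 2)" using R(2) by (simp add: P_def)
    finally show ?thesis using c(1) by simp
  qed
  then show "\<exists>no. \<forall>n\<ge>no. norm (Im (w n) - 0) < \<epsilon>"
    using w by (intro exI[of _ N]) (simp add: abs_of_pos)
qed

text \<open>A period would keep \<open>G\<close> constant along \<open>i + n d\<close>, where it tends to zero.\<close>

lemma (in real_distribution) F_transform_not_periodic:
  assumes d: "d \<noteq> (0::real)" shows "\<exists>u. Im u > 0 \<and> F_transform M (u + of_real d) \<noteq> F_transform M u"
proof (rule ccontr)
  assume "\<not> ?thesis"
  then have per: "F_transform M (u + of_real d) = F_transform M u" if "Im u > 0" for u using that by blast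
  have iter: "F_transform M (\<i> + of_real (real n * d)) = F_transform M \<i>" for n
  proof (induction n)
    case (Suc n)
    have eq: "\<i> + of_real (real (Suc n) * d) = (\<i> + of_real (real n * d)) + of_real d" by (simp add: algebra_simps)
    have "Im (\<i> + complex_of_real (real n * d)) > 0" by simp
    from per[OF this] Suc show ?case unfolding eq by (rule trans)
  qed simp
  define w where "w n = \<i> + complex_of_real (real n * d)" for n
  have inf: "filterlim w at_infinity sequentially"
  proof -
    have "filterlim (\<lambda>n. norm (w n)) at_top sequentially"
    proof (rule filterlim_at_top_mono)
      have "\<bar>d\<bar> > 0" using d by simp
      then show "filterlim (\<lambda>n. real n * \<bar>d\<bar>) at_top sequentially" by real_asymp
      show "\<forall>\<^sub>F n in sequentially. real n * \<bar>d\<bar> \<le> norm (w n)"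
        using abs_Re_le_cmod[of "w _"] by (intro always_eventually allI) (simp add: w_def abs_mult)
    qed
    then show ?thesis by (rule filterlim_norm_at_top_imp_at_infinity)
  qed
  have eq: "cauchy_transform M (w n) = cauchy_transform M \<i>" for n
    using iter[of n] by (simp add: w_def F_transform_def)
  have Im_w: "Im (w n) = 1" for n by (simp add: w_def)
  have "cauchy_transform M \<i> \<noteq> 0" by (rule cauchy_transform_nonzero) simp
  then have "(\<lambda>n. Im (w n)) \<longlonglongrightarrow> 0"
    by (intro Im_tendsto_0_of_cauchy_bounded_below[OF _ inf, of "norm (cauchy_transform M \<i>)"])
       (simp_all add: Im_w eq)
  then show False by (simp add: Im_w LIMSEQ_const_iff)
qed

lemma local_holomorphic_inverse:
  assumes f: "f holomorphic_on S" "open S" and \<xi>: "\<xi> \<in> S" "deriv f \<xi> \<noteq> 0"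
  obtains r g where "r > 0" "ball \<xi> r \<subseteq> S" "open (f ` ball \<xi> r)" "g holomorphic_on f ` ball \<xi> r"
    "\<And>z. z \<in> ball \<xi> r \<Longrightarrow> g (f z) = z" "deriv g (f \<xi>) = 1 / deriv f \<xi>"
proof -
  obtain r where r: "r > 0" "ball \<xi> r \<subseteq> S" "inj_on f (ball \<xi> r)"
    using has_complex_derivative_locally_injective[OF f(1) \<xi>(1) f(2) \<xi>(2)] by blast
  have hol: "f holomorphic_on ball \<xi> r" by (rule holomorphic_on_subset[OF f(1) r(2)])
  obtain g where g: "g holomorphic_on f ` ball \<xi> r"
    "\<And>z. z \<in> ball \<xi> r \<Longrightarrow> deriv f z * deriv g (f z) = 1" "\<And>z. z \<in> ball \<xi> r \<Longrightarrow> g (f z) = z"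
    using holomorphic_has_inverse[OF hol open_ball r(3)] by metis
  have "deriv g (f \<xi>) = 1 / deriv f \<xi>" using g(2)[of \<xi>] r(1) \<xi>(2) by (simp add: field_simps)
  then show ?thesis
    using that[of r g] r g open_mapping_thm3[OF hol open_ball r(3)] by blast
qed

context subordination
begin

lemma open_preimage_\<omega>:
  assumes "open A" "open B" "open C"
  shows "open {z. Im z > 0 \<and> z \<in> C \<and> \<omega>1 z \<in> A \<and> \<omega>2 z \<in> B}"
proof -
  let ?H = "{z::complex. Im z > 0}"
  have o: "open ?H" by (simp add: open_halfspace_Im_gt)
  have "open (?H \<inter> \<omega>1 -` A)" "open (?H \<inter> \<omega>2 -` B)"
    using holomorphic_\<omega>[THEN holomorphic_on_imp_continuous_on] o assms(1,2)
    by (auto intro: continuous_open_preimage)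
  then have "open ((?H \<inter> \<omega>1 -` A) \<inter> (?H \<inter> \<omega>2 -` B) \<inter> C)" using assms(3) by auto
  also have "(?H \<inter> \<omega>1 -` A) \<inter> (?H \<inter> \<omega>2 -` B) \<inter> C = {z. Im z > 0 \<and> z \<in> C \<and> \<omega>1 z \<in> A \<and> \<omega>2 z \<in> B}" by auto
  finally show ?thesis .
qed

text \<open>Near \<open>w2\<close> the function \<open>F\<^sub>\<nu>\<close> has a local inverse, so \<open>\<omega>2 = k(\<omega>1)\<close> with \<open>k = (inverse of F\<^sub>\<nu>) \<circ> F\<^sub>\<mu>\<close>, and the sum of the
  subordination functions becomes \<open>z = \<Psi>(\<omega>1)\<close> with \<open>\<Psi>(w) = w + k(w) - F\<^sub>\<mu>(w)\<close>. This replaces an implicit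
  function theorem in two variables by an inverse function theorem in one: \<open>\<Psi>'(w1) \<noteq> 0\<close> is exactly the
  regularity condition, and the local inverse of \<open>\<Psi>\<close> continues \<open>\<omega>1\<close>.\<close>

lemma analytic_boundary_of_regular_limit_deriv_nonzero:
  assumes w: "Im w1 > 0" "Im w2 > 0" and eq: "w1 + w2 - of_real x = F_transform \<mu> w1" "F_transform \<mu> w1 = F_transform \<nu> w2"
    and reg: "(deriv (F_transform \<mu>) w1 - 1) * (deriv (F_transform \<nu>) w2 - 1) \<noteq> 1"
    and nz: "deriv (F_transform \<nu>) w2 \<noteq> 0"
    and z: "\<And>n. Im (z n) > 0" "z \<longlonglongrightarrow> of_real x" "(\<lambda>n. \<omega>1 (z n)) \<longlonglongrightarrow> w1" "(\<lambda>n. \<omega>2 (z n)) \<longlonglongrightarrow> w2"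
  shows "x \<in> analytic_boundary \<rho>"
proof -
  let ?H = "{z::complex. Im z > 0}"
  let ?F = "F_transform \<mu>" and ?K = "F_transform \<nu>"
  have oH: "open ?H" by (simp add: open_halfspace_Im_gt)
  obtain r2 g2 where g2: "r2 > 0" "ball w2 r2 \<subseteq> ?H" "open (?K ` ball w2 r2)" "g2 holomorphic_on ?K ` ball w2 r2"
    "\<And>z. z \<in> ball w2 r2 \<Longrightarrow> g2 (?K z) = z" "deriv g2 (?K w2) = 1 / deriv ?K w2"
  proof -
    have "w2 \<in> ?H" using w by simp
    from local_holomorphic_inverse[OF \<nu>.holomorphic_F_transform oH this nz] show ?thesis using that .
  qed
  define S1 where "S1 = ?H \<inter> ?F -` (?K ` ball w2 r2)"
  have S1: "open S1" unfolding S1_def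
    using holomorphic_on_imp_continuous_on[OF \<mu>.holomorphic_F_transform] oH g2(3)
    by (rule continuous_open_preimage)
  have w1S: "w1 \<in> S1" using w eq(2) g2(1) by (auto simp: S1_def intro!: imageI)
  have FS1: "?F holomorphic_on S1" by (rule holomorphic_on_subset[OF \<mu>.holomorphic_F_transform]) (auto simp: S1_def)
  define k where "k w = g2 (?F w)" for w
  have k_hol: "k holomorphic_on S1"
    unfolding k_def[abs_def] by (rule holomorphic_on_comp[OF g2(4) FS1]) (auto simp: S1_def)
  define \<Psi> where "\<Psi> w = w + k w - ?F w" for w
  have \<Psi>_hol: "\<Psi> holomorphic_on S1" unfolding \<Psi>_def[abs_def] by (intro holomorphic_intros k_hol FS1)
  have k1: "k w1 = w2" unfolding k_def eq(2) using g2(1) by (intro g2(5)) simp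
  have \<Psi>1: "\<Psi> w1 = of_real x" using eq(1) k1 by (simp add: \<Psi>_def algebra_simps)
  define a b where "a = deriv ?F w1" and "b = deriv ?K w2"
  have dF: "(?F has_field_derivative a) (at w1)"
    unfolding a_def using FS1 S1 w1S by (rule holomorphic_derivI)
  have "(g2 has_field_derivative 1 / b) (at (?F w1))"
    unfolding b_def g2(6)[symmetric] eq(2) using g2(4,3) by (rule holomorphic_derivI) (use g2(1) in simp)
  from DERIV_chain2[OF this dF] have dk: "(k has_field_derivative 1 / b * a) (at w1)"
    unfolding k_def[abs_def] .
  have "(\<Psi> has_field_derivative (1 + 1 / b * a - a)) (at w1)"
    unfolding \<Psi>_def[abs_def] by (intro derivative_intros dk dF)
  then have "deriv \<Psi> w1 = 1 + 1 / b * a - a" by (rule DERIV_imp_deriv)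
  also have "\<dots> = (1 - (a - 1) * (b - 1)) / b" using nz by (simp add: b_def[symmetric] field_simps)
  also have "\<dots> \<noteq> 0" using nz reg by (simp add: a_def b_def)
  finally have d\<Psi>: "deriv \<Psi> w1 \<noteq> 0" .
  obtain r1 g1 where g1: "r1 > 0" "ball w1 r1 \<subseteq> S1" "open (\<Psi> ` ball w1 r1)" "g1 holomorphic_on \<Psi> ` ball w1 r1"
    "\<And>z. z \<in> ball w1 r1 \<Longrightarrow> g1 (\<Psi> z) = z" "deriv g1 (\<Psi> w1) = 1 / deriv \<Psi> w1"
  proof -
    from local_holomorphic_inverse[OF \<Psi>_hol S1 w1S d\<Psi>] show ?thesis using that .
  qed
  have "of_real x \<in> \<Psi> ` ball w1 r1" using \<Psi>1 g1(1) by (metis centre_in_ball imageI)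
  then obtain e where e: "e > 0" "ball (of_real x) e \<subseteq> \<Psi> ` ball w1 r1"
    using g1(3) open_contains_ball by blast
  have g1_up: "Im (g1 u) > 0" if "u \<in> ball (of_real x) e" for u
  proof -
    obtain v where "v \<in> ball w1 r1" "u = \<Psi> v" using \<open>u \<in> ball (of_real x) e\<close> e(2) by blast
    then show ?thesis using g1(2,5) by (auto simp: S1_def)
  qed
  let ?Q = "?H \<inter> ball (of_real x) e"
  define W where "W = {z. Im z > 0 \<and> z \<in> ball (of_real x) e \<and> \<omega>1 z \<in> ball w1 r1 \<and> \<omega>2 z \<in> ball w2 r2}"
  have "open W" unfolding W_def by (intro open_preimage_\<omega>) auto
  have W_eq: "g1 u = \<omega>1 u" if "u \<in> W" for u
  proof -
    have u: "Im u > 0" "\<omega>1 u \<in> ball w1 r1" "\<omega>2 u \<in> ball w2 r2" using that by (auto simp: W_def)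
    have "k (\<omega>1 u) = g2 (?K (\<omega>2 u))" unfolding k_def using F_eq(1,2)[OF u(1)] by simp
    also have "\<dots> = \<omega>2 u" by (rule g2(5)[OF u(3)])
    finally have "\<Psi> (\<omega>1 u) = \<omega>1 u + \<omega>2 u - ?F (\<omega>1 u)" by (simp add: \<Psi>_def)
    also have "\<dots> = u" using F_eq(1,3)[OF u(1)] by simp
    finally show ?thesis using g1(5)[OF u(2)] by simp
  qed
  have "W \<noteq> {}"
  proof -
    have "\<forall>\<^sub>F n in sequentially. z n \<in> ball (of_real x) e"
      using z(2) e(1) by (intro topological_tendstoD) auto
    moreover have "\<forall>\<^sub>F n in sequentially. \<omega>1 (z n) \<in> ball w1 r1"
      using z(3) g1(1) by (intro topological_tendstoD) auto
    moreover have "\<forall>\<^sub>F n in sequentially. \<omega>2 (z n) \<in> ball w2 r2"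
      using z(4) g2(1) by (intro topological_tendstoD) auto
    ultimately have "\<forall>\<^sub>F n in sequentially. z n \<in> W"
      by eventually_elim (simp add: W_def z(1))
    then show ?thesis using eventually_happens by fastforce
  qed
  have g1Q: "g1 holomorphic_on ball (of_real x) e" by (rule holomorphic_on_subset[OF g1(4) e(2)])
  have Q_eq: "g1 u = \<omega>1 u" if "u \<in> ?Q" for u
  proof (rule analytic_continuation_open[OF \<open>open W\<close> _ \<open>W \<noteq> {}\<close> _ _ _ _ W_eq that])
    show "open ?Q" using oH by auto
    show "connected ?Q" by (intro convex_connected convex_Int convex_halfspace_Im_gt convex_ball)
    show "W \<subseteq> ?Q" by (auto simp: W_def)
    show "g1 holomorphic_on ?Q" by (rule holomorphic_on_subset[OF g1Q]) auto
    show "\<omega>1 holomorphic_on ?Q" by (rule holomorphic_on_subset[OF holomorphic_\<omega>(1)]) auto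
  qed
  have "analytic_boundary_at \<rho> x e (\<lambda>u. cauchy_transform \<mu> (g1 u))"
    unfolding analytic_boundary_at_def
  proof (intro conjI ballI impI allI)
    show "e > 0" by (rule e(1))
    show "(\<lambda>u. cauchy_transform \<mu> (g1 u)) holomorphic_on ball (of_real x) e"
      by (rule holomorphic_on_comp[OF \<mu>.holomorphic_cauchy_transform g1Q]) (use g1_up in auto)
    show "cauchy_transform \<mu> (g1 u) = cauchy_transform \<rho> u" if "u \<in> ball (of_real x) e" "Im u > 0" for u
      using Q_eq[of u] cauchy_eq(1)[OF that(2)] that by simp
    show "Im (cauchy_transform \<mu> (g1 (of_real t))) < 0" if "\<bar>t - x\<bar> < e" for t
      by (rule \<mu>.Im_cauchy_transform_neg, rule g1_up) (use that in \<open>simp add: dist_real_def abs_minus_commute\<close>)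
  qed
  then show ?thesis by (auto simp: analytic_boundary_def)
qed

text \<open>If both derivatives vanished, the product in the regularity condition would be \<open>1\<close>; so the preceding
  lemma applies to \<open>(\<mu>, \<nu>)\<close> or to \<open>(\<nu>, \<mu>)\<close>.\<close>

lemma analytic_boundary_of_regular_limit:
  assumes w: "Im w1 > 0" "Im w2 > 0" and eq: "w1 + w2 - of_real x = F_transform \<mu> w1" "F_transform \<mu> w1 = F_transform \<nu> w2"
    and reg: "(deriv (F_transform \<mu>) w1 - 1) * (deriv (F_transform \<nu>) w2 - 1) \<noteq> 1"
    and z: "\<And>n. Im (z n) > 0" "z \<longlonglongrightarrow> of_real x" "(\<lambda>n. \<omega>1 (z n)) \<longlonglongrightarrow> w1" "(\<lambda>n. \<omega>2 (z n)) \<longlonglongrightarrow> w2"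
  shows "x \<in> analytic_boundary \<rho>"
proof (cases "deriv (F_transform \<nu>) w2 = 0")
  case False
  then show ?thesis using analytic_boundary_of_regular_limit_deriv_nonzero[OF w eq reg _ z] by blast
next
  case True
  then have nz: "deriv (F_transform \<mu>) w1 \<noteq> 0" using reg by auto
  interpret sw: subordination \<nu> \<mu> \<rho> \<omega>2 \<omega>1 by (rule swap)
  show ?thesis
    by (rule sw.analytic_boundary_of_regular_limit_deriv_nonzero[OF w(2,1) _ eq(2)[symmetric] _ nz z(1,2,4,3)])
       (use eq reg in \<open>simp_all add: add.commute mult.commute\<close>)
qed

text \<open>The fixed-point map of the subordination function at a real point \<open>x\<close>. It is a self-map of the half-plane but,
  unlike for \<open>Im z > 0\<close>, it may be an automorphism, as for two measures with two atoms each.\<close>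

definition boundary_map :: "real \<Rightarrow> complex \<Rightarrow> complex"
  where "boundary_map x w = of_real x + h_transform \<nu> (of_real x + h_transform \<mu> w)"

lemma Im_h_pos: "Im w > 0 \<Longrightarrow> Im (h_transform \<mu> w) > 0" "Im w > 0 \<Longrightarrow> Im (h_transform \<nu> w) > 0"
  using \<mu>.Im_h_transform_pos \<nu>.Im_h_transform_pos \<mu>_not_return \<nu>_not_return by auto

text \<open>If the map is the identity at \<open>x\<close> and at \<open>x'\<close>, then \<open>h\<^sub>\<nu>(x + u) + x = h\<^sub>\<nu>(x' + u) + x'\<close> for all \<open>u\<close> in the open
  image of \<open>h\<^sub>\<mu>\<close>, hence on the whole half-plane; so \<open>F\<^sub>\<nu>\<close> has the period \<open>x' - x\<close>. One exceptional point does occur: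
  for two symmetric Bernoulli measures on \<open>{-1, 1}\<close> the map is the identity at \<open>x = 0\<close>.\<close>

lemma boundary_map_eq_id_unique:
  assumes x: "\<And>w. Im w > 0 \<Longrightarrow> boundary_map x w = w" and x': "\<And>w. Im w > 0 \<Longrightarrow> boundary_map x' w = w"
  shows "x = x'"
proof (rule ccontr)
  assume "x \<noteq> x'"
  let ?H = "{z::complex. Im z > 0}"
  have oH: "open ?H" by (simp add: open_halfspace_Im_gt)
  have inj: "inj_on (h_transform \<mu>) ?H"
  proof (rule inj_onI)
    fix u v assume "u \<in> ?H" "v \<in> ?H" "h_transform \<mu> u = h_transform \<mu> v"
    then show "u = v" using x[of u] x[of v] by (simp add: boundary_map_def)
  qed
  define W where "W = h_transform \<mu> ` ?H"
  have "open W" unfolding W_def by (rule open_mapping_thm3[OF \<mu>.holomorphic_h_transform oH inj])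
  have WH: "W \<subseteq> ?H" using Im_h_pos by (auto simp: W_def)
  have "W \<noteq> {}" unfolding W_def by (auto intro!: exI[of _ \<i>])
  have hol: "(\<lambda>u. of_real s + h_transform \<nu> (of_real s + u)) holomorphic_on ?H" for s
    by (intro holomorphic_intros holomorphic_on_comp[OF \<nu>.holomorphic_h_transform]) auto
  have eq: "of_real x + h_transform \<nu> (of_real x + u) = of_real x' + h_transform \<nu> (of_real x' + u)"
    if u: "u \<in> ?H" for u
  proof (rule analytic_continuation_open[OF \<open>open W\<close> oH \<open>W \<noteq> {}\<close> _ WH hol hol _ u])
    show "connected ?H" by (simp add: convex_connected convex_halfspace_Im_gt)
    fix v assume "v \<in> W"
    then obtain w where w: "Im w > 0" "v = h_transform \<mu> w" by (auto simp: W_def)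
    show "of_real x + h_transform \<nu> (of_real x + v) = of_real x' + h_transform \<nu> (of_real x' + v)"
      using x[OF w(1)] x'[OF w(1)] by (simp add: boundary_map_def w(2))
  qed
  have "F_transform \<nu> (u + of_real (x' - x)) = F_transform \<nu> u" if u: "Im u > 0" for u
  proof -
    have v: "u - of_real x \<in> ?H" using u by simp
    have "h_transform \<nu> (of_real x' + (u - of_real x)) = of_real x - of_real x' + h_transform \<nu> u"
      using eq[OF v] by (simp add: algebra_simps)
    then show ?thesis by (simp add: h_transform_def algebra_simps)
  qed
  then show False using \<nu>.F_transform_not_periodic[of "x' - x"] \<open>x \<noteq> x'\<close> by auto
qed

text \<open>The product is the derivative of the boundary map at its fixed point \<open>w1\<close>, so the equality case of the
  Schwarz lemma applies.\<close>

lemma boundary_map_eq_id_of_critical_point: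
  assumes w: "Im w1 > 0" "Im w2 > 0" and eq: "w1 = of_real x + h_transform \<nu> w2" "w2 = of_real x + h_transform \<mu> w1"
    and crit: "(deriv (F_transform \<mu>) w1 - 1) * (deriv (F_transform \<nu>) w2 - 1) = 1"
    and u: "Im u > 0"
  shows "boundary_map x u = u"
proof (rule self_map_eq_id[of "boundary_map x" w1])
  let ?H = "{z::complex. Im z > 0}"
  have oH: "open ?H" by (simp add: open_halfspace_Im_gt)
  show "boundary_map x holomorphic_on ?H"
    unfolding boundary_map_def[abs_def]
    by (intro holomorphic_intros holomorphic_on_comp[OF \<nu>.holomorphic_h_transform] \<mu>.holomorphic_h_transform)
       (use Im_h_pos in auto)
  show "Im (boundary_map x v) > 0" if "Im v > 0" for v
    unfolding boundary_map_def using Im_h_pos that by simp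
  show "boundary_map x w1 = w1" using eq by (simp add: boundary_map_def)
  have d: "(h_transform \<mu> has_field_derivative deriv (F_transform \<mu>) w1 - 1) (at w1)"
    "(h_transform \<nu> has_field_derivative deriv (F_transform \<nu>) w2 - 1) (at w2)"
    unfolding h_transform_def[abs_def]
    by (intro derivative_intros holomorphic_derivI[OF \<mu>.holomorphic_F_transform oH]
        holomorphic_derivI[OF \<nu>.holomorphic_F_transform oH]; use w in simp)+
  have d1: "((\<lambda>v. of_real x + h_transform \<mu> v) has_field_derivative (deriv (F_transform \<mu>) w1 - 1)) (at w1)"
    using DERIV_add[OF DERIV_const d(1), of "of_real x"] by simp
  have "((\<lambda>v. h_transform \<nu> (of_real x + h_transform \<mu> v)) has_field_derivative
     (deriv (F_transform \<nu>) w2 - 1) * (deriv (F_transform \<mu>) w1 - 1)) (at w1)"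
    by (rule DERIV_chain2[OF _ d1]) (use d(2) eq(2) in simp)
  from DERIV_add[OF DERIV_const this, of "of_real x"]
  show "(boundary_map x has_field_derivative 1) (at w1)"
    using crit by (simp add: boundary_map_def[abs_def] mult.commute)
qed (use w u in auto)

text \<open>Since \<open>x\<close> is not a sum of a heavy pair, \<open>F\<close> cannot accumulate at \<open>0\<close>, and as \<open>- Im G \<ge> \<epsilon>\<close> it accumulates at some
  \<open>F0\<close> with \<open>Im F0 > 0\<close>. If \<open>\<omega>1\<close> and \<open>\<omega>2\<close> escaped to infinity, both imaginary parts would tend to \<open>0\<close>, but their sum
  tends to \<open>Im F0\<close>. So there are finite limits \<open>w1, w2\<close> with \<open>Im w1 + Im w2 > 0\<close>, and as soon as one of them lies in
  the open half-plane the subordination equation puts the other one there as well.\<close>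

lemma subordination_limits_in_half_plane:
  assumes x: "\<And>b c. x = b + c \<Longrightarrow> measure \<mu> {b} + measure \<nu> {c} < 1"
    and z: "\<And>n. Im (z n) > 0" "z \<longlonglongrightarrow> of_real x"
    and \<epsilon>: "\<epsilon> > 0" "\<And>n. - Im (cauchy_transform \<rho> (z n)) \<ge> \<epsilon>"
  obtains r w1 w2 where "strict_mono (r :: nat \<Rightarrow> nat)" "(\<lambda>n. \<omega>1 (z (r n))) \<longlonglongrightarrow> w1" "(\<lambda>n. \<omega>2 (z (r n))) \<longlonglongrightarrow> w2"
    "Im w1 > 0" "Im w2 > 0"
    "w1 = of_real x + h_transform \<nu> w2" "w2 = of_real x + h_transform \<mu> w1"
proof -
  have G_ge: "norm (cauchy_transform \<rho> (z n)) \<ge> \<epsilon>" for n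
    using \<epsilon>(2)[of n] abs_Im_le_cmod[of "cauchy_transform \<rho> (z n)"] by linarith
  have "norm (F_transform \<rho> (z n)) \<le> 1 / \<epsilon>" for n
    unfolding F_transform_def norm_divide norm_one using G_ge[of n] \<epsilon>(1) by (intro divide_left_mono mult_pos_pos) auto
  then have "F_transform \<rho> (z n) \<in> cball 0 (1 / \<epsilon>)" for n by simp
  moreover have "compact (cball (0::complex) (1 / \<epsilon>))" by simp
  ultimately obtain F0 s where s: "strict_mono (s :: nat \<Rightarrow> nat)" and "((\<lambda>n. F_transform \<rho> (z n)) \<circ> s) \<longlonglongrightarrow> F0"
    unfolding compact_def by metis
  then have F0: "(\<lambda>n. F_transform \<rho> (z (s n))) \<longlonglongrightarrow> F0" by (simp add: o_def)
  have zs: "(\<lambda>n. z (s n)) \<longlonglongrightarrow> of_real x" using LIMSEQ_subseq_LIMSEQ[OF z(2) s] by (simp add: o_def)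
  have "F0 \<noteq> 0"
  proof
    assume "F0 = 0"
    have nn: "0 \<le> Im (z (s n)) / Im (F_transform \<rho> (z (s n)))" for n
      using \<rho>.Im_F_transform_ge[OF z(1)[of "s n"]] z(1)[of "s n"] by simp
    obtain b c where "x = b + c" "measure \<mu> {b} + measure \<nu> {c} \<ge> 1 + 0"
      using heavy_pair_of_F_tendsto_0[OF z(1) zs F0[unfolded \<open>F0 = 0\<close>] nn tendsto_const] .
    then show False using x by force
  qed
  have "Im F0 > 0"
  proof -
    have "(\<lambda>n. - Im (1 / F_transform \<rho> (z (s n)))) \<longlonglongrightarrow> - Im (1 / F0)"
      by (intro tendsto_intros F0 \<open>F0 \<noteq> 0\<close>)
    then have "\<epsilon> \<le> - Im (1 / F0)"
      by (rule LIMSEQ_le_const) (use \<epsilon>(2) in \<open>auto simp: F_transform_def\<close>)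
    then have "\<epsilon> \<le> Im F0 / (norm F0)\<^sup>2" by (simp add: Im_divide cmod_power2)
    then have "0 < Im F0 / (norm F0)\<^sup>2" using \<epsilon>(1) by linarith
    then show ?thesis using \<open>F0 \<noteq> 0\<close> by (simp add: zero_less_divide_iff)
  qed
  have sum: "(\<lambda>n. \<omega>1 (z (s n)) + \<omega>2 (z (s n))) \<longlonglongrightarrow> of_real x + F0"
    using tendsto_add[OF zs F0] F_eq(3)[OF z(1)] by simp
  from convergent_subseq_or_at_infinity[of "\<lambda>n. \<omega>1 (z (s n))"]
  show ?thesis
  proof
    assume inf1: "filterlim (\<lambda>n. \<omega>1 (z (s n))) at_infinity sequentially"
    have "filterlim (\<lambda>n. - \<omega>1 (z (s n))) at_infinity sequentially"
      using inf1 by (simp add: filterlim_at_infinity[of 0])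
    from tendsto_add_filterlim_at_infinity[OF sum this]
    have inf2: "filterlim (\<lambda>n. \<omega>2 (z (s n))) at_infinity sequentially" by simp
    have "(\<lambda>n. Im (\<omega>1 (z (s n)))) \<longlonglongrightarrow> 0"
      by (rule \<mu>.Im_tendsto_0_of_cauchy_bounded_below[OF _ inf1 \<epsilon>(1)])
         (use Im_\<omega> z(1) G_ge cauchy_eq in auto)
    moreover have "(\<lambda>n. Im (\<omega>2 (z (s n)))) \<longlonglongrightarrow> 0"
      by (rule \<nu>.Im_tendsto_0_of_cauchy_bounded_below[OF _ inf2 \<epsilon>(1)])
         (use Im_\<omega> z(1) G_ge cauchy_eq in auto)
    ultimately have "(\<lambda>n. Im (\<omega>1 (z (s n)) + \<omega>2 (z (s n)))) \<longlonglongrightarrow> 0"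
      using tendsto_add by fastforce
    then have "Im (of_real x + F0) = 0" using tendsto_Im[OF sum] LIMSEQ_unique by blast
    then show ?thesis using \<open>Im F0 > 0\<close> by simp
  next
    assume "\<exists>r l. strict_mono r \<and> (\<lambda>n. \<omega>1 (z (s (r n)))) \<longlonglongrightarrow> l"
    then obtain r w1 where r: "strict_mono (r :: nat \<Rightarrow> nat)" and w1: "(\<lambda>n. \<omega>1 (z (s (r n)))) \<longlonglongrightarrow> w1" by blast
    define w2 where "w2 = of_real x + F0 - w1"
    have zr: "(\<lambda>n. z (s (r n))) \<longlonglongrightarrow> of_real x" using LIMSEQ_subseq_LIMSEQ[OF zs r] by (simp add: o_def)
    have sumr: "(\<lambda>n. \<omega>1 (z (s (r n))) + \<omega>2 (z (s (r n)))) \<longlonglongrightarrow> of_real x + F0"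
      using LIMSEQ_subseq_LIMSEQ[OF sum r] by (simp add: o_def)
    have w2: "(\<lambda>n. \<omega>2 (z (s (r n)))) \<longlonglongrightarrow> w2"
      using tendsto_diff[OF sumr w1] by (simp add: w2_def)
    have Im_ge: "Im w1 \<ge> 0" "Im w2 \<ge> 0"
      by (rule LIMSEQ_le_const[OF tendsto_Im[OF w1]] LIMSEQ_le_const[OF tendsto_Im[OF w2]];
          use Im_\<omega> z(1) less_imp_le in blast)+
    have Im_sum: "Im w1 + Im w2 = Im F0" by (simp add: w2_def)
    have e2: "w2 = of_real x + h_transform \<mu> w1" if "Im w1 > 0"
    proof -
      have "(\<lambda>n. z (s (r n)) + h_transform \<mu> (\<omega>1 (z (s (r n))))) \<longlonglongrightarrow> of_real x + h_transform \<mu> w1"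
        by (intro tendsto_add zr isCont_tendsto_compose[OF \<mu>.isCont_h_transform[OF that] w1])
      then show ?thesis using w2 \<omega>_eq(2)[OF z(1)] LIMSEQ_unique by force
    qed
    have e1: "w1 = of_real x + h_transform \<nu> w2" if "Im w2 > 0"
    proof -
      have "(\<lambda>n. z (s (r n)) + h_transform \<nu> (\<omega>2 (z (s (r n))))) \<longlonglongrightarrow> of_real x + h_transform \<nu> w2"
        by (intro tendsto_add zr isCont_tendsto_compose[OF \<nu>.isCont_h_transform[OF that] w2])
      then show ?thesis using w1 \<omega>_eq(1)[OF z(1)] LIMSEQ_unique by force
    qed
    have "Im w1 > 0 \<and> Im w2 > 0"
    proof (cases "Im w1 > 0")
      case True
      have "Im w2 = Im (of_real x + h_transform \<mu> w1)" using e2[OF True] by (rule arg_cong)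
      then show ?thesis using True Im_h_pos(1)[OF True] by simp
    next
      case False
      then have pos: "Im w2 > 0" using Im_ge Im_sum \<open>Im F0 > 0\<close> by linarith
      have "Im w1 = Im (of_real x + h_transform \<nu> w2)" using e1[OF pos] by (rule arg_cong)
      then show ?thesis using pos Im_h_pos(2)[OF pos] by simp
    qed
    then have pos: "Im w1 > 0" "Im w2 > 0" by auto
    show ?thesis
    proof (rule that[of "s \<circ> r" w1 w2])
      show "(\<lambda>n. \<omega>1 (z ((s \<circ> r) n))) \<longlonglongrightarrow> w1" "(\<lambda>n. \<omega>2 (z ((s \<circ> r) n))) \<longlonglongrightarrow> w2"
        using w1 w2 by (simp_all add: o_def)
    qed (fact strict_mono_o[OF s r] pos e1[OF pos(2)] e2[OF pos(1)])+
  qed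
qed

lemma Im_cauchy_vanishes_off_analytic_boundary:
  assumes x: "\<And>b c. x = b + c \<Longrightarrow> measure \<mu> {b} + measure \<nu> {c} < 1"
    and not_id: "\<exists>w. Im w > 0 \<and> boundary_map x w \<noteq> w"
    and off: "x \<notin> analytic_boundary \<rho>" and \<epsilon>: "\<epsilon> > 0"
  shows "\<exists>d>0. \<forall>y. 0 < y \<and> y < d \<longrightarrow> - Im (cauchy_transform \<rho> (Complex x y)) < \<epsilon>"
proof (rule ccontr)
  assume "\<not> ?thesis"
  then have "\<exists>y. 0 < y \<and> y < 1 / real (Suc n) \<and> - Im (cauchy_transform \<rho> (Complex x y)) \<ge> \<epsilon>" for n
    by (metis not_less of_nat_0_less_iff zero_less_Suc zero_less_divide_1_iff)
  then obtain y where y: "\<And>n. 0 < y n" "\<And>n. y n < 1 / real (Suc n)"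
    "\<And>n. - Im (cauchy_transform \<rho> (Complex x (y n))) \<ge> \<epsilon>" by metis
  define z where "z n = Complex x (y n)" for n
  have z: "Im (z n) > 0" for n using y(1) by (simp add: z_def)
  have "y \<longlonglongrightarrow> 0"
  proof (rule tendsto_sandwich[of "\<lambda>_. 0" _ _ "\<lambda>n. 1 / real (Suc n)"])
    show "(\<lambda>n. 1 / real (Suc n)) \<longlonglongrightarrow> 0" by real_asymp
  qed (use y(1,2) in \<open>auto intro!: always_eventually less_imp_le\<close>)
  then have zx: "z \<longlonglongrightarrow> of_real x"
    unfolding z_def by (auto intro!: tendsto_eq_intros simp: complex_of_real_def)
  have ge: "- Im (cauchy_transform \<rho> (z n)) \<ge> \<epsilon>" for n using y(3) by (simp add: z_def)
  obtain r w1 w2 where r: "strict_mono (r :: nat \<Rightarrow> nat)"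
    and w: "(\<lambda>n. \<omega>1 (z (r n))) \<longlonglongrightarrow> w1" "(\<lambda>n. \<omega>2 (z (r n))) \<longlonglongrightarrow> w2" "Im w1 > 0" "Im w2 > 0"
    and eq: "w1 = of_real x + h_transform \<nu> w2" "w2 = of_real x + h_transform \<mu> w1"
    using subordination_limits_in_half_plane[OF x z zx \<epsilon> ge] by blast
  have reg: "(deriv (F_transform \<mu>) w1 - 1) * (deriv (F_transform \<nu>) w2 - 1) \<noteq> 1"
    using boundary_map_eq_id_of_critical_point[OF w(3,4) eq] not_id by blast
  have zr: "(\<lambda>n. z (r n)) \<longlonglongrightarrow> of_real x" using LIMSEQ_subseq_LIMSEQ[OF zx r] by (simp add: o_def)
  have F1: "w1 + w2 - of_real x = F_transform \<mu> w1"
    using eq(2) by (simp add: h_transform_def)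
  have F2: "w1 + w2 - of_real x = F_transform \<nu> w2"
    using eq(1) by (simp add: h_transform_def)
  have "x \<in> analytic_boundary \<rho>"
    by (rule analytic_boundary_of_regular_limit[OF w(3,4) F1 _ reg z zr w(1,2)]) (use F1 F2 in simp)
  then show False using off by blast
qed

end

section \<open>Vanishing of the derivative of a measure\<close>

context real_distribution
begin

text \<open>The Poisson kernel at height \<open>y\<close> is at least \<open>1 / (2 y)\<close> on the interval of radius \<open>y\<close>.\<close>

lemma prob_cball_le_cauchy:
  assumes y: "y > 0"
  shows "prob (cball x y) \<le> 2 * y * - Im (cauchy_transform M (Complex x y))"
proof -
  have z: "Im (Complex x y) > 0" using y by simp
  have meas: "cball x y \<in> sets M" by simp
  have i: "integrable M (indicator (cball x y) :: real \<Rightarrow> real)"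
    using meas by (auto intro!: integrable_real_indicator simp: less_top[symmetric])
  have "1 / (2 * y\<^sup>2) * prob (cball x y) = (LINT t|M. 1 / (2 * y\<^sup>2) * indicator (cball x y) t)"
    using meas by (subst integral_mult_right_zero) simp
  also have "\<dots> \<le> cauchy_energy M (Complex x y)"
    unfolding cauchy_energy_def
  proof (rule integral_mono[OF integrable_mult_right[OF i] integrable_cauchy_kernel_sq[OF z]])
    fix t
    show "1 / (2 * y\<^sup>2) * indicator (cball x y) t \<le> 1 / (norm (Complex x y - of_real t))\<^sup>2"
    proof (cases "t \<in> cball x y")
      case True
      then have "\<bar>x - t\<bar> \<le> \<bar>y\<bar>" using y by (simp add: dist_real_def)
      then have "(x - t)\<^sup>2 \<le> y\<^sup>2" by (simp only: abs_le_square_iff)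
      moreover have "(x - t)\<^sup>2 + y\<^sup>2 > 0" using y by (intro add_nonneg_pos) auto
      ultimately have "1 / (2 * y\<^sup>2) \<le> 1 / ((x - t)\<^sup>2 + y\<^sup>2)" using y by (intro divide_left_mono mult_pos_pos) auto
      then show ?thesis using True by (simp only: Complex_minus_real_norm_sq) simp
    qed simp
  qed
  finally have "prob (cball x y) \<le> 2 * y\<^sup>2 * cauchy_energy M (Complex x y)"
    using y by (simp add: field_simps)
  then show ?thesis using Im_cauchy_transform[OF z] by (simp add: power2_eq_square)
qed

text \<open>Around each point of \<open>A\<close> choose \<open>r\<close> such that the interval of radius \<open>5 r\<close> has mass at most \<open>5 \<epsilon>\<close> times
  the length \<open>2 r\<close>. Vitali's lemma selects countably many disjoint intervals of radius \<open>r\<close> whose fivefold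
  enlargements cover \<open>A\<close>, so the mass of \<open>A\<close> is at most \<open>5 \<epsilon>\<close> times the length of a fixed bounded interval.\<close>

lemma emeasure_null_of_vanishing_density_bounded:
  assumes A: "A \<in> sets borel" "A \<subseteq> {-real n..real n}"
    and van: "\<And>x \<epsilon>. x \<in> A \<Longrightarrow> \<epsilon> > 0 \<Longrightarrow> \<exists>d>0. \<forall>y. 0 < y \<and> y < d \<longrightarrow> - Im (cauchy_transform M (Complex x y)) < \<epsilon>"
  shows "emeasure M A = 0"
proof -
  have bound: "emeasure M A \<le> ennreal (\<epsilon> * (5 * (2 * real n + 2)))" if \<epsilon>: "\<epsilon> > 0" for \<epsilon>
  proof -
    have "\<exists>r. 0 < r \<and> r \<le> 1 \<and> prob (cball x (5 * r)) \<le> 5 * \<epsilon> * (2 * r)" if "x \<in> A" for x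
    proof -
      obtain d where d: "d > 0" "\<And>y. 0 < y \<Longrightarrow> y < d \<Longrightarrow> - Im (cauchy_transform M (Complex x y)) < \<epsilon>"
        using van[OF \<open>x \<in> A\<close> \<epsilon>] by blast
      define r where "r = min 1 (d / 10)"
      have r: "0 < r" "r \<le> 1" "5 * r < d" using d by (auto simp: r_def min_def)
      have "prob (cball x (5 * r)) \<le> 2 * (5 * r) * - Im (cauchy_transform M (Complex x (5 * r)))"
        by (rule prob_cball_le_cauchy) (use r in simp)
      also have "\<dots> \<le> 2 * (5 * r) * \<epsilon>"
        using d(2)[of "5 * r"] r by (intro mult_left_mono) auto
      finally show ?thesis using r by (intro exI[of _ r]) (simp add: mult_ac)
    qed
    then obtain r where r: "\<And>x. x \<in> A \<Longrightarrow> 0 < r x" "\<And>x. x \<in> A \<Longrightarrow> r x \<le> 1"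
      "\<And>x. x \<in> A \<Longrightarrow> prob (cball x (5 * r x)) \<le> 5 * \<epsilon> * (2 * r x)" by metis
    obtain C where C: "countable C" "C \<subseteq> A"
      "pairwise (\<lambda>i j. disjnt (cball i (r i)) (cball j (r j))) C"
      "A \<subseteq> (\<Union>i\<in>C. cball i (5 * r i))"
    proof (rule Vitali_covering_lemma_cballs[where S = A and K = A and a = "\<lambda>x. x" and r = r and B = 1])
      show "A \<subseteq> (\<Union>i\<in>A. cball i (r i))" using r(1) by (force intro: less_imp_le)
    qed (use r in auto)
    \<comment> \<open>The selected intervals, enlarged by the factor \<open>s\<close> and indexed by all natural numbers; unused indices give the empty set.\<close>
  define X where "X k s = (if k \<in> to_nat_on C ` C then cball (from_nat_into C k) (s * r (from_nat_into C k)) else {})"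
      for k and s :: real
    have Xm: "X k s \<in> sets borel" for k s by (simp add: X_def)
    have inC: "from_nat_into C k \<in> C" if "k \<in> to_nat_on C ` C" for k using that C(1) by auto
    have cover: "A \<subseteq> (\<Union>k. X k 5)"
    proof
      fix x assume "x \<in> A"
      then obtain i where i: "i \<in> C" "x \<in> cball i (5 * r i)" using C(4) by blast
      then have "x \<in> X (to_nat_on C i) 5" using C(1) by (simp add: X_def)
      then show "x \<in> (\<Union>k. X k 5)" by blast
    qed
    have disj: "disjoint_family (\<lambda>k. X k 1)"
      unfolding disjoint_family_on_def
    proof (intro ballI impI)
      fix k l :: nat assume "k \<noteq> l"
      show "X k 1 \<inter> X l 1 = {}"
      proof (cases "k \<in> to_nat_on C ` C \<and> l \<in> to_nat_on C ` C")
        case True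
        then have "from_nat_into C k \<noteq> from_nat_into C l"
          using \<open>k \<noteq> l\<close> C(1) by (metis imageE from_nat_into_to_nat_on)
        then show ?thesis using C(3) inC True by (auto simp: X_def pairwise_def disjnt_def)
      qed (auto simp: X_def)
    qed
    have sub: "(\<Union>k. X k 1) \<subseteq> {- (real n + 1)..real n + 1}"
    proof
      fix t assume "t \<in> (\<Union>k. X k 1)"
      then obtain k where k: "k \<in> to_nat_on C ` C" "t \<in> cball (from_nat_into C k) (r (from_nat_into C k))"
        by (auto simp: X_def split: if_splits)
      define i where "i = from_nat_into C k"
      have "i \<in> A" using inC[OF k(1)] C(2) by (auto simp: i_def)
      then have "i \<in> {-real n..real n}" "r i \<le> 1" using A(2) r(2) by auto
      moreover have "\<bar>i - t\<bar> \<le> r i" using k(2) by (simp add: i_def dist_real_def)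
      ultimately show "t \<in> {- (real n + 1)..real n + 1}"
        unfolding atLeastAtMost_iff abs_le_iff by linarith
    qed
    have "emeasure M A \<le> emeasure M (\<Union>k. X k 5)"
      using cover Xm by (intro emeasure_mono) auto
    also have "\<dots> \<le> (\<Sum>k. emeasure M (X k 5))"
      using Xm by (intro emeasure_subadditive_countably) auto
    also have "\<dots> \<le> (\<Sum>k. ennreal (5 * \<epsilon>) * emeasure lborel (X k 1))"
    proof (rule suminf_le)
      fix k
      show "emeasure M (X k 5) \<le> ennreal (5 * \<epsilon>) * emeasure lborel (X k 1)"
      proof (cases "k \<in> to_nat_on C ` C")
        case True
        define i where "i = from_nat_into C k"
        have i: "i \<in> A" using inC[OF True] C(2) by (auto simp: i_def)
        have "emeasure M (X k 5) = ennreal (prob (cball i (5 * r i)))"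
          using True by (simp add: X_def i_def emeasure_eq_measure)
        also have "\<dots> \<le> ennreal (5 * \<epsilon> * (2 * r i))" using r(3)[OF i] by (rule ennreal_leI)
        also have "\<dots> = ennreal (5 * \<epsilon>) * ennreal (2 * r i)" using \<epsilon> r(1)[OF i] by (intro ennreal_mult) auto
        also have "ennreal (2 * r i) = emeasure lborel (X k 1)"
          using True r(1)[OF i] by (simp add: X_def i_def[symmetric] cball_eq_atLeastAtMost)
        finally show ?thesis .
      qed (simp add: X_def)
    qed auto
    also have "\<dots> = ennreal (5 * \<epsilon>) * emeasure lborel (\<Union>k. X k 1)"
      using Xm disj by (subst suminf_emeasure[symmetric]) auto
    also have "\<dots> \<le> ennreal (5 * \<epsilon>) * emeasure lborel {- (real n + 1)..real n + 1}"
      using sub by (intro mult_left_mono emeasure_mono) auto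
    also have "emeasure lborel {- (real n + 1)..real n + 1} = ennreal (2 * real n + 2)" by simp
    also have "ennreal (5 * \<epsilon>) * ennreal (2 * real n + 2) = ennreal (5 * \<epsilon> * (2 * real n + 2))"
      using \<epsilon> by (intro ennreal_mult[symmetric]) auto
    also have "5 * \<epsilon> * (2 * real n + 2) = \<epsilon> * (5 * (2 * real n + 2))" by simp
    finally show ?thesis .
  qed
  have "prob A \<le> 0"
  proof (rule field_le_epsilon)
    fix e :: real assume e: "e > 0"
    define K where "K = 5 * (2 * real n + 2)"
    have K: "K > 0" by (simp add: K_def)
    have "emeasure M A \<le> ennreal (e / K * K)" unfolding K_def by (rule bound) (use e in simp)
    then have "ennreal (prob A) \<le> ennreal e" using K by (simp add: emeasure_eq_measure)
    then show "prob A \<le> 0 + e" using e by (simp add: ennreal_le_iff)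
  qed
  then show ?thesis by (simp add: emeasure_eq_measure measure_le_0_iff)
qed

lemma emeasure_null_of_vanishing_density:
  assumes A: "A \<in> sets borel"
    and van: "\<And>x \<epsilon>. x \<in> A \<Longrightarrow> \<epsilon> > 0 \<Longrightarrow> \<exists>d>0. \<forall>y. 0 < y \<and> y < d \<longrightarrow> - Im (cauchy_transform M (Complex x y)) < \<epsilon>"
  shows "emeasure M A = 0"
proof -
  have "A \<inter> {-real n..real n} \<in> null_sets M" for n
    using emeasure_null_of_vanishing_density_bounded[of "A \<inter> {-real n..real n}" n] A van
    by (intro null_setsI) auto
  then have "(\<Union>n. A \<inter> {-real n..real n}) \<in> null_sets M" by (intro null_sets_UN') auto
  also have "(\<Union>n. A \<inter> {-real n..real n}) = A"
  proof -
    have "\<exists>n. x \<in> {-real n..real n}" for x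
    proof -
      obtain n where "\<bar>x\<bar> \<le> real n" using real_arch_simple by blast
      then have "x \<in> {-real n..real n}" unfolding abs_le_iff atLeastAtMost_iff by linarith
      then show ?thesis by blast
    qed
    then show ?thesis by blast
  qed
  finally show ?thesis by auto
qed

end

section \<open>Uniqueness of the Lebesgue decomposition\<close>

lemma countable_imp_borel: "countable (X :: real set) \<Longrightarrow> X \<in> sets borel"
  by (erule sets.countable[rotated]) simp

text \<open>On a large enough null set \<open>Z\<close> and a large enough countable set \<open>D\<close> the parts can be read off from \<open>\<sigma>\<close>: \<open>\<alpha>\<close> ignores
  \<open>Z\<close>, which carries the other two; \<open>\<beta>\<close> lives on \<open>Z\<close> and ignores \<open>D\<close>, which carries \<open>\<delta>\<close>. Uniqueness follows since
  the sets of two decompositions have a common enlargement.\<close>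

lemma lebesgue_decomposition_determined:
  assumes "lebesgue_decomposition \<sigma> \<alpha> \<beta> \<delta>"
  obtains N C where "N \<in> null_sets lborel" "countable C"
    "\<And>Z A. Z \<in> null_sets lborel \<Longrightarrow> N \<union> C \<subseteq> Z \<Longrightarrow> A \<in> sets borel \<Longrightarrow> emeasure \<alpha> A = emeasure \<sigma> (A - Z)"
    "\<And>Z D A. Z \<in> null_sets lborel \<Longrightarrow> N \<union> C \<subseteq> Z \<Longrightarrow> countable D \<Longrightarrow> C \<subseteq> D \<Longrightarrow> A \<in> sets borel \<Longrightarrow>
       emeasure \<beta> A = emeasure \<sigma> (A \<inter> Z - D)"
proof -
  note d = assms[unfolded lebesgue_decomposition_def lebesgue_singular_def]
  have sets: "sets \<alpha> = sets borel" "sets \<beta> = sets borel" "sets \<delta> = sets borel" using d by auto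
  have sum: "emeasure \<sigma> A = emeasure \<alpha> A + emeasure \<beta> A + emeasure \<delta> A" if "A \<in> sets borel" for A
    using d that by blast
  have ac: "emeasure \<alpha> Z = 0" if "Z \<in> null_sets lborel" for Z
    using d that by (auto simp: absolutely_continuous_def null_sets_def)
  obtain N where N: "N \<in> null_sets lborel" "emeasure \<beta> (UNIV - N) = 0" using d by blast
  obtain C where C: "countable C" "emeasure \<delta> (UNIV - C) = 0" using d by blast
  have Nb: "N \<in> sets borel" using N(1) by (auto simp: null_sets_def)
  note cb = countable_imp_borel
  have \<beta>0: "emeasure \<beta> A = 0" if "A \<in> sets borel" "A \<inter> N = {}" for A
  proof -
    have "emeasure \<beta> A \<le> emeasure \<beta> (UNIV - N)" using that Nb sets by (intro emeasure_mono) auto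
    then show ?thesis using N(2) by simp
  qed
  have \<beta>c: "emeasure \<beta> D = 0" if "countable D" for D
  proof -
    have "emeasure \<beta> D = (\<integral>\<^sup>+x. emeasure \<beta> {x} \<partial>count_space D)"
      using that sets by (intro emeasure_countable_singleton) auto
    then show ?thesis using d by simp
  qed
  have \<delta>0: "emeasure \<delta> A = 0" if "A \<in> sets borel" "A \<inter> C = {}" for A
  proof -
    have "emeasure \<delta> A \<le> emeasure \<delta> (UNIV - C)" using that cb[OF C(1)] sets by (intro emeasure_mono) auto
    then show ?thesis using C(2) by simp
  qed
  show ?thesis
  proof (rule that[OF N(1) C(1)])
    fix Z A :: "real set" assume Z: "Z \<in> null_sets lborel" "N \<union> C \<subseteq> Z" and A: "A \<in> sets borel"
    have Zb: "Z \<in> sets borel" using Z by (auto simp: null_sets_def)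
    have AZ: "A - Z \<in> sets borel" using A Zb by auto
    have "emeasure \<sigma> (A - Z) = emeasure \<alpha> (A - Z)"
      using sum[OF AZ] \<beta>0[OF AZ] \<delta>0[OF AZ] Z(2) by auto
    also have "\<dots> = emeasure \<alpha> A"
      using Z(1) ac Zb A sets by (intro emeasure_Diff_null_set) (auto simp: null_sets_def)
    finally show "emeasure \<alpha> A = emeasure \<sigma> (A - Z)" by simp
    fix D :: "real set" assume D: "countable D" "C \<subseteq> D"
    have Db: "D \<in> sets borel" by (rule cb[OF D(1)])
    have AD: "A \<inter> Z - D \<in> sets borel" using A Zb Db by auto
    have "emeasure \<alpha> (A \<inter> Z - D) \<le> emeasure \<alpha> Z" using Zb sets by (intro emeasure_mono) auto
    then have "emeasure \<sigma> (A \<inter> Z - D) = emeasure \<beta> (A \<inter> Z - D)"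
      using sum[OF AD] ac[OF Z(1)] \<delta>0[OF AD] D(2) by auto
    also have "\<dots> = emeasure \<beta> (A \<inter> Z)"
      using \<beta>c[OF D(1)] Db A Zb sets by (intro emeasure_Diff_null_set) (auto simp: null_sets_def)
    also have "\<dots> = emeasure \<beta> A"
    proof -
      have "emeasure \<beta> A = emeasure \<beta> (A \<inter> Z) + emeasure \<beta> (A - Z)"
        using A Zb sets by (subst plus_emeasure) (auto intro!: arg_cong[where f = "emeasure \<beta>"])
      moreover have "emeasure \<beta> (A - Z) = 0" using \<beta>0[OF AZ] Z(2) by auto
      ultimately show ?thesis by simp
    qed
    finally show "emeasure \<beta> A = emeasure \<sigma> (A \<inter> Z - D)" by simp
  qed
qed

lemma lebesgue_decomposition_unique:
  assumes 1: "lebesgue_decomposition \<sigma> \<alpha> \<beta> \<delta>" and 2: "lebesgue_decomposition \<sigma> \<alpha>' \<beta>' \<delta>'"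
  shows "\<alpha> = \<alpha>'" "\<beta> = \<beta>'"
proof -
  obtain N C where N: "N \<in> null_sets lborel" "countable C"
    and a: "\<And>Z A. Z \<in> null_sets lborel \<Longrightarrow> N \<union> C \<subseteq> Z \<Longrightarrow> A \<in> sets borel \<Longrightarrow> emeasure \<alpha> A = emeasure \<sigma> (A - Z)"
    and b: "\<And>Z D A. Z \<in> null_sets lborel \<Longrightarrow> N \<union> C \<subseteq> Z \<Longrightarrow> countable D \<Longrightarrow> C \<subseteq> D \<Longrightarrow> A \<in> sets borel \<Longrightarrow>
       emeasure \<beta> A = emeasure \<sigma> (A \<inter> Z - D)"
    using lebesgue_decomposition_determined[OF 1] by metis
  obtain N' C' where N': "N' \<in> null_sets lborel" "countable C'"
    and a': "\<And>Z A. Z \<in> null_sets lborel \<Longrightarrow> N' \<union> C' \<subseteq> Z \<Longrightarrow> A \<in> sets borel \<Longrightarrow> emeasure \<alpha>' A = emeasure \<sigma> (A - Z)"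
    and b': "\<And>Z D A. Z \<in> null_sets lborel \<Longrightarrow> N' \<union> C' \<subseteq> Z \<Longrightarrow> countable D \<Longrightarrow> C' \<subseteq> D \<Longrightarrow> A \<in> sets borel \<Longrightarrow>
       emeasure \<beta>' A = emeasure \<sigma> (A \<inter> Z - D)"
    using lebesgue_decomposition_determined[OF 2] by metis
  define Z where "Z = N \<union> N' \<union> (C \<union> C')"
  have "C \<union> C' \<in> null_sets lborel" using N N' by (intro countable_imp_null_set_lborel) auto
  from null_sets.Un[OF null_sets.Un[OF N(1) N'(1)] this]
  have Z: "Z \<in> null_sets lborel" unfolding Z_def .
  have sub: "N \<union> C \<subseteq> Z" "N' \<union> C' \<subseteq> Z" by (auto simp: Z_def)
  have sets: "sets \<alpha> = sets borel" "sets \<beta> = sets borel" "sets \<alpha>' = sets borel" "sets \<beta>' = sets borel"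
    using 1 2 by (auto simp: lebesgue_decomposition_def)
  show "\<alpha> = \<alpha>'"
    by (rule measure_eqI) (use sets a[OF Z sub(1)] a'[OF Z sub(2)] in auto)
  show "\<beta> = \<beta>'"
    by (rule measure_eqI)
       (use sets b[OF Z sub(1), of "C \<union> C'"] b'[OF Z sub(2), of "C \<union> C'"] N N' in auto)
qed

lemma parts_of_lebesgue_decomposition:
  assumes "lebesgue_decomposition \<sigma> \<alpha> \<beta> \<delta>"
  shows "ac_part \<sigma> = \<alpha>" "sc_part \<sigma> = \<beta>"
  unfolding ac_part_def sc_part_def
  using assms lebesgue_decomposition_unique by (auto intro!: the_equality)

section \<open>Analyticity of the boundary density\<close>

text \<open>The Taylor series of the continuation \<open>h\<close> at \<open>x\<close> converges, and \<open>- Im / \<pi>\<close> of its coefficients gives a real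
  power series for the density, because the increments along the line are real.\<close>

lemma real_analytic_boundary_density:
  "real_analytic_on (boundary_density \<sigma>) (analytic_boundary \<sigma>)"
  unfolding real_analytic_on_def
proof
  fix x assume "x \<in> analytic_boundary \<sigma>"
  then obtain r h where rh: "analytic_boundary_at \<sigma> x r h" by (auto simp: analytic_boundary_def)
  then have r: "r > 0" "h holomorphic_on ball (of_real x) r" by (auto simp: analytic_boundary_at_def)
  have "h analytic_on {of_real x}"
    using r by (auto simp: analytic_at intro!: exI[of _ "ball (of_real x) r"])
  then have Q: "(\<lambda>z. h (of_real x + z)) has_fps_expansion fps_expansion h (of_real x)"
    by (rule analytic_at_imp_has_fps_expansion)
  define Q where "Q = fps_expansion h (of_real x)"
  have Q_conv: "fps_conv_radius Q > 0" and Q_ev: "\<forall>\<^sub>F z in nhds 0. eval_fps Q z = h (of_real x + z)"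
    using Q by (auto simp: has_fps_expansion_def Q_def)
  define P where "P = Abs_fps (\<lambda>n. - Im (fps_nth Q n) / pi)"
  have sums: "(\<lambda>n. fps_nth P n * s ^ n) sums (- Im (eval_fps Q (of_real s)) / pi)"
    if "ereal \<bar>s\<bar> < fps_conv_radius Q" for s :: real
  proof -
    have "(\<lambda>n. fps_nth Q n * of_real s ^ n) sums eval_fps Q (of_real s)"
      by (rule sums_eval_fps) (use that in simp)
    then have "(\<lambda>n. Im (fps_nth Q n * of_real s ^ n)) sums Im (eval_fps Q (of_real s))"
      by (rule sums_Im)
    then have "(\<lambda>n. - Im (fps_nth Q n * of_real s ^ n) / pi) sums (- Im (eval_fps Q (of_real s)) / pi)"
      by (intro sums_divide sums_minus)
    moreover have "- Im (fps_nth Q n * of_real s ^ n) / pi = fps_nth P n * s ^ n" for n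
      by (simp add: P_def flip: of_real_power)
    ultimately show ?thesis by simp
  qed
  obtain s0 where s0: "0 < ereal s0" "ereal s0 < fps_conv_radius Q"
    using ereal_dense2[OF Q_conv] by (auto simp: zero_ereal_def)
  then have s0_pos: "s0 > 0" by simp
  have P_conv: "fps_conv_radius P > 0"
  proof -
    have "summable (\<lambda>n. fps_nth P n * s0 ^ n)" using sums[of s0] s0 s0_pos by (auto simp: sums_iff)
    then have "conv_radius (fps_nth P) \<ge> norm s0" by (rule conv_radius_geI)
    then show ?thesis unfolding fps_conv_radius_def using s0_pos less_le_trans[of 0 "ereal (norm s0)"] by simp
  qed
  have "filterlim (complex_of_real) (nhds 0) (nhds 0)"
    using tendsto_of_real[OF filterlim_ident[of "nhds (0::real)"]] by simp
  from eventually_compose_filterlim[OF Q_ev this]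
  have "\<forall>\<^sub>F s in nhds (0::real). eval_fps Q (of_real s) = h (of_real x + of_real s)" .
  moreover have "\<forall>\<^sub>F s in nhds (0::real). s \<in> ball 0 (min r s0)"
    using r s0_pos by (intro eventually_nhds_in_open) auto
  ultimately have "\<forall>\<^sub>F s in nhds (0::real). eval_fps P s = boundary_density \<sigma> (x + s)"
  proof eventually_elim
    case (elim s)
    then have s: "\<bar>s\<bar> < r" "\<bar>s\<bar> < s0" by auto
    then have "ereal \<bar>s\<bar> < fps_conv_radius Q" using s0(2) less_trans[of "ereal \<bar>s\<bar>" "ereal s0"] by simp
    then have "eval_fps P s = - Im (eval_fps Q (of_real s)) / pi"
      unfolding eval_fps_def[of P] using sums by (simp add: sums_iff)
    also have "\<dots> = - Im (h (of_real (x + s))) / pi" using elim(1) by simp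
    also have "\<dots> = boundary_density \<sigma> (x + s)" using boundary_density_eq[OF rh, of "x + s"] s by simp
    finally show ?case .
  qed
  then show "\<exists>P. (\<lambda>h. boundary_density \<sigma> (x + h)) has_fps_expansion P"
    using P_conv by (auto simp: has_fps_expansion_def)
qed

section \<open>The Lebesgue decomposition of the free convolution\<close>

lemma emeasure_countable_mono:
  fixes X :: "real set"
  assumes "countable X" "sets \<sigma> = sets borel" "sets \<tau> = sets borel"
    and "\<And>x. x \<in> X \<Longrightarrow> emeasure \<sigma> {x} \<le> emeasure \<tau> {x}"
  shows "emeasure \<sigma> X \<le> emeasure \<tau> X"
proof -
  have "emeasure \<sigma> X = (\<integral>\<^sup>+x. emeasure \<sigma> {x} \<partial>count_space X)"
    using assms by (intro emeasure_countable_singleton) auto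
  also have "\<dots> \<le> (\<integral>\<^sup>+x. emeasure \<tau> {x} \<partial>count_space X)"
    using assms(4) by (intro nn_integral_mono) auto
  also have "\<dots> = emeasure \<tau> X"
    using assms by (intro emeasure_countable_singleton[symmetric]) auto
  finally show ?thesis .
qed

context subordination
begin

definition heavy_sums :: "real set"
  where "heavy_sums = {b + c |b c. measure \<mu> {b} + measure \<nu> {c} \<ge> 1}"

text \<open>No single atom has mass \<open>1\<close>, so both entries of a heavy pair are atoms.\<close>

lemma countable_heavy_sums: "countable heavy_sums"
proof -
  have "heavy_sums \<subseteq> (\<lambda>(b, c). b + c) ` ({b. measure \<mu> {b} > 0} \<times> {c. measure \<nu> {c} > 0})"
  proof
    fix x assume "x \<in> heavy_sums"
    then obtain b c where bc: "x = b + c" "measure \<mu> {b} + measure \<nu> {c} \<ge> 1" by (auto simp: heavy_sums_def)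
    have "measure \<mu> {b} < 1" "measure \<nu> {c} < 1"
      using \<mu>.prob_singleton_less_1 \<nu>.prob_singleton_less_1 \<mu>_not_return \<nu>_not_return by auto
    then have "measure \<mu> {b} > 0" "measure \<nu> {c} > 0" using bc(2) by linarith+
    then show "x \<in> (\<lambda>(b, c). b + c) ` ({b. measure \<mu> {b} > 0} \<times> {c. measure \<nu> {c} > 0})"
      using bc(1) by auto
  qed
  then show ?thesis
    by (rule countable_subset) (intro countable_image countable_SIGMA \<mu>.countable_atoms \<nu>.countable_atoms)
qed

lemma emeasure_singleton_off_heavy_sums: "x \<notin> heavy_sums \<Longrightarrow> emeasure \<rho> {x} = 0"
  using atom_iff[of x] by (fastforce simp: heavy_sums_def \<rho>.emeasure_eq_measure zero_less_measure_iff)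

text \<open>Apart from the exceptional point where the boundary map is the identity, every point of this set has vanishing
  \<open>Im G\<close>. The exceptional point, if it is not a heavy sum, is not an atom.\<close>

lemma emeasure_off_boundary_and_heavy_sums: "emeasure \<rho> (UNIV - analytic_boundary \<rho> - heavy_sums) = 0"
proof -
  \<comment> \<open>The exceptional set; it has at most one element.\<close>
  define X0 where "X0 = {x. \<forall>w. Im w > 0 \<longrightarrow> boundary_map x w = w}"
  have X0: "X0 = {} \<or> (\<exists>x0. X0 = {x0})"
    using boundary_map_eq_id_unique unfolding X0_def by blast
  have meas: "heavy_sums \<in> sets borel" "analytic_boundary \<rho> \<in> sets borel" "X0 \<in> sets borel"
    using countable_heavy_sums open_analytic_boundary X0
    by (auto intro: countable_imp_borel)
  have "emeasure \<rho> (UNIV - analytic_boundary \<rho> - heavy_sums - X0) = 0"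
  proof (rule \<rho>.emeasure_null_of_vanishing_density)
    show "UNIV - analytic_boundary \<rho> - heavy_sums - X0 \<in> sets borel" using meas by auto
    fix x and \<epsilon> :: real
    assume x: "x \<in> UNIV - analytic_boundary \<rho> - heavy_sums - X0" and \<epsilon>: "\<epsilon> > 0"
    show "\<exists>d>0. \<forall>y. 0 < y \<and> y < d \<longrightarrow> - Im (cauchy_transform \<rho> (Complex x y)) < \<epsilon>"
    proof (rule Im_cauchy_vanishes_off_analytic_boundary[OF _ _ _ \<epsilon>])
      show "measure \<mu> {b} + measure \<nu> {c} < 1" if "x = b + c" for b c
        using x that by (force simp: heavy_sums_def not_less)
    qed (use x in \<open>auto simp: X0_def\<close>)
  qed
  moreover have "emeasure \<rho> (X0 - heavy_sums) = 0"
    using X0 emeasure_singleton_off_heavy_sums by (auto simp: insert_Diff_if)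
  ultimately have "emeasure \<rho> ((UNIV - analytic_boundary \<rho> - heavy_sums - X0) \<union> (X0 - heavy_sums)) = 0"
    using meas by (intro emeasure_Un_null_set[THEN trans]) (auto intro!: null_setsI)
  moreover have "emeasure \<rho> (UNIV - analytic_boundary \<rho> - heavy_sums)
      \<le> emeasure \<rho> ((UNIV - analytic_boundary \<rho> - heavy_sums - X0) \<union> (X0 - heavy_sums))"
    using meas by (intro emeasure_mono) auto
  ultimately show ?thesis by simp
qed

text \<open>If all pairs heavier than \<open>1\<close> have the same first entry \<open>b\<close>, then each atom \<open>b + c\<close> of \<open>\<rho>\<close> is dominated by the atom
  \<open>c\<close> of \<open>\<nu>\<close> translated by \<open>b\<close>, with the definite loss \<open>1 - \<mu>({b}) > 0\<close> at one atom at least.\<close>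

lemma emeasure_countable_less_1_common_summand:
  assumes X: "countable X" and bc: "measure \<mu> {b} + measure \<nu> {c0} > 1" and x0: "b + c0 \<in> X"
    and star: "\<And>b' c'. measure \<mu> {b'} + measure \<nu> {c'} > 1 \<Longrightarrow> b' = b"
  shows "emeasure \<rho> X < 1"
proof -
  \<comment> \<open>The translate of \<open>\<nu>\<close> by \<open>b\<close>, which dominates \<open>\<rho>\<close> on singletons.\<close>
  define \<tau> where "\<tau> = distr \<nu> borel (\<lambda>t. b + t)"
  have \<tau>: "real_distribution \<tau>" unfolding \<tau>_def by (rule \<nu>.real_distribution_distr) auto
  interpret \<tau>: real_distribution \<tau> by (rule \<tau>)
  have Xb: "X \<in> sets borel" using X by (rule countable_imp_borel)
  have \<tau>_single: "measure \<tau> {b + c} = measure \<nu> {c}" for c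
  proof -
    have "(\<lambda>t. b + t) -` {b + c} = {c}" by auto
    then show ?thesis unfolding \<tau>_def by (subst measure_distr) auto
  qed
  have \<mu>b: "measure \<mu> {b} < 1" using \<mu>.prob_singleton_less_1 \<mu>_not_return by auto
  have dom: "measure \<rho> {x} \<le> measure \<tau> {x}" for x
  proof (cases "measure \<rho> {x} > 0")
    case True
    then obtain b' c' where b': "x = b' + c'" "measure \<mu> {b'} + measure \<nu> {c'} > 1" using atom_iff by blast
    then have "b' = b" using star by blast
    then show ?thesis using atom_formula[OF b'(2)] b'(1) \<tau>_single[of c'] \<mu>b by simp
  next
    case False
    then show ?thesis by (simp add: not_less measure_le_0_iff)
  qed
  let ?x0 = "b + c0"
  have "emeasure \<rho> (X - {?x0}) \<le> emeasure \<tau> (X - {?x0})"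
    by (rule emeasure_countable_mono) (use X dom in \<open>simp_all add: \<rho>.emeasure_eq_measure \<tau>.emeasure_eq_measure\<close>)
  then have "measure \<rho> (X - {?x0}) \<le> measure \<tau> (X - {?x0})"
    by (simp add: \<rho>.emeasure_eq_measure \<tau>.emeasure_eq_measure)
  moreover have "measure \<rho> X = measure \<rho> {?x0} + measure \<rho> (X - {?x0})"
    using \<rho>.finite_measure_Diff[of X "{?x0}"] Xb x0 by simp
  moreover have "measure \<tau> X = measure \<tau> {?x0} + measure \<tau> (X - {?x0})"
    using \<tau>.finite_measure_Diff[of X "{?x0}"] Xb x0 by simp
  moreover have "measure \<rho> {?x0} = measure \<mu> {b} + measure \<tau> {?x0} - 1"
    using atom_formula[OF bc] \<tau>_single[of c0] by simp
  moreover have "measure \<tau> X \<le> 1" by (rule \<tau>.prob_le_1)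
  ultimately have "measure \<rho> X < 1" using \<mu>b by linarith
  then show ?thesis by (simp add: \<rho>.emeasure_eq_measure)
qed

text \<open>Two pairs heavier than \<open>1\<close> share an entry, because otherwise the four masses would add up to at most \<open>2\<close>. A family of
  pairs any two of which share an entry has a common first or a common second entry.\<close>

lemma emeasure_countable_less_1:
  assumes X: "countable X" shows "emeasure \<rho> X < 1"
proof (cases "\<exists>x\<in>X. measure \<rho> {x} > 0")
  case False
  then have "emeasure \<rho> {x} = 0" if "x \<in> X" for x
    using that by (simp add: \<rho>.emeasure_eq_measure not_less measure_le_0_iff)
  moreover have "emeasure \<rho> X = (\<integral>\<^sup>+x. emeasure \<rho> {x} \<partial>count_space X)"
    using X by (intro emeasure_countable_singleton) auto
  ultimately have "emeasure \<rho> X = 0" by (simp add: nn_integral_0_iff_AE AE_count_space)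
  then show ?thesis by simp
next
  case True
  then obtain x where "x \<in> X" "measure \<rho> {x} > 0" by blast
  then obtain b c where bc: "b + c \<in> X" "measure \<mu> {b} + measure \<nu> {c} > 1" using atom_iff[of x] by blast
  have share: "b1 = b2 \<or> c1 = c2" if "measure \<mu> {b1} + measure \<nu> {c1} > 1" "measure \<mu> {b2} + measure \<nu> {c2} > 1" for b1 b2 c1 c2
    using that \<mu>.prob_two_points[of b1 b2] \<nu>.prob_two_points[of c1 c2] by force
  show ?thesis
  proof (cases "\<forall>b' c'. measure \<mu> {b'} + measure \<nu> {c'} > 1 \<longrightarrow> b' = b")
    case True
    then show ?thesis using emeasure_countable_less_1_common_summand[OF X bc(2,1)] by blast
  next
    case False
    then obtain b1 c1 where 1: "measure \<mu> {b1} + measure \<nu> {c1} > 1" "b1 \<noteq> b" by blast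
    have star: "c' = c" if p: "measure \<mu> {b'} + measure \<nu> {c'} > 1" for b' c'
      using share[OF p bc(2)] share[OF p 1(1)] share[OF 1(1) bc(2)] 1(2) by blast
    interpret sw: subordination \<nu> \<mu> \<rho> \<omega>2 \<omega>1 by (rule swap)
    show ?thesis
    proof (rule sw.emeasure_countable_less_1_common_summand[OF X, of c b])
      show "measure \<nu> {c} + measure \<mu> {b} > 1" "c + b \<in> X" using bc by (simp_all add: add.commute)
      show "c' = c" if "measure \<nu> {c'} + measure \<mu> {b'} > 1" for c' b'
        using star[of b' c'] that by (simp add: add.commute)
    qed
  qed
qed

lemma lebesgue_decomposition_free_conv:
  "lebesgue_decomposition \<rho>
     (density lborel (\<lambda>x. ennreal (boundary_density \<rho> x) * indicator (analytic_boundary \<rho>) x))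
     (null_measure borel)
     (density \<rho> (indicator (heavy_sums - analytic_boundary \<rho>)))"
proof -
  let ?U = "analytic_boundary \<rho>" and ?E = "heavy_sums"
  let ?f = "\<lambda>x. ennreal (boundary_density \<rho> x) * indicator ?U x"
  have meas: "?E \<in> sets borel" "?U \<in> sets borel"
    using countable_heavy_sums open_analytic_boundary by (auto intro: countable_imp_borel)
  have EU: "?E - ?U \<in> sets borel" using meas by auto
  have \<alpha>: "emeasure (density lborel ?f) A = emeasure \<rho> (A \<inter> ?U)" if A: "A \<in> sets borel" for A
  proof -
    have "emeasure (density lborel ?f) A = (\<integral>\<^sup>+x. ?f x * indicator A x \<partial>lborel)"
      using A \<rho>.borel_measurable_boundary_density by (subst emeasure_density) auto
    also have "\<dots> = (\<integral>\<^sup>+x. ennreal (boundary_density \<rho> x) * indicator (A \<inter> ?U) x \<partial>lborel)"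
      by (intro nn_integral_cong) (auto simp: indicator_def)
    also have "\<dots> = emeasure \<rho> (A \<inter> ?U)"
      using A meas by (intro \<rho>.emeasure_analytic_boundary[symmetric]) auto
    finally show ?thesis .
  qed
  have \<delta>: "emeasure (density \<rho> (indicator (?E - ?U))) A = emeasure \<rho> (A \<inter> (?E - ?U))" if A: "A \<in> sets borel" for A
  proof -
    have "emeasure (density \<rho> (indicator (?E - ?U))) A = (\<integral>\<^sup>+x. indicator (?E - ?U) x * indicator A x \<partial>\<rho>)"
      using A EU by (subst emeasure_density) auto
    also have "\<dots> = (\<integral>\<^sup>+x. indicator (A \<inter> (?E - ?U)) x \<partial>\<rho>)"
      by (intro nn_integral_cong) (auto simp: indicator_def)
    also have "\<dots> = emeasure \<rho> (A \<inter> (?E - ?U))" using A EU by (intro nn_integral_indicator) auto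
    finally show ?thesis .
  qed
  have sum: "emeasure \<rho> A = emeasure \<rho> (A \<inter> ?U) + emeasure \<rho> (A \<inter> (?E - ?U))" if A: "A \<in> sets borel" for A
  proof -
    have "emeasure \<rho> (A \<inter> ?U) + emeasure \<rho> (A \<inter> (?E - ?U)) = emeasure \<rho> ((A \<inter> ?U) \<union> (A \<inter> (?E - ?U)))"
      using A meas by (intro plus_emeasure) auto
    also have "(A \<inter> ?U) \<union> (A \<inter> (?E - ?U)) = A - (UNIV - ?U - ?E)" by auto
    also have "emeasure \<rho> (A - (UNIV - ?U - ?E)) = emeasure \<rho> A"
      using emeasure_off_boundary_and_heavy_sums A meas by (intro emeasure_Diff_null_set) (auto intro!: null_setsI)
    finally show ?thesis by simp
  qed
  have "absolutely_continuous lborel (density lborel ?f)"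
    by (rule absolutely_continuousI_density) (use \<rho>.borel_measurable_boundary_density in simp)
  moreover have "emeasure (density \<rho> (indicator (?E - ?U))) (UNIV - ?E) = 0"
  proof -
    have "(UNIV - ?E) \<inter> (?E - ?U) = {}" by auto
    then show ?thesis using \<delta>[of "UNIV - ?E"] meas by simp
  qed
  ultimately show ?thesis
    unfolding lebesgue_decomposition_def lebesgue_singular_def
    using sum \<alpha> \<delta> countable_heavy_sums by auto
qed

end

theorem theorem4p1:
  fixes \<mu> \<nu> :: "real measure"
  assumes "real_distribution \<mu>" and "real_distribution \<nu>"
    and "\<And>a. \<mu> \<noteq> return borel a" and "\<And>a. \<nu> \<noteq> return borel a"
  shows
    "(\<forall>a. (measure (free_conv \<mu> \<nu>) {a} > 0 \<longleftrightarrow>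
            (\<exists>b c. a = b + c \<and> measure \<mu> {b} + measure \<nu> {c} > 1)) \<and>
          (\<forall>b c. a = b + c \<and> measure \<mu> {b} + measure \<nu> {c} > 1 \<longrightarrow>
            measure (free_conv \<mu> \<nu>) {a} = measure \<mu> {b} + measure \<nu> {c} - 1)) \<and>
     (ac_part (free_conv \<mu> \<nu>) \<noteq> null_measure borel \<and>
      (\<exists>U. open U \<and>
           has_analytic_version_on (RN_deriv lborel (ac_part (free_conv \<mu> \<nu>))) U \<and>
           emeasure (ac_part (free_conv \<mu> \<nu>)) UNIV =
             (\<integral>\<^sup>+x\<in>U. RN_deriv lborel (ac_part (free_conv \<mu> \<nu>)) x \<partial>lborel))) \<and>
     sc_part (free_conv \<mu> \<nu>) = null_measure borel"
proof -
  obtain \<omega>1 \<omega>2 where "subordination \<mu> \<nu> (free_conv \<mu> \<nu>) \<omega>1 \<omega>2"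
    using subordination_free_conv[OF assms(1,3,2,4)] .
  then interpret subordination \<mu> \<nu> "free_conv \<mu> \<nu>" \<omega>1 \<omega>2 .
  let ?\<rho> = "free_conv \<mu> \<nu>"
  let ?U = "analytic_boundary ?\<rho>"
  define f where "f x = ennreal (boundary_density ?\<rho> x) * indicator ?U x" for x
  have fm: "f \<in> borel_measurable lborel"
    using \<rho>.borel_measurable_boundary_density by (simp add: f_def[abs_def])
  have ac: "ac_part ?\<rho> = density lborel f" and sc: "sc_part ?\<rho> = null_measure borel"
    using parts_of_lebesgue_decomposition[OF lebesgue_decomposition_free_conv] by (simp_all add: f_def[abs_def])
  have meas: "heavy_sums \<in> sets borel" "?U \<in> sets borel"
    using countable_heavy_sums open_analytic_boundary by (auto intro: countable_imp_borel)
  have total: "emeasure (density lborel f) UNIV = (\<integral>\<^sup>+x. f x \<partial>lborel)"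
    using fm by (simp add: emeasure_density)
  have total': "(\<integral>\<^sup>+x. f x \<partial>lborel) = emeasure ?\<rho> ?U"
    unfolding f_def using meas by (intro \<rho>.emeasure_analytic_boundary[symmetric]) auto
  have RN: "AE x in lborel. f x = RN_deriv lborel (ac_part ?\<rho>) x"
    by (rule sigma_finite_measure.RN_deriv_unique[OF sigma_finite_lborel fm ac[symmetric]])
  have nonzero: "ac_part ?\<rho> \<noteq> null_measure borel"
  proof
    assume "ac_part ?\<rho> = null_measure borel"
    then have "emeasure ?\<rho> ?U = 0" using total total' ac by simp
    then have "emeasure ?\<rho> (?U \<union> (UNIV - ?U - heavy_sums)) = 0"
      using emeasure_off_boundary_and_heavy_sums meas
      by (intro emeasure_Un_null_set[THEN trans]) (auto intro!: null_setsI)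
    moreover have "emeasure ?\<rho> UNIV \<le> emeasure ?\<rho> (?U \<union> (UNIV - ?U - heavy_sums)) + emeasure ?\<rho> heavy_sums"
    proof -
      have "emeasure ?\<rho> UNIV \<le> emeasure ?\<rho> ((?U \<union> (UNIV - ?U - heavy_sums)) \<union> heavy_sums)"
        using meas by (intro emeasure_mono) auto
      also have "\<dots> \<le> emeasure ?\<rho> (?U \<union> (UNIV - ?U - heavy_sums)) + emeasure ?\<rho> heavy_sums"
        using meas by (intro emeasure_subadditive) auto
      finally show ?thesis .
    qed
    ultimately show False
      using emeasure_countable_less_1[OF countable_heavy_sums] \<rho>.emeasure_space_1 by (simp add: not_le[symmetric])
  qed
  have analytic: "has_analytic_version_on (RN_deriv lborel (ac_part ?\<rho>)) ?U"
    unfolding has_analytic_version_on_def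
  proof (intro exI conjI ballI)
    show "real_analytic_on (boundary_density ?\<rho>) ?U" by (rule real_analytic_boundary_density)
    show "0 \<le> boundary_density ?\<rho> x" if "x \<in> ?U" for x using boundary_density_pos[OF that] by simp
    show "AE x in lborel. x \<in> ?U \<longrightarrow> RN_deriv lborel (ac_part ?\<rho>) x = ennreal (boundary_density ?\<rho> x)"
      using RN by eventually_elim (auto simp: f_def)
  qed
  have mass: "emeasure (ac_part ?\<rho>) UNIV = (\<integral>\<^sup>+x\<in>?U. RN_deriv lborel (ac_part ?\<rho>) x \<partial>lborel)"
  proof -
    have "(\<integral>\<^sup>+x. f x \<partial>lborel) = (\<integral>\<^sup>+x\<in>?U. RN_deriv lborel (ac_part ?\<rho>) x \<partial>lborel)"
    proof (rule nn_integral_cong_AE)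
      show "AE x in lborel. f x = RN_deriv lborel (ac_part ?\<rho>) x * indicator ?U x"
        using RN by eventually_elim (auto simp: f_def indicator_def split: if_splits)
    qed
    then show ?thesis using total ac by simp
  qed
  have atoms: "\<forall>a. (measure ?\<rho> {a} > 0 \<longleftrightarrow> (\<exists>b c. a = b + c \<and> measure \<mu> {b} + measure \<nu> {c} > 1)) \<and>
          (\<forall>b c. a = b + c \<and> measure \<mu> {b} + measure \<nu> {c} > 1 \<longrightarrow>
            measure ?\<rho> {a} = measure \<mu> {b} + measure \<nu> {c} - 1)"
    by (intro allI conjI impI atom_iff) (use atom_formula in auto)
  show ?thesis
    by (intro conjI exI[of _ ?U]) (fact atoms nonzero open_analytic_boundary analytic mass sc)+
qed

end
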